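(* Let $\Gamma\subset\mathbb{R}^3$ be a semialgebraic graph. The following statements are equivalent. (a) The graph $\Gamma$ is tight. (b) The intersection of $\Gamma$ with almost any closed half-space of $\mathbb{R}^3$ is either empty or connected. (c) The intersection of $\Gamma$ with any closed half-space of $\mathbb{R}^3$ is either empty or connected.
   Context: A semialgebraic graph is a compact connected one-dimensional semialgebraic set $\Gamma\subset\mathbb{R}^3$ together with a finite subset $V\subset\Gamma$ (the vertices) such that $\Gamma\setminus V$ is a finite disjoint union of real analytic, bounded semialgebraic arcs without self-intersections, each connecting two different points of $V$ (the open edges). Multiple edges between two vertices are allowed. $b_1(\Gamma)$ is the first Betti number. For $p\in\Gamma$, $\mathbf{N}_p\subset S^2$ is the finite set of all limits $\lim_k \frac{q_k-p}{|q_k-p|}$ with $q_k\in\Gamma\setminus\{p\}$, $q_k\to p$. For $u\in S^2$ let $h_u(x)=(u,x)$ (Euclidean inner product). Closed half-spaces are the sets $\{h_u\le c\}$ with $(u,c)\in S^2\times\mathbb{R}$; "almost any" means for all $(u,c)$ outside a set of measure zero in $S^2\times\mathbb{R}$. A vector $u\in S^2$ is $\Gamma$-nondegenerate if the restriction of $h_u$ to each open edge has only nondegenerate critical points and $(u,\tau)\ne0$ for all $v\in V$, $\tau\in\mathbf{N}_v$; $\Delta_\Gamma\subset S^2$ is the set of vectors that are not $\Gamma$-nondegenerate. For nondegenerate $u$ and $p\in\Gamma$, $d^-_p(u)$ is the number of $q\in\Gamma$ with $|p-q|=\varepsilon$ and $h_u(q)<h_u(p)$, for all sufficiently small $\varepsilon>0$.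 Put $w(p,u)=1$ if $p$ is a local minimum of $h_u|_\Gamma$ and $w(p,u)=d^-_p(u)-1$ otherwise; let $w_\Gamma(u)=\sum_{p\in\Gamma}w(p,u)$ (only finitely many nonzero terms). The graph $\Gamma$ is tight if $w_\Gamma(u)=1+b_1(\Gamma)$ for all $u\in S^2\setminus\Delta_\Gamma$. *)

theory Defs
  imports "HOL-Analysis.Analysis" "HOL-Homology.Homology"
begin

section \<open>Semialgebraic sets\<close>

inductive semialgebraic :: "'a::euclidean_space set \<Rightarrow> bool" where
  pos: "real_polynomial_function p \<Longrightarrow> semialgebraic {x. 0 < p x}"
| compl: "semialgebraic S \<Longrightarrow> semialgebraic (- S)"
| inter: "semialgebraic S \<Longrightarrow> semialgebraic T \<Longrightarrow> semialgebraic (S \<inter> T)"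

definition semialgebraic_map_on ::
    "'a::euclidean_space set \<Rightarrow> ('a \<Rightarrow> 'b::euclidean_space) \<Rightarrow> bool" where
  "semialgebraic_map_on S f \<longleftrightarrow> semialgebraic {(x, f x) | x. x \<in> S}"

definition coordinate_cell :: "'a::euclidean_space set \<Rightarrow> 'a set" where
  "coordinate_cell I =
     {x. \<forall>b\<in>Basis. if b \<in> I then 0 < x \<bullet> b \<and> x \<bullet> b < 1 else x \<bullet> b = 0}"

text \<open>A copy of the open cube \<open>(0,1)\<^sup>d\<close>, embedded by a continuous injective semialgebraic map.\<close>

definition contains_cell :: "'a::euclidean_space set \<Rightarrow> nat \<Rightarrow> bool" where
  "contains_cell S d \<longleftrightarrow>
     (\<exists>I \<subseteq> (Basis :: 'a set). \<exists>f :: 'a \<Rightarrow> 'a. card I = d \<and>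
        semialgebraic_map_on (coordinate_cell I) f \<and>
        continuous_on (coordinate_cell I) f \<and> inj_on f (coordinate_cell I) \<and>
        f ` coordinate_cell I \<subseteq> S)"

text \<open>The dimension of a nonempty semialgebraic set is the largest dimension of a cell in it.\<close>

definition has_semialgebraic_dim :: "'a::euclidean_space set \<Rightarrow> nat \<Rightarrow> bool" where
  "has_semialgebraic_dim S d \<longleftrightarrow> contains_cell S d \<and> (\<forall>d'>d. \<not> contains_cell S d')"


section \<open>Semialgebraic graphs\<close>

definition real_analytic_on :: "real set \<Rightarrow> (real \<Rightarrow> 'a::real_normed_vector) \<Rightarrow> bool" where
  "real_analytic_on S g \<longleftrightarrow>
     (\<forall>s\<in>S. \<exists>r>0. \<exists>a. \<forall>t\<in>ball s r. (\<lambda>n. (t - s) ^ n *\<^sub>R a n) sums g t)"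

text \<open>
  A regular real analytic parametrization of the open edge \<open>e\<close> by \<open>]0,1[\<close> that extends
  continuously to the end points, \<open>arc\<close> making the extension injective: so the end points are
  distinct and \<open>e\<close> is an embedded analytic curve. Nothing is required of the derivatives at
  0 and 1.
\<close>

definition edge_parametrization :: "(real \<Rightarrow> real^3) \<Rightarrow> (real^3) set \<Rightarrow> bool" where
  "edge_parametrization g e \<longleftrightarrow>
     arc g \<and> g ` {0<..<1} = e \<and> real_analytic_on {0<..<1} g \<and>
     (\<forall>t\<in>{0<..<1}. vector_derivative g (at t) \<noteq> 0)"

definition open_edge :: "(real^3) set \<Rightarrow> (real^3) set \<Rightarrow> bool" where
  "open_edge V e \<longleftrightarrow>
     semialgebraic e \<and> bounded e \<and>
     (\<exists>g. edge_parametrization g e \<and> pathstart g \<in> V \<and> pathfinish g \<in> V)"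

text \<open>
  The set \<open>E\<close> of open edges is determined by \<open>\<Gamma>\<close> and \<open>V\<close>: it is the set of connected
  components of \<open>\<Gamma> - V\<close>.
\<close>

definition semialgebraic_graph ::
    "(real^3) set \<Rightarrow> (real^3) set \<Rightarrow> (real^3) set set \<Rightarrow> bool" where
  "semialgebraic_graph \<Gamma> V E \<longleftrightarrow>
     compact \<Gamma> \<and> connected \<Gamma> \<and> semialgebraic \<Gamma> \<and> has_semialgebraic_dim \<Gamma> 1 \<and>
     finite V \<and> V \<subseteq> \<Gamma> \<and>
     finite E \<and> pairwise disjnt E \<and> \<Union>E = \<Gamma> - V \<and> (\<forall>e\<in>E. open_edge V e)"


section \<open>First Betti number\<close>

definition int_independent :: "('a, 'b) monoid_scheme \<Rightarrow> 'a set \<Rightarrow> bool" where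
  "int_independent G B \<longleftrightarrow>
     finite B \<and> B \<subseteq> carrier G \<and>
     (\<forall>k :: 'a \<Rightarrow> int. finprod G (\<lambda>b. b [^]\<^bsub>G\<^esub> k b) B = \<one>\<^bsub>G\<^esub> \<longrightarrow> (\<forall>b\<in>B. k b = 0))"

text \<open>Rank over the integers of an abelian group, written multiplicatively; only meaningful if finite.\<close>

definition abelian_rank :: "('a, 'b) monoid_scheme \<Rightarrow> nat" where
  "abelian_rank G = Sup {card B | B. int_independent G B}"

definition first_betti_number :: "'a::topological_space set \<Rightarrow> nat" where
  "first_betti_number S = abelian_rank (homology_group 1 (top_of_set S))"


section \<open>Height functions and tightness\<close>

definition tangent_directions :: "(real^3) set \<Rightarrow> real^3 \<Rightarrow> (real^3) set" where
  "tangent_directions \<Gamma> p =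
     {\<tau>. \<exists>q :: nat \<Rightarrow> real^3. (\<forall>k. q k \<in> \<Gamma> - {p}) \<and> q \<longlonglongrightarrow> p \<and>
          (\<lambda>k. (q k - p) /\<^sub>R norm (q k - p)) \<longlonglongrightarrow> \<tau>}"

text \<open>The condition below does not depend on the choice of the parametrization.\<close>

definition nondegenerate_on_edge :: "(real^3 \<Rightarrow> real) \<Rightarrow> (real^3) set \<Rightarrow> bool" where
  "nondegenerate_on_edge h e \<longleftrightarrow>
     (\<exists>g. edge_parametrization g e \<and>
          (\<forall>t\<in>{0<..<1}. deriv (h \<circ> g) t = 0 \<longrightarrow> deriv (deriv (h \<circ> g)) t \<noteq> 0))"

definition nondegenerate ::
    "(real^3) set \<Rightarrow> (real^3) set \<Rightarrow> (real^3) set set \<Rightarrow> real^3 \<Rightarrow> bool" where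
  "nondegenerate \<Gamma> V E u \<longleftrightarrow>
     (\<forall>e\<in>E. nondegenerate_on_edge (\<lambda>x. u \<bullet> x) e) \<and>
     (\<forall>v\<in>V. \<forall>\<tau>\<in>tangent_directions \<Gamma> v. u \<bullet> \<tau> \<noteq> 0)"

definition degenerate_vectors ::
    "(real^3) set \<Rightarrow> (real^3) set \<Rightarrow> (real^3) set set \<Rightarrow> (real^3) set" where
  "degenerate_vectors \<Gamma> V E = {u \<in> sphere 0 1. \<not> nondegenerate \<Gamma> V E u}"

text \<open>The eventual number of lower points; \<open>finite\<close> is there because infinite sets have cardinality 0.\<close>

definition lower_degree :: "(real^3) set \<Rightarrow> real^3 \<Rightarrow> real^3 \<Rightarrow> nat" where
  "lower_degree \<Gamma> u p =
     (THE n. \<forall>\<^sub>F \<epsilon> in at_right 0.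
        finite {q \<in> \<Gamma>. dist p q = \<epsilon> \<and> u \<bullet> q < u \<bullet> p} \<and>
        card {q \<in> \<Gamma>. dist p q = \<epsilon> \<and> u \<bullet> q < u \<bullet> p} = n)"

definition local_minimum_on :: "(real^3) set \<Rightarrow> (real^3 \<Rightarrow> real) \<Rightarrow> real^3 \<Rightarrow> bool" where
  "local_minimum_on \<Gamma> h p \<longleftrightarrow> p \<in> \<Gamma> \<and> (\<forall>\<^sub>F q in at p within \<Gamma>. h p \<le> h q)"

definition point_weight :: "(real^3) set \<Rightarrow> real^3 \<Rightarrow> real^3 \<Rightarrow> int" where
  "point_weight \<Gamma> u p =
     (if local_minimum_on \<Gamma> (\<lambda>x. u \<bullet> x) p then 1 else int (lower_degree \<Gamma> u p) - 1)"

definition graph_weight :: "(real^3) set \<Rightarrow> real^3 \<Rightarrow> int" where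
  "graph_weight \<Gamma> u = (\<Sum>p | p \<in> \<Gamma> \<and> point_weight \<Gamma> u p \<noteq> 0. point_weight \<Gamma> u p)"

definition tight_graph :: "(real^3) set \<Rightarrow> (real^3) set \<Rightarrow> (real^3) set set \<Rightarrow> bool" where
  "tight_graph \<Gamma> V E \<longleftrightarrow>
     (\<forall>u \<in> sphere 0 1 - degenerate_vectors \<Gamma> V E.
        graph_weight \<Gamma> u = 1 + int (first_betti_number \<Gamma>))"


section \<open>Half-spaces\<close>

definition half_space :: "real^3 \<Rightarrow> real \<Rightarrow> (real^3) set" where
  "half_space u c = {x. u \<bullet> x \<le> c}"

text \<open>
  The surface measure of the unit sphere as cone measure: a Borel set \<open>A\<close> gets three times the
  volume of the cone \<open>{r *\<^sub>R x | r x. 0 < r \<and> r < 1 \<and> x \<in> A}\<close>.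
\<close>

definition sphere_measure :: "(real^3) measure" where
  "sphere_measure =
     scale_measure 3
       (distr (restrict_space lborel (ball 0 1 - {0})) (restrict_space borel (sphere 0 1))
          (\<lambda>x. x /\<^sub>R norm x))"

end

theory Submission
  imports Defs "HOL-Complex_Analysis.Complex_Analysis"
begin

text \<open>
  For a nondegenerate direction \<open>u\<close> only the local minima of the height function
  matter. A point that is not a local minimum contributes the number of its descending branches
  minus one, a local minimum contributes one, that is, two more than this formula would give.
  Summing over the vertices and the critical points of the edges, every edge with \<open>k\<close>
  interior critical points accounts for \<open>k + 1\<close> descending branches, because each of
  its \<open>k + 1\<close> monotone pieces descends from exactly one of its ends. The critical
  points cancel, and \<open>graph_weight \<Gamma> u = 2 * m + card E - card V\<close>, where
  \<open>m\<close> is the number of local minima (\<open>graph_weight_eq\<close>). On the other hand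
  the first Betti number is \<open>1 - card V + card E\<close>
  (\<open>first_betti_number_graph\<close>). So the weight is \<open>1 + first_betti_number
  \<Gamma>\<close> if and only if the height function has exactly one local minimum
  (\<open>graph_weight_tight_iff_unique_minimum\<close>), and tightness says that this holds for all
  nondegenerate directions.

  A separation of a compact set cut by a closed half-space persists when the half-space is replaced
  by any half-space close to a slightly larger one (\<open>disconnected_half_space_stable\<close>).
  Hence a disconnected section yields a set of positive measure of disconnected sections, which
  gives the passage from almost all half-spaces to all of them. It also yields a disconnected
  section with nondegenerate normal vector, since these vectors are dense
  (\<open>nondegenerate_dense\<close>); the lowest points of its two parts are two local minima, so
  the graph is not tight. Conversely, let \<open>q\<close> be a local minimum for a nondegenerate
  direction that is not the only one, and at least as high as a global minimum \<open>p\<close>. The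
  level of \<open>q\<close> meets the graph in finitely many points, so \<open>q\<close> is isolated
  in the section at its level, and this section also contains \<open>p\<close>: it is not connected.

  The real work lies in the finiteness statements that these counts presuppose, and in the Betti
  number. The edges are only known to be analytic inside, so compactness cannot be used at their
  ends; semialgebraicity has to be used. Any two coordinates along a semialgebraic analytic arc are
  algebraically dependent (\<open>edge_coordinates_dependent\<close>), hence so are all polynomials
  on the arc, and it follows that a polynomial on an edge has finitely many zeros and finitely many
  critical points unless it vanishes identically or is constant. Density of nondegenerate directions
  combines Sard's theorem with the finiteness of the set of limit directions at a vertex. The Betti
  number comes from the exact sequences of the pairs formed by the graph and small stars of its
  vertices, before and after the vertices are excised.
\<close>

section \<open>Functions algebraic over a coordinate\<close>

text \<open>Gaussian elimination without division, so that the coefficients may be polynomials.\<close>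

lemma homogeneous_system_nontrivial_solution:
  fixes a :: "'i \<Rightarrow> 'j \<Rightarrow> 'a::idom"
  assumes "finite I" "finite J" "card I < card J"
  shows "\<exists>x. (\<exists>j\<in>J. x j \<noteq> 0) \<and> (\<forall>i\<in>I. (\<Sum>j\<in>J. a i j * x j) = 0)"
  using assms
proof (induction I arbitrary: J a rule: finite_induct)
  case empty
  then obtain j where "j \<in> J" by (auto simp: card_gt_0_iff)
  then show ?case by (intro exI[of _ "\<lambda>_. 1"]) auto
next
  case (insert i I)
  show ?case
  proof (cases "\<forall>j\<in>J. a i j = 0")
    case True
    have "card I < card J" using insert by simp
    from insert.IH[OF \<open>finite J\<close> this, of a] True show ?thesis by auto
  next
    case False
    then obtain p where p: "p \<in> J" "a i p \<noteq> 0" by auto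
    define J' where "J' = J - {p}"
    have J': "finite J'" "card I < card J'" "p \<notin> J'" "J = insert p J'"
      using insert p by (auto simp: J'_def card_Diff_singleton)
    obtain x where x: "\<exists>j\<in>J'. x j \<noteq> 0"
        "\<forall>k\<in>I. (\<Sum>j\<in>J'. (a i p * a k j - a k p * a i j) * x j) = 0"
      using insert.IH[OF J'(1,2), of "\<lambda>k j. a i p * a k j - a k p * a i j"] by auto
    define s where "s = (\<Sum>j\<in>J'. a i j * x j)"
    define y where "y j = (if j = p then - s else a i p * x j)" for j
    have sum_y: "(\<Sum>j\<in>J. a k j * y j) = a i p * (\<Sum>j\<in>J'. a k j * x j) - a k p * s" for k
    proof -
      have "(\<Sum>j\<in>J'. a k j * y j) = (\<Sum>j\<in>J'. a i p * (a k j * x j))"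
        using J'(3) by (intro sum.cong) (auto simp: y_def)
      then show ?thesis
        using J' by (simp add: y_def sum_distrib_left)
    qed
    have "(\<Sum>j\<in>J. a k j * y j) = 0" if "k \<in> I" for k
    proof -
      have "0 = (\<Sum>j\<in>J'. (a i p * a k j - a k p * a i j) * x j)" using x that by simp
      also have "\<dots> = a i p * (\<Sum>j\<in>J'. a k j * x j) - a k p * s"
        by (simp add: s_def sum_distrib_left sum_subtractf algebra_simps)
      finally show ?thesis by (simp add: sum_y)
    qed
    moreover have "(\<Sum>j\<in>J. a i j * y j) = 0" by (simp add: sum_y s_def)
    moreover have "\<exists>j\<in>J. y j \<noteq> 0"
      using x(1) p J' by (auto simp: y_def)
    ultimately show ?thesis by blast
  qed
qed

text \<open>
  The symbol \<open>$\<close> is to denote the components of vectors, and the names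
  \<open>coeff\<close> and \<open>monom\<close> those of the type of polynomials, not of the
  algebraic structures.
\<close>

no_notation fps_nth (infixl "$" 75)
hide_const (open) up_ring.coeff up_ring.monom module.smult

definition bivariate_eval :: "real poly poly \<Rightarrow> real \<Rightarrow> real \<Rightarrow> real" where
  "bivariate_eval R x y = poly (poly R [:y:]) x"

lemma bivariate_eval_simps [simp]:
  "bivariate_eval 0 x y = 0"
  "bivariate_eval (A + B) x y = bivariate_eval A x y + bivariate_eval B x y"
  "bivariate_eval (A * B) x y = bivariate_eval A x y * bivariate_eval B x y"
  "bivariate_eval (smult p A) x y = poly p x * bivariate_eval A x y"
  "bivariate_eval (monom p k) x y = poly p x * y ^ k"
  by (simp_all add: bivariate_eval_def poly_monom poly_power)

lemma bivariate_eval_sum: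
  "bivariate_eval (\<Sum>i\<in>I. A i) x y = (\<Sum>i\<in>I. bivariate_eval (A i) x y)"
  by (simp add: bivariate_eval_def poly_sum)

lemma bivariate_eval_altdef:
  "bivariate_eval R x y = (\<Sum>i\<le>degree R. poly (coeff R i) x * y ^ i)"
  by (simp add: bivariate_eval_def poly_altdef[of R] poly_sum poly_power)

lemma bivariate_eval_altdef_le:
  assumes "degree R \<le> n"
  shows "bivariate_eval R x y = (\<Sum>i\<le>n. poly (coeff R i) x * y ^ i)"
  unfolding bivariate_eval_altdef
  by (rule sum.mono_neutral_left) (use assms in \<open>auto simp: coeff_eq_0\<close>)

text \<open>
  The values of \<open>f\<close> are algebraic over the field generated by those of
  \<open>\<xi>\<close>, by one equation that is valid on all of \<open>T\<close>. The variable
  \<open>x\<close> of \<open>bivariate_eval\<close> is that of the coefficients.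
\<close>

definition algebraic_over :: "'a set \<Rightarrow> ('a \<Rightarrow> real) \<Rightarrow> ('a \<Rightarrow> real) \<Rightarrow> bool" where
  "algebraic_over T \<xi> f \<longleftrightarrow> (\<exists>R. R \<noteq> 0 \<and> (\<forall>t\<in>T. bivariate_eval R (\<xi> t) (f t) = 0))"

text \<open>
  Linear combinations with rational functions of \<open>\<xi>\<close> as coefficients, with the
  denominators cleared.
\<close>

definition in_rational_span ::
    "'a set \<Rightarrow> ('a \<Rightarrow> real) \<Rightarrow> 'i set \<Rightarrow> ('i \<Rightarrow> 'a \<Rightarrow> real) \<Rightarrow> ('a \<Rightarrow> real) \<Rightarrow> bool" where
  "in_rational_span T \<xi> I b w \<longleftrightarrow>
     (\<exists>d a. d \<noteq> 0 \<and> (\<forall>t\<in>T. poly d (\<xi> t) * w t = (\<Sum>i\<in>I. poly (a i) (\<xi> t) * b i t)))"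

lemma in_rational_span_add:
  assumes "in_rational_span T \<xi> I b v" "in_rational_span T \<xi> I b w"
  shows "in_rational_span T \<xi> I b (\<lambda>t. v t + w t)"
proof -
  obtain d a where d: "d \<noteq> 0" "\<And>t. t \<in> T \<Longrightarrow> poly d (\<xi> t) * v t = (\<Sum>i\<in>I. poly (a i) (\<xi> t) * b i t)"
    using assms(1) unfolding in_rational_span_def by blast
  obtain e c where e: "e \<noteq> 0" "\<And>t. t \<in> T \<Longrightarrow> poly e (\<xi> t) * w t = (\<Sum>i\<in>I. poly (c i) (\<xi> t) * b i t)"
    using assms(2) unfolding in_rational_span_def by blast
  show ?thesis
    unfolding in_rational_span_def
  proof (intro exI[of _ "d * e"] exI[of _ "\<lambda>i. e * a i + d * c i"] conjI ballI)
    show "d * e \<noteq> 0" using d e by simp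
    fix t assume "t \<in> T"
    have "poly (d * e) (\<xi> t) * (v t + w t)
        = poly e (\<xi> t) * (poly d (\<xi> t) * v t) + poly d (\<xi> t) * (poly e (\<xi> t) * w t)"
      by (simp add: algebra_simps)
    also have "\<dots> = (\<Sum>i\<in>I. poly (e * a i + d * c i) (\<xi> t) * b i t)"
      unfolding d(2)[OF \<open>t \<in> T\<close>] e(2)[OF \<open>t \<in> T\<close>]
      by (simp add: sum_distrib_left flip: sum.distrib) (simp add: algebra_simps)
    finally show "poly (d * e) (\<xi> t) * (v t + w t) = (\<Sum>i\<in>I. poly (e * a i + d * c i) (\<xi> t) * b i t)" .
  qed
qed

lemma in_rational_span_zero: "in_rational_span T \<xi> I b (\<lambda>t. 0)"
  unfolding in_rational_span_def by (intro exI[of _ 1] exI[of _ "\<lambda>_. 0"]) simp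

lemma in_rational_span_scale:
  assumes "in_rational_span T \<xi> I b w"
  shows "in_rational_span T \<xi> I b (\<lambda>t. c * w t)"
proof -
  obtain d a where d: "d \<noteq> 0" "\<And>t. t \<in> T \<Longrightarrow> poly d (\<xi> t) * w t = (\<Sum>i\<in>I. poly (a i) (\<xi> t) * b i t)"
    using assms unfolding in_rational_span_def by blast
  show ?thesis
    unfolding in_rational_span_def
  proof (intro exI[of _ d] exI[of _ "\<lambda>i. smult c (a i)"] conjI ballI)
    fix t assume "t \<in> T"
    then show "poly d (\<xi> t) * (c * w t) = (\<Sum>i\<in>I. poly (smult c (a i)) (\<xi> t) * b i t)"
      using d(2)[of t] by (simp add: mult.left_commute[of _ c] sum_distrib_left mult.assoc)
  qed (rule d)
qed

lemma in_rational_span_sum: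
  assumes "finite K" "\<And>k. k \<in> K \<Longrightarrow> in_rational_span T \<xi> I b (w k)"
  shows "in_rational_span T \<xi> I b (\<lambda>t. \<Sum>k\<in>K. w k t)"
  using assms
  by (induction K rule: finite_induct) (auto intro: in_rational_span_zero in_rational_span_add)

lemma in_rational_span_mult:
  assumes "in_rational_span T \<xi> I b v" "in_rational_span T \<xi> J c w"
  shows "in_rational_span T \<xi> (I \<times> J) (\<lambda>(i, j) t. b i t * c j t) (\<lambda>t. v t * w t)"
proof -
  obtain d a where d: "d \<noteq> 0" "\<And>t. t \<in> T \<Longrightarrow> poly d (\<xi> t) * v t = (\<Sum>i\<in>I. poly (a i) (\<xi> t) * b i t)"
    using assms(1) unfolding in_rational_span_def by blast
  obtain e a' where e: "e \<noteq> 0" "\<And>t. t \<in> T \<Longrightarrow> poly e (\<xi> t) * w t = (\<Sum>j\<in>J. poly (a' j) (\<xi> t) * c j t)"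
    using assms(2) unfolding in_rational_span_def by blast
  show ?thesis
    unfolding in_rational_span_def
  proof (intro exI[of _ "d * e"] exI[of _ "\<lambda>(i, j). a i * a' j"] conjI ballI)
    show "d * e \<noteq> 0" using d e by simp
    fix t assume t: "t \<in> T"
    have "poly (d * e) (\<xi> t) * (v t * w t) = (poly d (\<xi> t) * v t) * (poly e (\<xi> t) * w t)"
      by (simp add: algebra_simps)
    also have "\<dots> = (\<Sum>i\<in>I. \<Sum>j\<in>J. (poly (a i) (\<xi> t) * b i t) * (poly (a' j) (\<xi> t) * c j t))"
      by (simp only: d(2)[OF t] e(2)[OF t] sum_product)
    also have "\<dots> = (\<Sum>(i, j)\<in>I \<times> J. (poly (a i) (\<xi> t) * b i t) * (poly (a' j) (\<xi> t) * c j t))"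
      by (rule sum.cartesian_product)
    also have "\<dots> = (\<Sum>p\<in>I \<times> J. poly ((\<lambda>(i, j). a i * a' j) p) (\<xi> t) * (\<lambda>(i, j) t. b i t * c j t) p t)"
      by (intro sum.cong) (auto simp: algebra_simps)
    finally show "poly (d * e) (\<xi> t) * (v t * w t) = \<dots>" .
  qed
qed

text \<open>
  Pseudo-division of \<open>y ^ k\<close> by the equation of \<open>f\<close> reduces every power of
  \<open>f\<close> to the first \<open>n\<close> powers.
\<close>

lemma powers_in_rational_span:
  assumes "algebraic_over T \<xi> f"
  shows "\<exists>n. \<forall>k. in_rational_span T \<xi> {..<n} (\<lambda>i t. f t ^ i) (\<lambda>t. f t ^ k)"
proof -
  obtain R where R: "R \<noteq> 0" "\<And>t. t \<in> T \<Longrightarrow> bivariate_eval R (\<xi> t) (f t) = 0"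
    using assms unfolding algebraic_over_def by blast
  have "in_rational_span T \<xi> {..<degree R} (\<lambda>i t. f t ^ i) (\<lambda>t. f t ^ k)" for k
  proof -
    define r where "r = pseudo_mod (monom 1 k) R"
    obtain a q where aq: "a \<noteq> 0" "smult a (monom 1 k) = R * q + r"
      using pseudo_mod(1)[OF R(1), of "monom 1 k"] unfolding r_def by blast
    have deg: "r = 0 \<or> degree r < degree R"
      using pseudo_mod(2)[OF R(1), of "monom 1 k"] unfolding r_def .
    have "poly a (\<xi> t) * f t ^ k = (\<Sum>i<degree R. poly (coeff r i) (\<xi> t) * f t ^ i)" if "t \<in> T" for t
    proof -
      have "poly a (\<xi> t) * f t ^ k = bivariate_eval (smult a (monom 1 k)) (\<xi> t) (f t)" by simp
      also have "\<dots> = bivariate_eval r (\<xi> t) (f t)"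
        unfolding aq(2) by (simp add: R(2)[OF that])
      also have "\<dots> = (\<Sum>i<degree R. poly (coeff r i) (\<xi> t) * f t ^ i)"
        using deg
      proof
        assume "degree r < degree R"
        then have "{..<degree R} = {..degree R - 1}" "degree r \<le> degree R - 1" by auto
        then show ?thesis by (simp add: bivariate_eval_altdef_le)
      qed simp
      finally show ?thesis .
    qed
    then show ?thesis using aq(1) unfolding in_rational_span_def by blast
  qed
  then show ?thesis by blast
qed

text \<open>
  More powers than spanning elements are linearly dependent: the usual proof that the elements of a
  finite extension are algebraic.
\<close>

lemma algebraic_over_if_powers_in_rational_span:
  assumes "finite I" "\<And>k. in_rational_span T \<xi> I b (\<lambda>t. f t ^ k)"
  shows "algebraic_over T \<xi> f"
proof -
  have "\<forall>k. \<exists>d a. d \<noteq> 0 \<and> (\<forall>t\<in>T. poly d (\<xi> t) * f t ^ k = (\<Sum>i\<in>I. poly (a i) (\<xi> t) * b i t))"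
    using assms(2) unfolding in_rational_span_def by blast
  then obtain d where "\<forall>k. \<exists>a. d k \<noteq> 0 \<and> (\<forall>t\<in>T. poly (d k) (\<xi> t) * f t ^ k = (\<Sum>i\<in>I. poly (a i) (\<xi> t) * b i t))"
    by metis
  then obtain a where da: "\<And>k. d k \<noteq> 0"
      "\<And>k t. t \<in> T \<Longrightarrow> poly (d k) (\<xi> t) * f t ^ k = (\<Sum>i\<in>I. poly (a k i) (\<xi> t) * b i t)"
    by metis
  obtain x where x: "\<exists>k\<in>{..card I}. x k \<noteq> 0" "\<And>i. i \<in> I \<Longrightarrow> (\<Sum>k\<le>card I. a k i * x k) = 0"
    using homogeneous_system_nontrivial_solution[OF assms(1), of "{..card I}" "\<lambda>i k. a k i"] by auto
  define R where "R = (\<Sum>k\<le>card I. monom (d k * x k) k)"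
  have "coeff R k = d k * x k" if "k \<le> card I" for k
    unfolding R_def using that by (simp add: coeff_sum)
  then have "R \<noteq> 0" using x(1) da(1) by (metis atMost_iff coeff_0 mult_eq_0_iff)
  moreover have "bivariate_eval R (\<xi> t) (f t) = 0" if t: "t \<in> T" for t
  proof -
    have "bivariate_eval R (\<xi> t) (f t) = (\<Sum>k\<le>card I. poly (x k) (\<xi> t) * (poly (d k) (\<xi> t) * f t ^ k))"
      unfolding R_def by (simp add: bivariate_eval_sum algebra_simps)
    also have "\<dots> = (\<Sum>k\<le>card I. \<Sum>i\<in>I. poly (a k i * x k) (\<xi> t) * b i t)"
      unfolding da(2)[OF t] by (simp add: sum_distrib_left mult_ac)
    also have "\<dots> = (\<Sum>i\<in>I. poly (\<Sum>k\<le>card I. a k i * x k) (\<xi> t) * b i t)"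
      by (subst sum.swap) (simp add: poly_sum sum_distrib_right)
    also have "\<dots> = 0" by (simp add: x(2))
    finally show ?thesis .
  qed
  ultimately show ?thesis unfolding algebraic_over_def by blast
qed

lemma algebraic_over_const: "algebraic_over T \<xi> (\<lambda>_. c)"
  unfolding algebraic_over_def
  by (intro exI[of _ "monom 1 1 + monom [:-c:] 0"]) (auto simp: poly_eq_iff coeff_monom intro!: exI[of _ 1])

lemma algebraic_over_self: "algebraic_over T \<xi> \<xi>"
  unfolding algebraic_over_def
  by (intro exI[of _ "monom 1 1 + monom [:0, -1:] 0"]) (auto simp: poly_eq_iff coeff_monom intro!: exI[of _ 1])

text \<open>
  The powers of the sum and of the product lie in the span of the products of the powers of
  \<open>f\<close> and \<open>h\<close>, of which finitely many suffice.
\<close>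

lemma
  assumes f: "algebraic_over T \<xi> f" and h: "algebraic_over T \<xi> h"
  shows algebraic_over_add: "algebraic_over T \<xi> (\<lambda>t. f t + h t)"
    and algebraic_over_mult: "algebraic_over T \<xi> (\<lambda>t. f t * h t)"
proof -
  obtain n m where nm: "\<And>k. in_rational_span T \<xi> {..<n} (\<lambda>i t. f t ^ i) (\<lambda>t. f t ^ k)"
      "\<And>k. in_rational_span T \<xi> {..<m} (\<lambda>i t. h t ^ i) (\<lambda>t. h t ^ k)"
    using powers_in_rational_span[OF f] powers_in_rational_span[OF h] by blast
  note monomial = in_rational_span_mult[OF nm]
  show "algebraic_over T \<xi> (\<lambda>t. f t * h t)"
    by (rule algebraic_over_if_powers_in_rational_span[where I="{..<n} \<times> {..<m}"])
      (auto simp: power_mult_distrib intro: monomial)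
  show "algebraic_over T \<xi> (\<lambda>t. f t + h t)"
  proof (rule algebraic_over_if_powers_in_rational_span[where I="{..<n} \<times> {..<m}"])
    fix k
    have "(\<lambda>t. (f t + h t) ^ k) = (\<lambda>t. \<Sum>i\<le>k. of_nat (k choose i) * (f t ^ i * h t ^ (k - i)))"
      by (simp add: binomial_ring mult.assoc)
    then show "in_rational_span T \<xi> ({..<n} \<times> {..<m}) (\<lambda>(i, j) t. f t ^ i * h t ^ j) (\<lambda>t. (f t + h t) ^ k)"
      by (auto intro!: in_rational_span_sum in_rational_span_scale monomial)
  qed simp
qed

section \<open>Real analytic functions of one variable\<close>

text \<open>
  Real analyticity of \<open>\<phi>\<close> near the points of \<open>S\<close>, expressed through
  complex extensions so that the identity theorem for holomorphic functions can be applied.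
\<close>

definition locally_holomorphic_extendable :: "real set \<Rightarrow> (real \<Rightarrow> real) \<Rightarrow> bool" where
  "locally_holomorphic_extendable S \<phi> \<longleftrightarrow>
     (\<forall>s\<in>S. \<exists>r>0. \<exists>f. f holomorphic_on ball (complex_of_real s) r \<and>
        (\<forall>t\<in>ball s r. f (complex_of_real t) = complex_of_real (\<phi> t)))"

lemma of_real_in_ball_iff: "complex_of_real t \<in> ball (complex_of_real s) r \<longleftrightarrow> t \<in> ball s r"
  by (simp add: dist_of_real)

lemma locally_holomorphic_extendableE:
  assumes "locally_holomorphic_extendable S \<phi>" "s \<in> S"
  obtains r f where "r > 0" "f holomorphic_on ball (complex_of_real s) r"
    "\<And>t. t \<in> ball s r \<Longrightarrow> f (complex_of_real t) = complex_of_real (\<phi> t)"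
  using assms unfolding locally_holomorphic_extendable_def by blast

lemma locally_holomorphic_extendable_const: "locally_holomorphic_extendable S (\<lambda>_. c)"
  unfolding locally_holomorphic_extendable_def by (auto intro!: exI[of _ 1] exI[of _ "\<lambda>_. of_real c"])

lemma
  assumes "locally_holomorphic_extendable S \<phi>" "locally_holomorphic_extendable S \<psi>"
  shows locally_holomorphic_extendable_add: "locally_holomorphic_extendable S (\<lambda>t. \<phi> t + \<psi> t)"
    and locally_holomorphic_extendable_mult: "locally_holomorphic_extendable S (\<lambda>t. \<phi> t * \<psi> t)"
proof -
  have *: "\<exists>r>0. \<exists>f g. f holomorphic_on ball (complex_of_real s) r \<and> g holomorphic_on ball (complex_of_real s) r \<and>
      (\<forall>t\<in>ball s r. f (complex_of_real t) = complex_of_real (\<phi> t) \<and> g (complex_of_real t) = complex_of_real (\<psi> t))"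
    if s: "s \<in> S" for s
  proof -
    obtain r f where f: "r > 0" "f holomorphic_on ball (complex_of_real s) r"
      "\<And>t. t \<in> ball s r \<Longrightarrow> f (complex_of_real t) = complex_of_real (\<phi> t)"
      using locally_holomorphic_extendableE[OF assms(1) s] by blast
    obtain q g where g: "q > 0" "g holomorphic_on ball (complex_of_real s) q"
      "\<And>t. t \<in> ball s q \<Longrightarrow> g (complex_of_real t) = complex_of_real (\<psi> t)"
      using locally_holomorphic_extendableE[OF assms(2) s] by blast
    show ?thesis
      using f g by (intro exI[of _ "min r q"] conjI exI[of _ f] exI[of _ g])
        (auto intro: holomorphic_on_subset)
  qed
  show "locally_holomorphic_extendable S (\<lambda>t. \<phi> t + \<psi> t)"
    unfolding locally_holomorphic_extendable_def
  proof
    fix s assume "s \<in> S"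
    from *[OF this] obtain r f g where "r > 0" "f holomorphic_on ball (complex_of_real s) r"
      "g holomorphic_on ball (complex_of_real s) r"
      "\<forall>t\<in>ball s r. f (complex_of_real t) = complex_of_real (\<phi> t) \<and> g (complex_of_real t) = complex_of_real (\<psi> t)"
      by blast
    then show "\<exists>r>0. \<exists>f. f holomorphic_on ball (complex_of_real s) r \<and>
        (\<forall>t\<in>ball s r. f (complex_of_real t) = complex_of_real (\<phi> t + \<psi> t))"
      by (intro exI[of _ r] conjI exI[of _ "\<lambda>z. f z + g z"]) (auto intro: holomorphic_intros)
  qed
  show "locally_holomorphic_extendable S (\<lambda>t. \<phi> t * \<psi> t)"
    unfolding locally_holomorphic_extendable_def
  proof
    fix s assume "s \<in> S"
    from *[OF this] obtain r f g where "r > 0" "f holomorphic_on ball (complex_of_real s) r"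
      "g holomorphic_on ball (complex_of_real s) r"
      "\<forall>t\<in>ball s r. f (complex_of_real t) = complex_of_real (\<phi> t) \<and> g (complex_of_real t) = complex_of_real (\<psi> t)"
      by blast
    then show "\<exists>r>0. \<exists>f. f holomorphic_on ball (complex_of_real s) r \<and>
        (\<forall>t\<in>ball s r. f (complex_of_real t) = complex_of_real (\<phi> t * \<psi> t))"
      by (intro exI[of _ r] conjI exI[of _ "\<lambda>z. f z * g z"]) (auto intro: holomorphic_intros)
  qed
qed

text \<open>
  The power series at a point of \<open>S\<close> converges on a real neighbourhood, hence on a
  complex disc of the same radius, and its sum is the extension.
\<close>

lemma locally_holomorphic_extendable_real_analytic:
  fixes g :: "real \<Rightarrow> real ^ 'n"
  assumes "real_analytic_on S g"
  shows "locally_holomorphic_extendable S (\<lambda>t. g t $ i)"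
  unfolding locally_holomorphic_extendable_def
proof
  fix s assume "s \<in> S"
  then obtain r a where r: "r > 0"
    and a: "\<And>t. t \<in> ball s r \<Longrightarrow> (\<lambda>n. (t - s) ^ n *\<^sub>R a n) sums g t"
    using assms unfolding real_analytic_on_def by blast
  have ai: "(\<lambda>n. a n $ i * (t - s) ^ n) sums (g t $ i)" if "t \<in> ball s r" for t
    using bounded_linear.sums[OF bounded_linear_vec_nth a[OF that], of i] by (simp add: mult.commute)
  define f where "f w = suminf (\<lambda>n. complex_of_real (a n $ i) * (w - of_real s) ^ n)" for w
  have summ: "(\<lambda>n. complex_of_real (a n $ i) * (w - of_real s) ^ n) sums f w"
    if w: "w \<in> ball (complex_of_real s) r" for w
  proof -
    have "norm (w - of_real s) < r" using w by (simp add: dist_norm norm_minus_commute)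
    then obtain \<rho> where \<rho>: "norm (w - of_real s) < \<rho>" "\<rho> < r" using dense by blast
    moreover have "0 \<le> norm (w - of_real s)" by simp
    ultimately have "\<rho> > 0" by linarith
    have "summable (\<lambda>n. (a n $ i) * \<rho> ^ n)"
      using ai[of "s + \<rho>"] \<rho> \<open>\<rho> > 0\<close> by (auto simp: dist_norm sums_iff)
    then have "summable (\<lambda>n. norm (a n $ i * norm (w - of_real s) ^ n))"
      by (rule powser_insidea) (use \<rho> \<open>\<rho> > 0\<close> in auto)
    then have "summable (\<lambda>n. norm (complex_of_real (a n $ i) * (w - of_real s) ^ n))"
      by (simp add: norm_mult norm_power abs_mult)
    then show ?thesis unfolding f_def by (rule summable_sums[OF summable_norm_cancel])
  qed
  have "f holomorphic_on ball (complex_of_real s) r"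
    by (rule power_series_holomorphic) (rule summ)
  moreover have "f (complex_of_real t) = complex_of_real (g t $ i)" if t: "t \<in> ball s r" for t
  proof -
    have "(\<lambda>n. complex_of_real (a n $ i * (t - s) ^ n)) sums complex_of_real (g t $ i)"
      using ai[OF t] by (rule sums_of_real)
    moreover have "(\<lambda>n. complex_of_real (a n $ i) * (of_real t - of_real s) ^ n) sums f (of_real t)"
      using summ t by (simp add: of_real_in_ball_iff del: of_real_diff)
    ultimately show ?thesis by (simp add: sums_unique2)
  qed
  ultimately show "\<exists>r>0. \<exists>f. f holomorphic_on ball (complex_of_real s) r \<and>
        (\<forall>t\<in>ball s r. f (complex_of_real t) = complex_of_real (g t $ i))"
    using r by blast
qed

lemma locally_holomorphic_extendable_has_derivative_aux:
  assumes f: "f holomorphic_on ball (complex_of_real s) r"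
    and eq: "\<And>t. t \<in> ball s r \<Longrightarrow> f (complex_of_real t) = complex_of_real (\<phi> t)"
    and t: "t \<in> ball s r"
  shows "(\<phi> has_real_derivative Re (deriv f (of_real t))) (at t)"
    and "deriv f (complex_of_real t) = complex_of_real (deriv \<phi> t)"
proof -
  have "(f has_field_derivative deriv f (of_real t)) (at (of_real t))"
    by (rule holomorphic_derivI[OF f]) (use t in \<open>auto simp: of_real_in_ball_iff\<close>)
  then have d: "((\<lambda>t. f (of_real t)) has_vector_derivative deriv f (of_real t)) (at t)"
    by (rule has_vector_derivative_real_field)
  have "((\<lambda>t. complex_of_real (\<phi> t)) has_vector_derivative deriv f (of_real t)) (at t)"
    by (rule has_vector_derivative_transform_within_open[OF d, of "ball s r"])
      (use t eq in auto)
  from bounded_linear.has_vector_derivative[OF bounded_linear_Re this]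
    bounded_linear.has_vector_derivative[OF bounded_linear_Im this]
  have 1: "(\<phi> has_real_derivative Re (deriv f (of_real t))) (at t)"
    and 2: "((\<lambda>t. 0::real) has_vector_derivative Im (deriv f (of_real t))) (at t)"
    by (simp_all add: has_real_derivative_iff_has_vector_derivative)
  have "Im (deriv f (of_real t)) = 0"
    by (rule vector_derivative_unique_at[OF 2 has_vector_derivative_const])
  then show "deriv f (complex_of_real t) = complex_of_real (deriv \<phi> t)"
    by (simp add: complex_eq_iff DERIV_imp_deriv[OF 1])
  show "(\<phi> has_real_derivative Re (deriv f (of_real t))) (at t)" by (rule 1)
qed

lemma
  assumes "locally_holomorphic_extendable S \<phi>"
  shows locally_holomorphic_extendable_has_derivative:
      "\<And>s. s \<in> S \<Longrightarrow> (\<phi> has_real_derivative deriv \<phi> s) (at s)"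
    and locally_holomorphic_extendable_deriv: "locally_holomorphic_extendable S (deriv \<phi>)"
proof -
  fix s assume s: "s \<in> S"
  obtain r f where f: "r > 0" "f holomorphic_on ball (complex_of_real s) r"
      "\<And>t. t \<in> ball s r \<Longrightarrow> f (complex_of_real t) = complex_of_real (\<phi> t)"
    using locally_holomorphic_extendableE[OF assms(1) s] by blast
  show "(\<phi> has_real_derivative deriv \<phi> s) (at s)"
    using locally_holomorphic_extendable_has_derivative_aux[OF f(2,3), of s] f(1)
    by (simp add: DERIV_imp_deriv)
next
  show "locally_holomorphic_extendable S (deriv \<phi>)"
    unfolding locally_holomorphic_extendable_def
  proof
    fix s assume s: "s \<in> S"
    obtain r f where f: "r > 0" "f holomorphic_on ball (complex_of_real s) r"
        "\<And>t. t \<in> ball s r \<Longrightarrow> f (complex_of_real t) = complex_of_real (\<phi> t)"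
      using locally_holomorphic_extendableE[OF assms(1) s] by blast
    show "\<exists>r>0. \<exists>f. f holomorphic_on ball (complex_of_real s) r \<and>
        (\<forall>t\<in>ball s r. f (complex_of_real t) = complex_of_real (deriv \<phi> t))"
      using f(1) holomorphic_deriv[OF f(2)] locally_holomorphic_extendable_has_derivative_aux(2)[OF f(2,3)]
      by (intro exI[of _ r] conjI exI[of _ "deriv f"]) auto
  qed
qed

lemma locally_holomorphic_extendable_continuous_on:
  assumes "locally_holomorphic_extendable S \<phi>"
  shows "continuous_on S \<phi>"
  by (intro continuous_at_imp_continuous_on ballI DERIV_isCont[OF locally_holomorphic_extendable_has_derivative[OF assms]])

lemma analytic_zero_near_limit_of_zeros:
  assumes \<phi>: "locally_holomorphic_extendable S \<phi>" and s: "s \<in> S" "s islimpt {t. \<phi> t = 0}"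
  shows "\<exists>r>0. \<forall>t\<in>ball s r. \<phi> t = 0"
proof -
  obtain r f where f: "r > 0" "f holomorphic_on ball (complex_of_real s) r"
      "\<And>t. t \<in> ball s r \<Longrightarrow> f (complex_of_real t) = complex_of_real (\<phi> t)"
    using locally_holomorphic_extendableE[OF \<phi> s(1)] by blast
  define U where "U = complex_of_real ` {t \<in> ball s r. \<phi> t = 0}"
  have "complex_of_real s islimpt U"
    unfolding islimpt_approachable
  proof (intro allI impI)
    fix e :: real assume "e > 0"
    then have "min e r > 0" using f(1) by simp
    then obtain t where "\<phi> t = 0" "t \<noteq> s" "dist t s < min e r"
      using s(2) unfolding islimpt_approachable by blast
    then show "\<exists>x'\<in>U. x' \<noteq> complex_of_real s \<and> dist x' (complex_of_real s) < e"
      unfolding U_def by (intro bexI[of _ "of_real t"]) (auto simp: dist_of_real dist_commute)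
  qed
  note lim = this
  have "f w = 0" if "w \<in> ball (complex_of_real s) r" for w
    by (rule analytic_continuation[OF f(2) _ _ _ _ lim]) (use that f(1,3) in \<open>auto simp: U_def of_real_in_ball_iff simp del: mem_ball\<close>)
  then have "\<forall>t\<in>ball s r. complex_of_real (\<phi> t) = 0"
    using f(3) by (simp add: of_real_in_ball_iff del: of_real_eq_0_iff mem_ball)
  then have "\<forall>t\<in>ball s r. \<phi> t = 0" by simp
  then show ?thesis using f(1) by blast
qed

text \<open>The limit points of the zeros form an open and closed subset of \<open>S\<close>.\<close>

lemma analytic_zero_if_limit_of_zeros:
  assumes \<phi>: "locally_holomorphic_extendable S \<phi>" and S: "open S" "connected S"
    and s: "s \<in> S" "s islimpt {t. \<phi> t = 0}" and t: "t \<in> S"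
  shows "\<phi> t = 0"
proof -
  define Z where "Z = {x \<in> S. x islimpt {t. \<phi> t = 0}}"
  have "open Z"
    unfolding open_contains_ball
  proof
    fix x assume "x \<in> Z"
    then have x: "x \<in> S" "x islimpt {t. \<phi> t = 0}" by (auto simp: Z_def)
    obtain r where r: "r > 0" "\<forall>t\<in>ball x r. \<phi> t = 0"
      using analytic_zero_near_limit_of_zeros[OF \<phi> x] by blast
    obtain q where q: "q > 0" "ball x q \<subseteq> S" using S(1) x(1) open_contains_ball by blast
    have "ball x (min q r) \<subseteq> Z"
    proof
      fix y assume y: "y \<in> ball x (min q r)"
      then have yr: "y \<in> ball x r" "y \<in> ball x q" by simp_all
      have "y islimpt ball x r" by (rule open_imp_islimpt) (use yr in simp_all)
      moreover have "ball x r \<subseteq> {t. \<phi> t = 0}" using r by blast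
      ultimately have "y islimpt {t. \<phi> t = 0}" by (rule islimpt_subset)
      then show "y \<in> Z" using yr q by (simp add: Z_def subset_eq)
    qed
    moreover have "min q r > 0" using q r by simp
    ultimately show "\<exists>e>0. ball x e \<subseteq> Z" by blast
  qed
  define L where "L = {x. x islimpt {t. \<phi> t = 0}}"
  have ZL: "Z = S \<inter> L" unfolding Z_def L_def by blast
  have "closed L" unfolding L_def by (rule closed_limpts)
  then have "closedin (top_of_set S) Z" unfolding ZL by (rule closedin_closed_Int)
  moreover have "openin (top_of_set S) Z"
    unfolding openin_open_eq[OF S(1)] using \<open>open Z\<close> ZL by blast
  moreover have "Z \<noteq> {}" using s unfolding Z_def by blast
  ultimately have "Z = S" using S(2) unfolding connected_clopen by blast
  then have "t islimpt {t. \<phi> t = 0}" using t unfolding Z_def by blast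
  from analytic_zero_near_limit_of_zeros[OF \<phi> t this] show ?thesis by auto
qed

lemma analytic_mult_eq_zero:
  assumes \<phi>: "locally_holomorphic_extendable S \<phi>" and \<psi>: "locally_holomorphic_extendable S \<psi>"
    and S: "open S" "connected S" and zero: "\<And>t. t \<in> S \<Longrightarrow> \<phi> t * \<psi> t = 0"
    and a: "a \<in> S" "\<phi> a \<noteq> 0" and t: "t \<in> S"
  shows "\<psi> t = 0"
proof -
  have "\<not> a islimpt {t. \<phi> t = 0}"
    using analytic_zero_if_limit_of_zeros[OF \<phi> S a(1) _ a(1)] a(2) by blast
  moreover have "a islimpt S" using a S by (simp add: open_imp_islimpt)
  moreover have "S \<subseteq> (S - {t. \<phi> t = 0}) \<union> {t. \<phi> t = 0}" by blast
  ultimately have "a islimpt (S - {t. \<phi> t = 0})"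
    using islimpt_Un islimpt_subset by blast
  then have "a islimpt {t. \<psi> t = 0}"
    by (rule islimpt_subset) (use zero in auto)
  then show ?thesis using analytic_zero_if_limit_of_zeros[OF \<psi> S a(1) _ t] by blast
qed

text \<open>
  Analytic functions on an interval have no zero divisors, so the product of finitely many of them
  that do not vanish identically is nonzero somewhere.
\<close>

lemma analytic_common_nonzero:
  assumes "finite K" "open S" "connected S" "S \<noteq> {}"
    and "\<And>k. k \<in> K \<Longrightarrow> locally_holomorphic_extendable S (\<phi> k)"
    and "\<And>k. k \<in> K \<Longrightarrow> \<exists>t\<in>S. \<phi> k t \<noteq> 0"
  shows "\<exists>t\<in>S. \<forall>k\<in>K. \<phi> k t \<noteq> (0::real)"
proof -
  have "locally_holomorphic_extendable S (\<lambda>t. \<Prod>k\<in>K. \<phi> k t) \<and> (\<exists>t\<in>S. (\<Prod>k\<in>K. \<phi> k t) \<noteq> 0)"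
    using assms
  proof (induction K rule: finite_induct)
    case empty
    then show ?case by (auto simp: locally_holomorphic_extendable_const)
  next
    case (insert k K)
    have IH: "locally_holomorphic_extendable S (\<lambda>t. \<Prod>k\<in>K. \<phi> k t)"
      and "\<exists>t\<in>S. (\<Prod>k\<in>K. \<phi> k t) \<noteq> 0"
      using insert.IH[OF insert.prems(1-3)] insert.prems(4,5) by blast+
    then obtain a where a: "a \<in> S" "(\<Prod>k\<in>K. \<phi> k a) \<noteq> 0" by blast
    have k: "locally_holomorphic_extendable S (\<phi> k)" "\<exists>t\<in>S. \<phi> k t \<noteq> 0"
      using insert.prems(4,5)[of k] by blast+
    have "\<exists>t\<in>S. (\<Prod>k\<in>K. \<phi> k t) * \<phi> k t \<noteq> 0"
      using analytic_mult_eq_zero[OF IH k(1) insert.prems(1,2) _ a] k(2) by blast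
    then show ?case
      using insert.hyps locally_holomorphic_extendable_mult[OF k(1) IH] by (simp add: mult.commute)
  qed
  then show ?thesis using assms(1) by (metis prod_zero)
qed

section \<open>Polynomials in three coordinates and semialgebraic sets\<close>

lemma bivariate_eval_pCons [simp]:
  "bivariate_eval (pCons a R) x y = poly a x + y * bivariate_eval R x y"
  by (simp add: bivariate_eval_def)

text \<open>
  The main variable of \<open>P\<close> is \<open>z\<close>, so that division with remainder
  eliminates the third coordinate.
\<close>

definition trivariate_eval :: "real poly poly poly \<Rightarrow> real \<Rightarrow> real \<Rightarrow> real \<Rightarrow> real" where
  "trivariate_eval P x y z = bivariate_eval (poly P [:[:z:]:]) x y"

lemma trivariate_eval_simps [simp]:
  "trivariate_eval 0 x y z = 0"
  "trivariate_eval (A + B) x y z = trivariate_eval A x y z + trivariate_eval B x y z"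
  "trivariate_eval (A * B) x y z = trivariate_eval A x y z * trivariate_eval B x y z"
  "trivariate_eval (smult p A) x y z = bivariate_eval p x y * trivariate_eval A x y z"
  "trivariate_eval (pCons p A) x y z = bivariate_eval p x y + z * trivariate_eval A x y z"
  by (simp_all add: trivariate_eval_def)

lemma locally_holomorphic_extendable_poly:
  assumes "locally_holomorphic_extendable S \<phi>"
  shows "locally_holomorphic_extendable S (\<lambda>t. poly p (\<phi> t))"
  by (induction p)
    (simp_all add: assms locally_holomorphic_extendable_const locally_holomorphic_extendable_add
      locally_holomorphic_extendable_mult)

lemma locally_holomorphic_extendable_bivariate_eval:
  assumes "locally_holomorphic_extendable S \<phi>" "locally_holomorphic_extendable S \<psi>"
  shows "locally_holomorphic_extendable S (\<lambda>t. bivariate_eval R (\<phi> t) (\<psi> t))"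
  by (induction R)
    (simp_all add: assms locally_holomorphic_extendable_const locally_holomorphic_extendable_add
      locally_holomorphic_extendable_mult locally_holomorphic_extendable_poly)

lemma locally_holomorphic_extendable_trivariate_eval:
  assumes "locally_holomorphic_extendable S \<phi>" "locally_holomorphic_extendable S \<psi>"
    "locally_holomorphic_extendable S \<omega>"
  shows "locally_holomorphic_extendable S (\<lambda>t. trivariate_eval P (\<phi> t) (\<psi> t) (\<omega> t))"
  by (induction P)
    (simp_all add: assms locally_holomorphic_extendable_const locally_holomorphic_extendable_add
      locally_holomorphic_extendable_mult locally_holomorphic_extendable_bivariate_eval)

lemma continuous_on_bivariate_eval [continuous_intros]:
  assumes "continuous_on S f" "continuous_on S h"
  shows "continuous_on S (\<lambda>w. bivariate_eval R (f w) (h w))"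
  by (induction R) (auto intro!: continuous_intros assms)

lemma continuous_on_trivariate_eval [continuous_intros]:
  assumes "continuous_on S f" "continuous_on S h" "continuous_on S k"
  shows "continuous_on S (\<lambda>w. trivariate_eval P (f w) (h w) (k w))"
  by (induction P) (auto intro!: continuous_intros assms)

lemma has_derivative_trivariate_eval:
  "((\<lambda>z. trivariate_eval P x y z) has_real_derivative trivariate_eval (pderiv P) x y z) (at z)"
proof (induction P)
  case (pCons a P)
  show ?case by (auto intro!: derivative_eq_intros pCons simp: pderiv_pCons)
qed simp

lemma bounded_linear_coords3:
  fixes f :: "real^3 \<Rightarrow> real" and i j k :: 3
  assumes "bounded_linear f" "UNIV = {i, j, k}" "i \<noteq> j" "i \<noteq> k" "j \<noteq> k"
  shows "f v = v $ i * f (axis i 1) + v $ j * f (axis j 1) + v $ k * f (axis k 1)"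
proof -
  have "f v = f (\<Sum>l\<in>UNIV. v $ l *s axis l 1)" by (simp add: basis_expansion)
  also have "\<dots> = (\<Sum>l\<in>UNIV. v $ l * f (axis l 1))"
    using bounded_linear.linear[OF assms(1)]
    by (simp add: linear_sum scalar_mult_eq_scaleR linear_scale)
  also have "\<dots> = v $ i * f (axis i 1) + v $ j * f (axis j 1) + v $ k * f (axis k 1)"
    unfolding assms(2) using assms(3-5) by simp
  finally show ?thesis .
qed

lemma real_polynomial_function_trivariate:
  fixes p :: "real^3 \<Rightarrow> real" and i j k :: 3
  assumes "real_polynomial_function p" "UNIV = {i, j, k}" "i \<noteq> j" "i \<noteq> k" "j \<noteq> k"
  shows "\<exists>P. \<forall>v. p v = trivariate_eval P (v $ i) (v $ j) (v $ k)"
  using assms(1)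
proof (induction p rule: real_polynomial_function.induct)
  case (linear f)
  have "f v = trivariate_eval [:[:[:0, f (axis i 1):], [:f (axis j 1):]:], [:[:f (axis k 1):]:]:]
      (v $ i) (v $ j) (v $ k)" for v
    using bounded_linear_coords3[OF linear assms(2-), of v] by simp
  then show ?case by blast
next
  case (const c)
  show ?case by (rule exI[of _ "[:[:[:c:]:]:]"]) simp
next
  case (add f h)
  then show ?case by (metis trivariate_eval_simps(2))
next
  case (mult f h)
  then show ?case by (metis trivariate_eval_simps(3))
qed

text \<open>
  Membership depends only on which of the polynomials occurring in the construction of the set are
  positive.
\<close>

lemma semialgebraic_sign_conditions:
  assumes "semialgebraic S"
  shows "\<exists>F. finite F \<and> (\<forall>p\<in>F. real_polynomial_function p) \<and>
           (\<forall>x y. (\<forall>p\<in>F. 0 < p x \<longleftrightarrow> 0 < p y) \<longrightarrow> (x \<in> S \<longleftrightarrow> y \<in> S))"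
  using assms
proof (induction S rule: semialgebraic.induct)
  case (pos p)
  then show ?case by (intro exI[of _ "{p}"]) auto
next
  case (compl S)
  then show ?case by auto
next
  case (inter S T)
  then obtain F G where
    "finite F" "\<forall>p\<in>F. real_polynomial_function p"
    "\<forall>x y. (\<forall>p\<in>F. 0 < p x \<longleftrightarrow> 0 < p y) \<longrightarrow> (x \<in> S \<longleftrightarrow> y \<in> S)"
    "finite G" "\<forall>p\<in>G. real_polynomial_function p"
    "\<forall>x y. (\<forall>p\<in>G. 0 < p x \<longleftrightarrow> 0 < p y) \<longrightarrow> (x \<in> T \<longleftrightarrow> y \<in> T)" by blast
  then show ?case by (intro exI[of _ "F \<union> G"]) blast
qed

lemma edge_parametrization_analytic:
  fixes g :: "real \<Rightarrow> real^3"
  assumes "edge_parametrization g e"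
  shows "locally_holomorphic_extendable {0<..<1} (\<lambda>t. g t $ i)"
  using assms locally_holomorphic_extendable_real_analytic unfolding edge_parametrization_def by blast

lemma eventually_same_sign:
  fixes f :: "'a::t2_space \<Rightarrow> real"
  assumes "isCont f a" "f a \<noteq> 0"
  shows "\<forall>\<^sub>F w in nhds a. f w \<noteq> 0 \<and> (0 < f w \<longleftrightarrow> 0 < f a)"
proof -
  have lim: "(f \<longlongrightarrow> f a) (nhds a)" using assms(1) by (simp add: isCont_def tendsto_nhds_iff)
  consider "0 < f a" | "f a < 0" using assms(2) by linarith
  then show ?thesis
  proof cases
    case 1
    from order_tendstoD(1)[OF lim this] show ?thesis by eventually_elim (use 1 in auto)
  next
    case 2
    from order_tendstoD(2)[OF lim this] show ?thesis by eventually_elim (use 2 in auto)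
  qed
qed

text \<open>The projection of a differentiable arc to a coordinate plane is a null set.\<close>

lemma planar_image_not_neighbourhood:
  fixes g :: "real \<Rightarrow> real^3"
  assumes g: "edge_parametrization g e" and W: "open W" "w \<in> W"
    and cover: "\<And>x y. (x, y) \<in> W \<Longrightarrow> \<exists>v\<in>e. v $ i = x \<and> v $ j = y"
  shows False
proof -
  let ?f = "\<lambda>t. (g t $ i, g t $ j)"
  have "?f differentiable_on {0<..<1}"
    unfolding differentiable_on_def
  proof
    fix t :: real assume t: "t \<in> {0<..<1}"
    note d = locally_holomorphic_extendable_has_derivative[OF edge_parametrization_analytic[OF g] t]
    have "(?f has_derivative (\<lambda>h. (deriv (\<lambda>t. g t $ i) t * h, deriv (\<lambda>t. g t $ j) t * h))) (at t)"
      by (intro has_derivative_Pair d[unfolded has_field_derivative_def])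
    then show "?f differentiable (at t within {0<..<1})"
      using differentiable_at_withinI differentiable_def by blast
  qed
  then have "negligible (?f ` {0<..<1})"
    by (intro negligible_differentiable_image_lowdim) auto
  moreover have "W \<subseteq> ?f ` {0<..<1}"
  proof
    fix w assume "w \<in> W"
    then obtain v where v: "v \<in> e" "v $ i = fst w" "v $ j = snd w" using cover[of "fst w" "snd w"] by auto
    moreover have "e = g ` {0<..<1}" using g by (simp add: edge_parametrization_def)
    ultimately obtain t where "t \<in> {0<..<1}" "v = g t" by blast
    then show "w \<in> ?f ` {0<..<1}" using v by (intro image_eqI[of _ _ t]) auto
  qed
  ultimately have "negligible W" by (rule negligible_subset)
  then show False using open_not_negligible[OF W(1)] W(2) by blast
qed

text \<open>
  Here \<open>Q\<close> plays the role of the minimal equation of the third coordinate over the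
  first two. Near \<open>v0\<close>, a polynomial that does not vanish at \<open>v0\<close> keeps
  its sign, and one that is divisible by \<open>Q\<close>, up to a factor in the first two
  coordinates that is nonzero at \<open>v0\<close>, stays zero on the zero set of \<open>Q\<close>.
  So the points of that zero set near \<open>v0\<close> satisfy the same sign conditions as
  \<open>v0\<close> and belong to \<open>e\<close>.
\<close>

lemma edge_neighbourhood_if_conditions:
  fixes i j k :: 3 and v0 :: "real^3"
  assumes ijk: "UNIV = {i, j, k}" "i \<noteq> j" "i \<noteq> k" "j \<noteq> k"
    and F: "finite F" "\<forall>x y. (\<forall>p\<in>F. 0 < p x \<longleftrightarrow> 0 < p y) \<longrightarrow> (x \<in> e \<longleftrightarrow> y \<in> e)"
    and P: "\<And>p v. p \<in> F \<Longrightarrow> p v = trivariate_eval (P p) (v $ i) (v $ j) (v $ k)"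
    and cond: "\<And>p. p \<in> F \<Longrightarrow> p v0 \<noteq> 0 \<or>
        p v0 = 0 \<and> (\<exists>a q. bivariate_eval a (v0 $ i) (v0 $ j) \<noteq> 0 \<and> smult a (P p) = Q * q)"
    and v0: "v0 \<in> e"
  shows "\<forall>\<^sub>F w in nhds (v0 $ i, v0 $ j, v0 $ k).
      trivariate_eval Q (fst w) (fst (snd w)) (snd (snd w)) = 0 \<longrightarrow>
      (\<exists>v\<in>e. v $ i = fst w \<and> v $ j = fst (snd w))"
proof -
  define w0 where "w0 = (v0 $ i, v0 $ j, v0 $ k)"
  define vec where "vec w = (\<chi> l. if l = i then fst w else if l = j then fst (snd w) else snd (snd w))"
    for w :: "real \<times> real \<times> real"
  have vec: "vec w $ i = fst w" "vec w $ j = fst (snd w)" "vec w $ k = snd (snd w)" for w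
    using ijk by (auto simp: vec_def)
  have cont: "isCont (\<lambda>w. trivariate_eval A (fst w) (fst (snd w)) (snd (snd w))) w0"
    "isCont (\<lambda>w. bivariate_eval B (fst w) (fst (snd w))) w0" for A B
    by (rule continuous_on_interior[of UNIV]; auto intro!: continuous_intros)+
  have "\<forall>\<^sub>F w in nhds w0. trivariate_eval Q (fst w) (fst (snd w)) (snd (snd w)) = 0 \<longrightarrow>
      (0 < p (vec w) \<longleftrightarrow> 0 < p v0)" if p: "p \<in> F" for p
    using cond[OF p]
  proof
    assume "p v0 \<noteq> 0"
    then show ?thesis
      using eventually_same_sign[OF cont(1), of "P p"] P[OF p]
      by (auto simp: vec w0_def elim!: eventually_mono)
  next
    assume *: "p v0 = 0 \<and> (\<exists>a q. bivariate_eval a (v0 $ i) (v0 $ j) \<noteq> 0 \<and> smult a (P p) = Q * q)"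
    then obtain a q where a: "bivariate_eval a (v0 $ i) (v0 $ j) \<noteq> 0" "smult a (P p) = Q * q" by blast
    have "\<forall>\<^sub>F w in nhds w0. bivariate_eval a (fst w) (fst (snd w)) \<noteq> 0"
      using eventually_same_sign[OF cont(2), of a] a(1) by (auto simp: w0_def elim!: eventually_mono)
    then show ?thesis
    proof eventually_elim
      case (elim w)
      have "bivariate_eval a (fst w) (fst (snd w)) * p (vec w) =
          trivariate_eval (smult a (P p)) (fst w) (fst (snd w)) (snd (snd w))"
        by (simp add: P[OF p] vec)
      also have "\<dots> = trivariate_eval Q (fst w) (fst (snd w)) (snd (snd w)) *
          trivariate_eval q (fst w) (fst (snd w)) (snd (snd w))"
        by (simp only: a(2) trivariate_eval_simps)
      finally show ?case using elim * by auto
    qed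
  qed
  then have "\<forall>\<^sub>F w in nhds w0. \<forall>p\<in>F. trivariate_eval Q (fst w) (fst (snd w)) (snd (snd w)) = 0 \<longrightarrow>
      (0 < p (vec w) \<longleftrightarrow> 0 < p v0)"
    using F(1) by (intro eventually_ball_finite) auto
  then show ?thesis
    unfolding w0_def[symmetric]
  proof eventually_elim
    case (elim w)
    show ?case
    proof
      assume "trivariate_eval Q (fst w) (fst (snd w)) (snd (snd w)) = 0"
      then have "vec w \<in> e" using elim F(2) v0 by blast
      then show "\<exists>v\<in>e. v $ i = fst w \<and> v $ j = fst (snd w)" using vec by blast
    qed
  qed
qed

text \<open>
  Continuity of a simple root: the polynomial changes sign across it, and the two signs persist for
  nearby coefficients. If \<open>Q = 0\<close>, every point is a zero.
\<close>

lemma nearby_zero_of_simple_zero: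
  assumes Q: "Q \<noteq> 0 \<Longrightarrow> trivariate_eval (pderiv Q) x0 y0 z0 \<noteq> 0"
    and zero: "trivariate_eval Q x0 y0 z0 = 0" and "d > 0"
  shows "\<exists>W. open W \<and> (x0, y0) \<in> W \<and>
    (\<forall>x y. (x, y) \<in> W \<longrightarrow> (\<exists>z. dist (x, y, z) (x0, y0, z0) < d \<and> trivariate_eval Q x y z = 0))"
proof (cases "Q = 0")
  case True
  have *: "dist (x, y, z0) (x0, y0, z0) = dist (x, y) (x0, y0)" for x y
    by (simp add: dist_prod_def)
  have "\<exists>z. dist (x, y, z) (x0, y0, z0) < d \<and> trivariate_eval Q x y z = 0"
    if "(x, y) \<in> ball (x0, y0) d" for x y
    using True that by (intro exI[of _ z0]) (simp add: * dist_commute[of "(x0, y0)"])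
  then show ?thesis using \<open>d > 0\<close> by (intro exI[of _ "ball (x0, y0) d"]) simp
next
  case False
  define D where "D = trivariate_eval (pderiv Q) x0 y0 z0"
  have der: "(trivariate_eval Q x0 y0 has_real_derivative D) (at z0)"
    unfolding D_def by (rule has_derivative_trivariate_eval)
  have "D \<noteq> 0" using Q False by (simp add: D_def)
  have "\<exists>h. 0 < h \<and> h < d / 2 \<and> trivariate_eval Q x0 y0 (z0 + h) * trivariate_eval Q x0 y0 (z0 - h) < 0"
  proof (cases "D > 0")
    case True
    obtain h1 where h1: "h1 > 0" "\<And>h. 0 < h \<Longrightarrow> h < h1 \<Longrightarrow> 0 < trivariate_eval Q x0 y0 (z0 + h)"
      using DERIV_pos_inc_right[OF der True] zero by auto
    obtain h2 where h2: "h2 > 0" "\<And>h. 0 < h \<Longrightarrow> h < h2 \<Longrightarrow> trivariate_eval Q x0 y0 (z0 - h) < 0"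
      using DERIV_pos_inc_left[OF der True] zero by auto
    define h where "h = min (d / 2) (min h1 h2) / 2"
    have "0 < h" "h < d / 2" "h < h1" "h < h2"
      using h1(1) h2(1) \<open>d > 0\<close> by (auto simp: h_def min_def)
    then show ?thesis using h1(2) h2(2) by (meson mult_pos_neg)
  next
    case False
    then have "D < 0" using \<open>D \<noteq> 0\<close> by simp
    obtain h1 where h1: "h1 > 0" "\<And>h. 0 < h \<Longrightarrow> h < h1 \<Longrightarrow> trivariate_eval Q x0 y0 (z0 + h) < 0"
      using DERIV_neg_dec_right[OF der \<open>D < 0\<close>] zero by auto
    obtain h2 where h2: "h2 > 0" "\<And>h. 0 < h \<Longrightarrow> h < h2 \<Longrightarrow> 0 < trivariate_eval Q x0 y0 (z0 - h)"
      using DERIV_neg_dec_left[OF der \<open>D < 0\<close>] zero by auto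
    define h where "h = min (d / 2) (min h1 h2) / 2"
    have "0 < h" "h < d / 2" "h < h1" "h < h2"
      using h1(1) h2(1) \<open>d > 0\<close> by (auto simp: h_def min_def)
    then show ?thesis using h1(2) h2(2) by (meson mult_neg_pos)
  qed
  then obtain h where h: "0 < h" "h < d / 2"
    "trivariate_eval Q x0 y0 (z0 + h) * trivariate_eval Q x0 y0 (z0 - h) < 0" by blast
  define G where "G = (\<lambda>w. trivariate_eval Q (fst w) (snd w) (z0 + h) * trivariate_eval Q (fst w) (snd w) (z0 - h))"
  define W where "W = {w. G w < 0} \<inter> ball (x0, y0) (d / 2)"
  have "continuous_on UNIV G" unfolding G_def by (intro continuous_intros)
  then have "open {w. G w < 0}" by (intro open_Collect_less continuous_on_const)
  then have "open W" unfolding W_def by auto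
  moreover have "(x0, y0) \<in> W" using h \<open>d > 0\<close> by (simp add: W_def G_def)
  moreover have "\<exists>z. dist (x, y, z) (x0, y0, z0) < d \<and> trivariate_eval Q x y z = 0" if w: "(x, y) \<in> W" for x y
  proof -
    have neg: "trivariate_eval Q x y (z0 + h) * trivariate_eval Q x y (z0 - h) < 0"
      using w by (simp add: W_def G_def)
    have cont: "continuous_on {z0 - h..z0 + h} (trivariate_eval Q x y)"
      by (intro continuous_intros)
    have "\<exists>z\<ge>z0 - h. z \<le> z0 + h \<and> trivariate_eval Q x y z = 0"
    proof (cases "trivariate_eval Q x y (z0 - h) \<le> 0")
      case True
      then have "0 \<le> trivariate_eval Q x y (z0 + h)" using neg by (smt (verit) mult_nonpos_nonpos)
      then show ?thesis using IVT'[of "trivariate_eval Q x y" "z0 - h" 0 "z0 + h"] True h(1) cont by auto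
    next
      case False
      then have "trivariate_eval Q x y (z0 + h) \<le> 0" using neg by (smt (verit) mult_nonneg_nonneg)
      then show ?thesis using IVT2'[of "trivariate_eval Q x y" "z0 + h" 0 "z0 - h"] False h(1) cont by auto
    qed
    then obtain z where z: "z0 - h \<le> z" "z \<le> z0 + h" "trivariate_eval Q x y z = 0" by blast
    have "dist (x, y, z) (x0, y0, z0) \<le> dist (x, y, z) (x0, y0, z) + dist (x0, y0, z) (x0, y0, z0)"
      by (rule dist_triangle)
    also have "dist (x, y, z) (x0, y0, z) = dist (x, y) (x0, y0)" by (simp add: dist_prod_def)
    also have "dist (x0, y0, z) (x0, y0, z0) = \<bar>z - z0\<bar>" by (simp add: dist_prod_def dist_real_def)
    also have "dist (x, y) (x0, y0) < d / 2" using w by (simp add: W_def dist_commute)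
    also have "\<bar>z - z0\<bar> \<le> h" using z by linarith
    finally show ?thesis using z(3) h(2) by force
  qed
  ultimately show ?thesis by blast
qed

section \<open>Polynomials on a semialgebraic edge\<close>

text \<open>
  Were two coordinates algebraically independent on the edge, the edge would contain a whole sheet
  over an open subset of their coordinate plane, which the image of an arc does not. To see this,
  let \<open>I\<close> be the ideal of polynomials vanishing on the edge. Over the field of rational
  functions of the first two coordinates it is principal, generated by a polynomial \<open>Q\<close>
  of minimal degree; minimality also shows that the derivative of \<open>Q\<close> does not vanish
  on the edge. At a generic point of the edge, all defining polynomials outside \<open>I\<close> are
  nonzero, and \<open>Q\<close> has a simple root, which survives on an open set of the plane. By
  \<open>edge_neighbourhood_if_conditions\<close> the points so obtained lie on the edge.
\<close>

lemma edge_coordinates_dependent: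
  fixes g :: "real \<Rightarrow> real^3" and i j k :: 3
  assumes e: "semialgebraic e" and g: "edge_parametrization g e"
    and ijk: "UNIV = {i, j, k}" "i \<noteq> j" "i \<noteq> k" "j \<noteq> k"
  shows "algebraic_over {0<..<1} (\<lambda>t. g t $ i) (\<lambda>t. g t $ j)"
proof (rule ccontr)
  assume indep: "\<not> algebraic_over {0<..<1} (\<lambda>t. g t $ i) (\<lambda>t. g t $ j)"
  let ?T = "{0<..<1::real}"
  let ?ev = "\<lambda>P t. trivariate_eval P (g t $ i) (g t $ j) (g t $ k)"
  define I where "I = {P. \<forall>t\<in>?T. ?ev P t = 0}"
  note ana = edge_parametrization_analytic[OF g]
  have biv_nz: "\<exists>t\<in>?T. bivariate_eval A (g t $ i) (g t $ j) \<noteq> 0" if "A \<noteq> 0" for A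
    using indep that unfolding algebraic_over_def by blast
  obtain F where F: "finite F" "\<And>p. p \<in> F \<Longrightarrow> real_polynomial_function p"
    "\<forall>x y. (\<forall>p\<in>F. 0 < p x \<longleftrightarrow> 0 < p y) \<longrightarrow> (x \<in> e \<longleftrightarrow> y \<in> e)"
    using semialgebraic_sign_conditions[OF e] by blast
  have "\<forall>p\<in>F. \<exists>P. \<forall>v. p v = trivariate_eval P (v $ i) (v $ j) (v $ k)"
    using real_polynomial_function_trivariate[OF F(2) ijk] by blast
  then obtain P where P: "\<And>p v. p \<in> F \<Longrightarrow> p v = trivariate_eval (P p) (v $ i) (v $ j) (v $ k)"
    by metis
  \<comment> \<open>a generator of the ideal over the field of fractions of the first two coordinates\<close>
  obtain Q where Q: "Q \<in> I" "Q \<noteq> 0 \<Longrightarrow> pderiv Q \<notin> I"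
    "\<And>R. R \<in> I \<Longrightarrow> \<exists>a q. a \<noteq> 0 \<and> smult a R = Q * q"
  proof (cases "I = {0}")
    case True
    show ?thesis by (rule that[of 0]) (use True in \<open>auto intro: exI[of _ 1]\<close>)
  next
    case False
    have "0 \<in> I" by (simp add: I_def)
    then obtain Q0 where "Q0 \<in> I - {0}" using False by blast
    then obtain Q where Q: "Q \<in> I - {0}" "\<And>R. R \<in> I - {0} \<Longrightarrow> degree Q \<le> degree R"
      using ex_has_least_nat[of "\<lambda>R. R \<in> I - {0}" Q0 degree] by blast
    have deg: "degree Q > 0"
    proof (rule ccontr)
      assume "\<not> degree Q > 0"
      then obtain A where A: "Q = [:A:]" by (metis degree_eq_zeroE not_gr_zero)
      then have "A \<noteq> 0" "\<forall>t\<in>?T. bivariate_eval A (g t $ i) (g t $ j) = 0"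
        using Q(1) by (auto simp: I_def)
      then show False using biv_nz by blast
    qed
    show ?thesis
    proof (rule that[of Q])
      show "Q \<in> I" using Q(1) by simp
      have "pderiv Q \<noteq> 0" "degree (pderiv Q) < degree Q"
        using deg by (simp_all add: pderiv_eq_0_iff degree_pderiv)
      then show "pderiv Q \<notin> I" using Q(2)[of "pderiv Q"] by auto
      fix R assume R: "R \<in> I"
      have "Q \<noteq> 0" using Q(1) by simp
      obtain a q where aq: "a \<noteq> 0" "smult a R = Q * q + pseudo_mod R Q"
        using pseudo_mod(1)[OF \<open>Q \<noteq> 0\<close>, of R] by blast
      have "pseudo_mod R Q \<in> I"
        unfolding I_def
      proof (intro CollectI ballI)
        fix t :: real assume "t \<in> ?T"
        then have "?ev (smult a R) t = 0" "?ev (Q * q) t = 0"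
          using R Q(1) by (simp_all add: I_def)
        then show "?ev (pseudo_mod R Q) t = 0"
          unfolding aq(2) by (metis add_0 trivariate_eval_simps(2))
      qed
      then have "pseudo_mod R Q = 0"
        using pseudo_mod(2)[OF \<open>Q \<noteq> 0\<close>, of R] Q(2)[of "pseudo_mod R Q"] by fastforce
      then show "\<exists>a q. a \<noteq> 0 \<and> smult a R = Q * q" using aq by auto
    qed
  qed
  from Q(3) obtain a where a: "\<And>R. R \<in> I \<Longrightarrow> a R \<noteq> 0" "\<And>R. R \<in> I \<Longrightarrow> \<exists>q. smult (a R) R = Q * q"
    by metis
  \<comment> \<open>a point of the edge that is generic for all these polynomials\<close>
  define gen where "gen R = (if R \<in> I then [:a R:] else R)" for R
  have "gen R \<notin> I" for R
    using a(1)[of R] biv_nz[of "a R"] by (auto simp: gen_def I_def)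
  define K where "K = (gen \<circ> P) ` F \<union> (if Q = 0 then {} else {pderiv Q})"
  have "K \<inter> I = {}"
    unfolding K_def using \<open>\<And>R. gen R \<notin> I\<close> Q(2) by auto
  have "\<exists>t\<in>?T. \<forall>R\<in>K. ?ev R t \<noteq> 0"
  proof (rule analytic_common_nonzero)
    show "finite K" unfolding K_def using F(1) by simp
    show "locally_holomorphic_extendable ?T (?ev R)" for R
      by (intro locally_holomorphic_extendable_trivariate_eval ana)
    show "\<exists>t\<in>?T. ?ev R t \<noteq> 0" if "R \<in> K" for R
      using that \<open>K \<inter> I = {}\<close> unfolding I_def by blast
  qed auto
  then obtain t where t: "t \<in> ?T" "\<And>R. R \<in> K \<Longrightarrow> ?ev R t \<noteq> 0" by blast
  have "g t \<in> e" using g t(1) by (auto simp: edge_parametrization_def)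
  have "\<forall>\<^sub>F w in nhds (g t $ i, g t $ j, g t $ k).
      trivariate_eval Q (fst w) (fst (snd w)) (snd (snd w)) = 0 \<longrightarrow>
      (\<exists>v\<in>e. v $ i = fst w \<and> v $ j = fst (snd w))"
  proof (rule edge_neighbourhood_if_conditions[OF ijk F(1,3) P _ \<open>g t \<in> e\<close>])
    fix p assume p: "p \<in> F"
    then have nz: "?ev (gen (P p)) t \<noteq> 0" by (intro t(2)) (auto simp: K_def)
    show "p (g t) \<noteq> 0 \<or>
        p (g t) = 0 \<and> (\<exists>a q. bivariate_eval a (g t $ i) (g t $ j) \<noteq> 0 \<and> smult a (P p) = Q * q)"
    proof (cases "P p \<in> I")
      case True
      then have "p (g t) = 0" using t(1) by (simp add: P[OF p] I_def)
      moreover have "bivariate_eval (a (P p)) (g t $ i) (g t $ j) \<noteq> 0"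
        using nz True by (simp add: gen_def)
      ultimately show ?thesis using a(2)[OF True] by blast
    next
      case False
      then show ?thesis using nz by (simp add: gen_def P[OF p])
    qed
  qed
  then obtain d where d: "d > 0" "\<And>w. dist w (g t $ i, g t $ j, g t $ k) < d \<Longrightarrow>
      trivariate_eval Q (fst w) (fst (snd w)) (snd (snd w)) = 0 \<Longrightarrow>
      \<exists>v\<in>e. v $ i = fst w \<and> v $ j = fst (snd w)"
    unfolding eventually_nhds_metric by blast
  have "?ev Q t = 0" using Q(1) t(1) by (simp add: I_def)
  moreover have "?ev (pderiv Q) t \<noteq> 0" if "Q \<noteq> 0" by (rule t(2)) (use that in \<open>simp add: K_def\<close>)
  ultimately obtain W where W: "open W" "(g t $ i, g t $ j) \<in> W"
    "\<And>x y. (x, y) \<in> W \<Longrightarrow> \<exists>z. dist (x, y, z) (g t $ i, g t $ j, g t $ k) < d \<and> trivariate_eval Q x y z = 0"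
    using nearby_zero_of_simple_zero[of Q "g t $ i" "g t $ j" "g t $ k" d] d(1) by blast
  have "\<exists>v\<in>e. v $ i = x \<and> v $ j = y" if xy: "(x, y) \<in> W" for x y
  proof -
    obtain z where "dist (x, y, z) (g t $ i, g t $ j, g t $ k) < d" "trivariate_eval Q x y z = 0"
      using W(3)[OF xy] by blast
    then show ?thesis using d(2)[of "(x, y, z)"] by simp
  qed
  then show False using planar_image_not_neighbourhood[OF g W(1,2)] by blast
qed

lemma exists_third_index:
  fixes i j :: 3
  assumes "i \<noteq> j"
  shows "\<exists>k. UNIV = {i, j, k} \<and> i \<noteq> k \<and> j \<noteq> k"
proof -
  have "(1::3) \<noteq> 2" "(1::3) \<noteq> 3" "(2::3) \<noteq> 3" by simp_all
  then show ?thesis using assms exhaust_3[of i] exhaust_3[of j] unfolding UNIV_3 by auto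
qed

lemma edge_polynomial_algebraic_over_coordinate:
  fixes g :: "real \<Rightarrow> real^3"
  assumes e: "semialgebraic e" and g: "edge_parametrization g e" and F: "real_polynomial_function F"
  shows "algebraic_over {0<..<1} (\<lambda>t. g t $ j) (\<lambda>t. F (g t))"
  using F
proof (induction F rule: real_polynomial_function.induct)
  case (linear f)
  have coord: "algebraic_over {0<..<1} (\<lambda>t. g t $ j) (\<lambda>t. g t $ i)" for i
  proof (cases "i = j")
    case True
    then show ?thesis by (simp add: algebraic_over_self)
  next
    case False
    then show ?thesis
      using exists_third_index[of j i] edge_coordinates_dependent[OF e g] by metis
  qed
  have "(\<lambda>t. f (g t)) = (\<lambda>t. g t $ 1 * f (axis 1 1) + g t $ 2 * f (axis 2 1) + g t $ 3 * f (axis 3 1))"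
    by (rule ext, rule bounded_linear_coords3[OF linear UNIV_3]) simp_all
  then show ?case
    by (auto intro!: algebraic_over_add algebraic_over_mult coord algebraic_over_const)
qed (auto intro: algebraic_over_add algebraic_over_mult algebraic_over_const)

lemma edge_polynomial_analytic:
  fixes g :: "real \<Rightarrow> real^3"
  assumes g: "edge_parametrization g e" and F: "real_polynomial_function F"
  shows "locally_holomorphic_extendable {0<..<1} (\<lambda>t. F (g t))"
  using F
proof (induction F rule: real_polynomial_function.induct)
  case (linear f)
  have "(\<lambda>t. f (g t)) = (\<lambda>t. g t $ 1 * f (axis 1 1) + g t $ 2 * f (axis 2 1) + g t $ 3 * f (axis 3 1))"
    by (rule ext, rule bounded_linear_coords3[OF linear UNIV_3]) simp_all
  then show ?case
    by (auto intro!: locally_holomorphic_extendable_add locally_holomorphic_extendable_mult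
        edge_parametrization_analytic[OF g] locally_holomorphic_extendable_const)
qed (auto intro: locally_holomorphic_extendable_add locally_holomorphic_extendable_mult
    locally_holomorphic_extendable_const)

lemma edge_parametrization_inj:
  assumes "edge_parametrization g e"
  shows "inj_on g {0..1}"
  using assms by (simp add: edge_parametrization_def arc_def)

text \<open>
  For each coordinate, take an equation of minimal degree relating it to \<open>G\<close>. Its
  constant term is not zero, since otherwise a factor \<open>y\<close> could be split off. At a zero
  of \<open>G\<close> the coordinate is a root of this constant term, so every coordinate takes
  finitely many values on the zeros.
\<close>

lemma finite_zeros_of_polynomial_on_edge:
  fixes g :: "real \<Rightarrow> real^3"
  assumes e: "semialgebraic e" and g: "edge_parametrization g e" and G: "real_polynomial_function G"
    and a: "a \<in> {0<..<1}" "G (g a) \<noteq> 0"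
  shows "finite {t\<in>{0<..<1}. G (g t) = 0}"
proof -
  let ?T = "{0<..<1::real}"
  define Z where "Z = {t\<in>?T. G (g t) = 0}"
  have "finite ((\<lambda>t. g t $ j) ` Z)" for j
  proof -
    let ?ann = "\<lambda>R. R \<noteq> 0 \<and> (\<forall>t\<in>?T. bivariate_eval R (g t $ j) (G (g t)) = 0)"
    obtain R0 where "?ann R0"
      using edge_polynomial_algebraic_over_coordinate[OF e g G, of j] unfolding algebraic_over_def by blast
    then obtain R where R: "?ann R" "\<And>R'. ?ann R' \<Longrightarrow> degree R \<le> degree R'"
      using ex_has_least_nat[of ?ann R0 degree] by blast
    have nz: "coeff R 0 \<noteq> 0"
    proof
      assume 0: "coeff R 0 = 0"
      then obtain R' where R': "R = pCons 0 R'" by (metis coeff_pCons_0 pCons_cases)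
      then have "R' \<noteq> 0" using R(1) by auto
      have "bivariate_eval R' (g t $ j) (G (g t)) = 0" if t: "t \<in> ?T" for t
      proof (rule analytic_mult_eq_zero[OF edge_polynomial_analytic[OF g G] _ _ _ _ a t])
        show "locally_holomorphic_extendable ?T (\<lambda>t. bivariate_eval R' (g t $ j) (G (g t)))"
          by (intro locally_holomorphic_extendable_bivariate_eval edge_parametrization_analytic[OF g]
              edge_polynomial_analytic[OF g G])
        show "G (g t) * bivariate_eval R' (g t $ j) (G (g t)) = 0" if "t \<in> ?T" for t
          using R(1) that unfolding R' by simp
      qed auto
      then have "degree R \<le> degree R'" using \<open>R' \<noteq> 0\<close> by (intro R(2)) auto
      then show False using R' \<open>R' \<noteq> 0\<close> by simp
    qed
    have "(\<lambda>t. g t $ j) ` Z \<subseteq> {x. poly (coeff R 0) x = 0}"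
    proof (clarsimp simp: Z_def)
      fix t :: real assume t: "0 < t" "t < 1" "G (g t) = 0"
      then have "bivariate_eval R (g t $ j) 0 = 0" using R(1) by (metis greaterThanLessThan_iff)
      then show "poly (coeff R 0) (g t $ j) = 0"
        by (cases R) simp
    qed
    then show ?thesis using poly_roots_finite[OF nz] finite_subset by blast
  qed
  moreover have "(\<lambda>t. (g t $ 1, g t $ 2, g t $ 3)) ` Z \<subseteq>
      (\<lambda>t. g t $ 1) ` Z \<times> (\<lambda>t. g t $ 2) ` Z \<times> (\<lambda>t. g t $ 3) ` Z" by auto
  ultimately have "finite ((\<lambda>t. (g t $ 1, g t $ 2, g t $ 3)) ` Z)"
    by (meson finite_SigmaI finite_subset)
  moreover have "inj_on (\<lambda>t. (g t $ 1, g t $ 2, g t $ 3)) Z"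
  proof (rule inj_onI)
    fix s t assume st: "s \<in> Z" "t \<in> Z" "(g s $ 1, g s $ 2, g s $ 3) = (g t $ 1, g t $ 2, g t $ 3)"
    then have "g s = g t" by (simp add: vec_eq_iff forall_3)
    moreover have "s \<in> {0..1}" "t \<in> {0..1}" using st by (auto simp: Z_def)
    ultimately show "s = t" using inj_onD[OF edge_parametrization_inj[OF g]] by blast
  qed
  ultimately have "finite Z" by (rule finite_imageD)
  then show ?thesis by (simp add: Z_def)
qed

text \<open>
  At a critical point of \<open>\<phi>\<close> only the coefficients of \<open>R\<close> contribute
  to the derivative.
\<close>

lemma has_derivative_bivariate_eval_critical:
  assumes "(\<psi> has_real_derivative \<psi>') (at t)" "(\<phi> has_real_derivative 0) (at t)"
  shows "((\<lambda>t. bivariate_eval R (\<psi> t) (\<phi> t)) has_real_derivative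
      bivariate_eval (map_poly pderiv R) (\<psi> t) (\<phi> t) * \<psi>') (at t)"
proof (induction R)
  case (pCons a R)
  have "((\<lambda>t. poly a (\<psi> t)) has_real_derivative poly (pderiv a) (\<psi> t) * \<psi>') (at t)"
    by (rule DERIV_chain2[OF poly_DERIV assms(1)])
  from DERIV_add[OF this DERIV_mult[OF assms(2) pCons.IH]] show ?case
    by (simp add: map_poly_pCons algebra_simps)
qed simp

lemma real_polynomial_function_poly:
  assumes "real_polynomial_function f"
  shows "real_polynomial_function (\<lambda>x. poly p (f x))"
proof (induction p)
  case (pCons a p)
  show ?case
    using real_polynomial_function.intros(3)[OF real_polynomial_function.intros(2)[of a]
      real_polynomial_function.intros(4)[OF assms pCons.IH]] by simp
qed (simp add: real_polynomial_function.intros(2))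

lemma real_polynomial_function_bivariate_eval:
  assumes "real_polynomial_function f" "real_polynomial_function h"
  shows "real_polynomial_function (\<lambda>x. bivariate_eval R (f x) (h x))"
proof (induction R)
  case (pCons a R)
  show ?case
    using real_polynomial_function.intros(3)[OF real_polynomial_function_poly[OF assms(1), of a]
      real_polynomial_function.intros(4)[OF assms(2) pCons.IH]] by simp
qed (simp add: real_polynomial_function.intros(2))

lemma edge_parametrization_deriv_nonzero:
  fixes g :: "real \<Rightarrow> real^3"
  assumes g: "edge_parametrization g e" and t: "t \<in> {0<..<1}"
  shows "(g has_vector_derivative (\<chi> i. deriv (\<lambda>t. g t $ i) t)) (at t)"
    and "\<exists>j. deriv (\<lambda>t. g t $ j) t \<noteq> 0"
proof -
  show *: "(g has_vector_derivative (\<chi> i. deriv (\<lambda>t. g t $ i) t)) (at t)"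
    unfolding has_vector_derivative_def
  proof (subst has_derivative_componentwise_within, intro ballI)
    fix b :: "real^3" assume "b \<in> Basis"
    then obtain i where b: "b = axis i 1" by (auto simp: Basis_vec_def)
    show "((\<lambda>x. g x \<bullet> b) has_derivative (\<lambda>x. (x *\<^sub>R (\<chi> i. deriv (\<lambda>t. g t $ i) t)) \<bullet> b)) (at t)"
      using locally_holomorphic_extendable_has_derivative[OF edge_parametrization_analytic[OF g, of i] t]
      by (simp add: b inner_axis has_field_derivative_def mult_commute_abs)
  qed
  show "\<exists>j. deriv (\<lambda>t. g t $ j) t \<noteq> 0"
  proof (rule ccontr)
    assume "\<not> ?thesis"
    then have "vector_derivative g (at t) = 0"
      using vector_derivative_at[OF *] by (simp add: vec_eq_iff)
    then show False using g t by (simp add: edge_parametrization_def)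
  qed
qed

text \<open>
  Let \<open>R\<close> relate a coordinate \<open>\<psi>\<close> to the function
  \<open>\<phi>\<close>, with coefficients of minimal degree in \<open>\<psi>\<close>.
  Differentiating the relation at a critical point of \<open>\<phi>\<close> with nonzero derivative
  of \<open>\<psi>\<close> shows that the polynomial \<open>S\<close>, obtained by differentiating
  the coefficients of \<open>R\<close>, vanishes there. By minimality \<open>S\<close> does not
  vanish on the whole edge, so this happens finitely often. As the parametrization is regular, at
  every point some coordinate has nonzero derivative.
\<close>

lemma finite_critical_points_of_polynomial_on_edge:
  fixes g :: "real \<Rightarrow> real^3"
  assumes e: "semialgebraic e" and g: "edge_parametrization g e" and F: "real_polynomial_function F"
    and a: "a \<in> {0<..<1}" "deriv (\<lambda>t. F (g t)) a \<noteq> 0"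
  shows "finite {t\<in>{0<..<1}. deriv (\<lambda>t. F (g t)) t = 0}"
proof -
  let ?T = "{0<..<1::real}"
  define \<phi> where "\<phi> = (\<lambda>t. F (g t))"
  have \<phi>_ana: "locally_holomorphic_extendable ?T \<phi>"
    unfolding \<phi>_def by (rule edge_polynomial_analytic[OF g F])
  note D\<phi> = locally_holomorphic_extendable_has_derivative[OF \<phi>_ana]
  have "finite {t\<in>?T. deriv \<phi> t = 0 \<and> deriv (\<lambda>t. g t $ j) t \<noteq> 0}" for j
  proof -
    define \<psi> where "\<psi> = (\<lambda>t. g t $ j)"
    note D\<psi> = locally_holomorphic_extendable_has_derivative[OF edge_parametrization_analytic[OF g, of j], folded \<psi>_def]
    let ?ann = "\<lambda>R. R \<noteq> 0 \<and> (\<forall>t\<in>?T. bivariate_eval R (\<psi> t) (\<phi> t) = 0)"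
    let ?bound = "\<lambda>R d. \<forall>i. degree (coeff R i) \<le> d"
    obtain R0 where "?ann R0"
      using edge_polynomial_algebraic_over_coordinate[OF e g F, of j]
      unfolding algebraic_over_def \<phi>_def \<psi>_def by blast
    moreover have "?bound R0 (\<Sum>i\<le>degree R0. degree (coeff R0 i))"
    proof
      fix i show "degree (coeff R0 i) \<le> (\<Sum>i\<le>degree R0. degree (coeff R0 i))"
        by (cases "i \<le> degree R0") (auto intro: member_le_sum simp: coeff_eq_0)
    qed
    ultimately have ex: "\<exists>d R. ?ann R \<and> ?bound R d" by blast
    define d where "d = (LEAST d. \<exists>R. ?ann R \<and> ?bound R d)"
    have d: "\<exists>R. ?ann R \<and> ?bound R d"
      unfolding d_def using ex by (rule LeastI_ex)
    have d_le: "d \<le> d'" if "?ann R" "?bound R d'" for d' R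
      unfolding d_def by (rule Least_le) (use that in blast)
    from d obtain R where R: "?ann R" "?bound R d" by blast
    define S where "S = map_poly pderiv R"
    have coeff_S: "coeff S i = pderiv (coeff R i)" for i
      by (simp add: S_def coeff_map_poly)
    have der0: "bivariate_eval S (\<psi> t) (\<phi> t) * deriv \<psi> t = 0" if t: "t \<in> ?T" "deriv \<phi> t = 0" for t
    proof -
      have 1: "((\<lambda>t. bivariate_eval R (\<psi> t) (\<phi> t)) has_real_derivative
          bivariate_eval S (\<psi> t) (\<phi> t) * deriv \<psi> t) (at t)"
        unfolding S_def using has_derivative_bivariate_eval_critical[OF D\<psi>[OF t(1)]] D\<phi>[OF t(1)] t(2) by simp
      have "((\<lambda>t. 0) has_real_derivative bivariate_eval S (\<psi> t) (\<phi> t) * deriv \<psi> t) (at t)"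
        by (rule has_field_derivative_transform_within_open[OF 1, of ?T]) (use R(1) t in auto)
      from DERIV_unique[OF this DERIV_const] show ?thesis .
    qed
    have "\<exists>t\<in>?T. bivariate_eval S (\<psi> t) (\<phi> t) \<noteq> 0"
    proof (cases "d = 0")
      case True
      \<comment> \<open>then \<open>\<phi>\<close> is algebraic over the constants\<close>
      define p where "p = map_poly (\<lambda>q. coeff q 0) R"
      have const: "coeff R i = [:coeff p i:]" for i
      proof -
        have "degree (coeff R i) = 0" using R(2) True by simp
        then obtain c where "coeff R i = [:c:]" by (rule degree_eq_zeroE)
        then show ?thesis by (simp add: p_def coeff_map_poly)
      qed
      have "p \<noteq> 0"
      proof
        assume "p = 0"
        then have "coeff R i = 0" for i using const[of i] by simp
        then show False using R(1) by (simp add: poly_eq_iff)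
      qed
      have "poly p (\<phi> t) = bivariate_eval R (\<psi> t) (\<phi> t)" for t
      proof -
        have deg: "degree p \<le> degree R" unfolding p_def by (rule map_poly_degree_leq)
        have "poly p (\<phi> t) = (\<Sum>i\<le>degree R. coeff p i * \<phi> t ^ i)"
          unfolding poly_altdef by (rule sum.mono_neutral_left) (use deg in \<open>auto simp: coeff_eq_0\<close>)
        also have "\<dots> = bivariate_eval R (\<psi> t) (\<phi> t)"
          unfolding bivariate_eval_altdef const by simp
        finally show ?thesis .
      qed
      then have "\<phi> ` ?T \<subseteq> {x. poly p x = 0}" using R(1) by auto
      then have "finite (\<phi> ` ?T)" using poly_roots_finite[OF \<open>p \<noteq> 0\<close>] finite_subset by blast
      moreover have "connected (\<phi> ` ?T)"
        by (intro connected_continuous_image locally_holomorphic_extendable_continuous_on[OF \<phi>_ana]) simp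
      ultimately obtain c where "\<phi> ` ?T \<subseteq> {c}"
        using connected_finite_iff_sing[of "\<phi> ` ?T"] by blast
      then have c: "\<phi> x = c" if "x \<in> ?T" for x using that by blast
      have "((\<lambda>t. c) has_real_derivative deriv \<phi> a) (at a)"
        by (rule has_field_derivative_transform_within_open[OF D\<phi>[OF a(1)] open_greaterThanLessThan a(1) c])
      from DERIV_unique[OF this DERIV_const] have "deriv \<phi> a = 0" .
      then show ?thesis using a(2) by (simp add: \<phi>_def)
    next
      case False
      have "S \<noteq> 0"
      proof
        assume "S = 0"
        then have "pderiv (coeff R i) = 0" for i using coeff_S[of i] by simp
        then have "?bound R 0" by (simp add: pderiv_eq_0_iff)
        then show False using d_le[of R 0] R(1) False by blast
      qed
      moreover have "?bound S (d - 1)"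
        using R(2) by (auto simp: coeff_S degree_pderiv intro: diff_le_mono)
      ultimately show ?thesis using d_le[of S "d - 1"] False by fastforce
    qed
    then obtain b where b: "b \<in> ?T" "bivariate_eval S (\<psi> b) (\<phi> b) \<noteq> 0" by blast
    have "finite {t\<in>?T. bivariate_eval S (g t $ j) (F (g t)) = 0}"
    proof (rule finite_zeros_of_polynomial_on_edge[OF e g _ b(1)])
      show "real_polynomial_function (\<lambda>x. bivariate_eval S (x $ j) (F x))"
        by (rule real_polynomial_function_bivariate_eval[OF real_polynomial_function.intros(1)[OF bounded_linear_vec_nth] F])
    qed (use b(2) in \<open>simp add: \<phi>_def \<psi>_def\<close>)
    then show ?thesis
      by (rule rev_finite_subset) (use der0 in \<open>auto simp: \<phi>_def \<psi>_def\<close>)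
  qed
  then have "finite (\<Union>j. {t\<in>?T. deriv \<phi> t = 0 \<and> deriv (\<lambda>t. g t $ j) t \<noteq> 0})" by simp
  then show ?thesis
    by (rule rev_finite_subset) (use edge_parametrization_deriv_nonzero(2)[OF g] in \<open>auto simp: \<phi>_def\<close>)
qed

section \<open>Directions at the end points of an edge\<close>

lemma edge_parametrization_reversepath:
  assumes "edge_parametrization g e"
  shows "edge_parametrization (reversepath g) e"
  unfolding edge_parametrization_def
proof (intro conjI)
  have g: "arc g" "g ` {0<..<1} = e" "real_analytic_on {0<..<1} g"
    "\<And>t. t \<in> {0<..<1} \<Longrightarrow> vector_derivative g (at t) \<noteq> 0"
    using assms by (auto simp: edge_parametrization_def)
  show "arc (reversepath g)" using g(1) by (rule arc_reversepath)
  have "(\<lambda>t. 1 - t) ` {0<..<1::real} = {0<..<1}"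
    by (auto intro!: image_eqI[of _ _ "1 - _"])
  then show "reversepath g ` {0<..<1} = e"
    unfolding reversepath_def by (metis (no_types, lifting) g(2) image_cong image_image)
  show "real_analytic_on {0<..<1} (reversepath g)"
    unfolding real_analytic_on_def
  proof
    fix s :: real assume s: "s \<in> {0<..<1}"
    then have "1 - s \<in> {0<..<1}" by simp
    then obtain r a where ra: "r > 0" "\<And>t. t \<in> ball (1 - s) r \<Longrightarrow> (\<lambda>n. (t - (1 - s)) ^ n *\<^sub>R a n) sums g t"
      using g(3) unfolding real_analytic_on_def by blast
    have "(\<lambda>n. (t - s) ^ n *\<^sub>R ((- 1) ^ n *\<^sub>R a n)) sums reversepath g t" if t: "t \<in> ball s r" for t
    proof -
      have "(\<lambda>n. ((1 - t) - (1 - s)) ^ n *\<^sub>R a n) sums g (1 - t)"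
        by (rule ra(2)) (use t in \<open>simp add: dist_real_def abs_minus_commute\<close>)
      moreover have "((1 - t) - (1 - s)) ^ n = (t - s) ^ n * (- 1) ^ n" for n
      proof -
        have "(1 - t) - (1 - s) = (t - s) * (- 1)" by simp
        then show ?thesis by (simp only: power_mult_distrib)
      qed
      ultimately show ?thesis by (simp only: reversepath_def scaleR_scaleR)
    qed
    then show "\<exists>r>0. \<exists>a. \<forall>t\<in>ball s r. (\<lambda>n. (t - s) ^ n *\<^sub>R a n) sums reversepath g t"
      using ra(1) by (intro exI[of _ r] conjI exI[of _ "\<lambda>n. (- 1) ^ n *\<^sub>R a n"] ballI)
  qed
  show "\<forall>t\<in>{0<..<1}. vector_derivative (reversepath g) (at t) \<noteq> 0"
  proof
    fix t :: real assume t: "t \<in> {0<..<1}"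
    define d where "d = (\<chi> i. deriv (\<lambda>t. g t $ i) (1 - t))"
    have 1: "(g has_vector_derivative d) (at (1 - t))"
      unfolding d_def by (rule edge_parametrization_deriv_nonzero(1)[OF assms]) (use t in auto)
    have "((\<lambda>t. 1 - t) has_real_derivative - 1) (at t)" by (auto intro!: derivative_eq_intros)
    from vector_diff_chain_at[OF this[unfolded has_real_derivative_iff_has_vector_derivative] 1]
    have "(reversepath g has_vector_derivative - d) (at t)"
      by (simp add: reversepath_def o_def)
    moreover have "d \<noteq> 0"
      using vector_derivative_at[OF 1] g(4)[of "1 - t"] t by auto
    ultimately show "vector_derivative (reversepath g) (at t) \<noteq> 0"
      by (simp add: vector_derivative_at)
  qed
qed

lemma real_polynomial_function_dist_squared:
  fixes v :: "real^3"
  shows "real_polynomial_function (\<lambda>x. (dist v x)\<^sup>2)"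
proof -
  have "(\<lambda>x. (dist v x)\<^sup>2) = (\<lambda>x. (\<Sum>i\<in>UNIV. (x $ i + - v $ i) * (x $ i + - v $ i)))"
    by (simp add: fun_eq_iff dist_norm norm_minus_commute power2_norm_eq_inner inner_vec_def)
  moreover have "real_polynomial_function (\<lambda>x. (\<Sum>i\<in>UNIV. (x $ i + - v $ i) * (x $ i + - v $ i)))"
    by (intro real_polynomial_function_sum finite real_polynomial_function.intros(4)
        real_polynomial_function.intros(3) real_polynomial_function.intros(1)
        real_polynomial_function.intros(2) bounded_linear_vec_nth)
  ultimately show ?thesis by simp
qed

lemma real_polynomial_function_inner: "real_polynomial_function (\<lambda>x :: real^3. u \<bullet> x)"
  by (rule real_polynomial_function.intros(1)[OF bounded_linear_inner_right])

lemma edge_parametrization_continuous: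
  assumes "edge_parametrization g e"
  shows "continuous_on {0..1} g"
  using assms by (simp add: edge_parametrization_def arc_def path_def)

lemma real_polynomial_function_continuous_on:
  assumes "real_polynomial_function (F :: 'a::real_normed_vector \<Rightarrow> real)"
  shows "continuous_on S F"
  using assms
  by (induction F rule: real_polynomial_function.induct)
    (auto intro: linear_continuous_on continuous_on_const continuous_on_add continuous_on_mult)

lemma polynomial_on_edge_continuous:
  assumes "edge_parametrization g e" "real_polynomial_function F"
  shows "continuous_on {0..1} (\<lambda>t. F (g t))"
  using continuous_on_compose2[OF real_polynomial_function_continuous_on[OF assms(2), of UNIV]
      edge_parametrization_continuous[OF assms(1)]] by simp

text \<open>
  Otherwise the function would be constant on the open interval and, by continuity, on the closed
  one.
\<close>

lemma polynomial_on_edge_noncritical: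
  assumes g: "edge_parametrization g e" and F: "real_polynomial_function F"
    and st: "s \<in> {0..1}" "t \<in> {0..1}" "F (g s) \<noteq> F (g t)"
  shows "\<exists>a\<in>{0<..<1}. deriv (\<lambda>t. F (g t)) a \<noteq> 0"
proof (rule ccontr)
  assume "\<not> ?thesis"
  then have "((\<lambda>t. F (g t)) has_real_derivative 0) (at x)" if "0 < x" "x < 1" for x
    using locally_holomorphic_extendable_has_derivative[OF edge_polynomial_analytic[OF g F], of x] that by simp
  then have "F (g x) = F (g 0)" if "x \<in> {0..1}" for x
    using DERIV_isconst2[of 0 1 "\<lambda>t. F (g t)" x] polynomial_on_edge_continuous[OF g F] that by simp
  from this[OF st(1)] this[OF st(2)] st(3) show False by simp
qed

text \<open>
  The limits of secant directions at the end point \<open>g 0\<close>, where nothing is known about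
  the derivative of \<open>g\<close>.
\<close>

definition initial_directions :: "(real \<Rightarrow> real^3) \<Rightarrow> (real^3) set" where
  "initial_directions g =
     {\<tau>. \<exists>t :: nat \<Rightarrow> real. (\<forall>k. t k \<in> {0<..<1}) \<and> t \<longlonglongrightarrow> 0 \<and>
          (\<lambda>k. (g (t k) - g 0) /\<^sub>R norm (g (t k) - g 0)) \<longlonglongrightarrow> \<tau>}"

text \<open>
  Suppose the \<open>j\<close>-th components of the secant directions oscillate between two limits.
  By the intermediate value theorem they attain each value \<open>c\<close> in between infinitely
  often, although the condition to attain \<open>c\<close> up to sign is the vanishing of a
  polynomial on the edge. So this polynomial vanishes identically, and \<open>c\<close> is
  determined up to sign: but there are too many values \<open>c\<close>.
\<close>

lemma initial_direction_unique:
  fixes g :: "real \<Rightarrow> real^3"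
  assumes e: "semialgebraic e" and g: "edge_parametrization g e"
    and \<tau>: "\<tau> \<in> initial_directions g" and \<sigma>: "\<sigma> \<in> initial_directions g"
  shows "\<tau> $ j \<le> \<sigma> $ j"
proof (rule ccontr)
  assume "\<not> ?thesis"
  then have less: "\<sigma> $ j < \<tau> $ j" by simp
  define D where "D t = ((g t - g 0) /\<^sub>R norm (g t - g 0)) $ j" for t
  obtain t where t: "\<And>k. t k \<in> {0<..<1}" "t \<longlonglongrightarrow> 0" "(\<lambda>k. (g (t k) - g 0) /\<^sub>R norm (g (t k) - g 0)) \<longlonglongrightarrow> \<tau>"
    using \<tau> unfolding initial_directions_def by blast
  obtain s where s: "\<And>k. s k \<in> {0<..<1}" "s \<longlonglongrightarrow> 0" "(\<lambda>k. (g (s k) - g 0) /\<^sub>R norm (g (s k) - g 0)) \<longlonglongrightarrow> \<sigma>"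
    using \<sigma> unfolding initial_directions_def by blast
  have Dt: "(\<lambda>k. D (t k)) \<longlonglongrightarrow> \<tau> $ j" and Ds: "(\<lambda>k. D (s k)) \<longlonglongrightarrow> \<sigma> $ j"
    unfolding D_def using t(3) s(3) by (intro tendsto_vec_nth; simp)+
  have inj: "g x \<noteq> g 0" if "0 < x" "x \<le> 1" for x
    using inj_onD[OF edge_parametrization_inj[OF g], of x 0] that by auto
  have contD: "continuous_on {x..y} D" if "0 < x" "y \<le> 1" for x y
  proof -
    have "continuous_on {x..y} g"
      by (rule continuous_on_subset[OF edge_parametrization_continuous[OF g]]) (use that in auto)
    then show ?thesis unfolding D_def using inj that by (auto intro!: continuous_intros)
  qed
  have square: "c\<^sup>2 = (D (1/2))\<^sup>2" if c: "\<sigma> $ j < c" "c < \<tau> $ j" for c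
  proof -
    let ?G = "\<lambda>x. (x $ j + - g 0 $ j) * (x $ j + - g 0 $ j) + (- c\<^sup>2) * (dist (g 0) x)\<^sup>2"
    have G: "real_polynomial_function ?G"
      by (intro real_polynomial_function.intros(3) real_polynomial_function.intros(4)
          real_polynomial_function.intros(1)[OF bounded_linear_vec_nth] real_polynomial_function.intros(2)
          real_polynomial_function_dist_squared)
    have G_iff: "?G (g x) = 0 \<longleftrightarrow> (D x)\<^sup>2 = c\<^sup>2" if "0 < x" "x \<le> 1" for x
      using inj[OF that]
      by (simp add: D_def dist_norm norm_minus_commute power_divide divide_simps power2_eq_square algebra_simps)
    have near0: "\<exists>x\<in>{0<..<1}. x < \<epsilon> \<and> D x = c" if \<epsilon>: "\<epsilon> > 0" for \<epsilon>
    proof -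
      have "\<forall>\<^sub>F k in sequentially. t k < \<epsilon> \<and> s k < \<epsilon> \<and> c < D (t k) \<and> D (s k) < c"
        using order_tendstoD(2)[OF t(2) \<epsilon>] order_tendstoD(2)[OF s(2) \<epsilon>]
          order_tendstoD(1)[OF Dt c(2)] order_tendstoD(2)[OF Ds c(1)] by eventually_elim auto
      then obtain k where k: "t k < \<epsilon>" "s k < \<epsilon>" "c < D (t k)" "D (s k) < c"
        using eventually_happens by fastforce
      show ?thesis
      proof (cases "s k \<le> t k")
        case True
        have "\<exists>x\<ge>s k. x \<le> t k \<and> D x = c"
          by (rule IVT') (use True k s(1)[of k] t(1)[of k] contD in auto)
        then obtain x where "s k \<le> x" "x \<le> t k" "D x = c" by blast
        then show ?thesis using k s(1)[of k] t(1)[of k] by (intro bexI[of _ x]) auto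
      next
        case False
        have "\<exists>x\<ge>t k. x \<le> s k \<and> D x = c"
          by (rule IVT2') (use False k s(1)[of k] t(1)[of k] contD in auto)
        then obtain x where "t k \<le> x" "x \<le> s k" "D x = c" by blast
        then show ?thesis using k s(1)[of k] t(1)[of k] by (intro bexI[of _ x]) auto
      qed
    qed
    define Z where "Z = {x\<in>{0<..<1}. ?G (g x) = 0}"
    have "infinite Z"
    proof
      assume fin: "finite Z"
      define \<epsilon> where "\<epsilon> = Min (insert 1 Z)"
      have "\<epsilon> \<in> insert 1 Z" unfolding \<epsilon>_def using fin by (intro Min_in) auto
      then have "\<epsilon> > 0" by (auto simp: Z_def)
      then obtain x where x: "x \<in> {0<..<1}" "x < \<epsilon>" "D x = c" using near0 by blast
      then have "x \<in> Z" using G_iff[of x] by (simp add: Z_def)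
      then have "\<epsilon> \<le> x" unfolding \<epsilon>_def using fin by simp
      then show False using x by simp
    qed
    have "?G (g (1/2)) = 0"
    proof (rule ccontr)
      assume "?G (g (1/2)) \<noteq> 0"
      from finite_zeros_of_polynomial_on_edge[OF e g G _ this] \<open>infinite Z\<close> show False
        unfolding Z_def by simp
    qed
    then show ?thesis using G_iff[of "1/2"] by simp
  qed
  define l where "l = (\<tau> $ j - \<sigma> $ j) / 4"
  have "l > 0" using less by (simp add: l_def)
  have "(\<sigma> $ j + l)\<^sup>2 = (\<sigma> $ j + 2 * l)\<^sup>2" "(\<sigma> $ j + l)\<^sup>2 = (\<sigma> $ j + 3 * l)\<^sup>2"
    using square[of "\<sigma> $ j + l"] square[of "\<sigma> $ j + 2 * l"] square[of "\<sigma> $ j + 3 * l"] \<open>l > 0\<close>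
    by (simp_all add: l_def field_simps)
  then show False using \<open>l > 0\<close> by (simp add: power2_eq_iff)
qed

lemma initial_directions_subsingleton:
  fixes g :: "real \<Rightarrow> real^3"
  assumes "semialgebraic e" "edge_parametrization g e"
  shows "finite (initial_directions g)"
proof -
  have "\<tau> = \<sigma>" if "\<tau> \<in> initial_directions g" "\<sigma> \<in> initial_directions g" for \<tau> \<sigma>
    using initial_direction_unique[OF assms] that by (simp add: vec_eq_iff order_antisym)
  then show ?thesis
    by (metis finite.emptyI finite.insertI finite_subset insertI1 subsetI)
qed

section \<open>Nondegenerate directions are dense\<close>

lemma semialgebraic_graph_edge:
  assumes "semialgebraic_graph \<Gamma> V E" "e \<in> E"
  shows "semialgebraic e" "\<exists>g. edge_parametrization g e \<and> g 0 \<in> V \<and> g 1 \<in> V" "e \<subseteq> \<Gamma> - V"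
  using assms unfolding semialgebraic_graph_def open_edge_def pathstart_def pathfinish_def by blast+

text \<open>
  After passing to a subsequence, the approximating points lie on a single edge and their parameters
  converge to one of its ends. Each end of an edge contributes at most one direction.
\<close>

lemma finite_tangent_directions:
  assumes \<Gamma>: "semialgebraic_graph \<Gamma> V E" and v: "v \<in> V"
  shows "finite (tangent_directions \<Gamma> v)"
proof -
  have "\<forall>e\<in>E. \<exists>g. edge_parametrization g e \<and> g 0 \<in> V \<and> g 1 \<in> V"
    using semialgebraic_graph_edge(2)[OF \<Gamma>] by blast
  then obtain g where g: "\<And>e. e \<in> E \<Longrightarrow> edge_parametrization (g e) e"
    by metis
  have fin: "finite E" "finite V" and cover: "\<Gamma> = V \<union> \<Union>E"
    using \<Gamma> unfolding semialgebraic_graph_def by auto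
  let ?I = "\<Union>e\<in>E. initial_directions (g e) \<union> initial_directions (reversepath (g e))"
  have "tangent_directions \<Gamma> v \<subseteq> ?I"
  proof
    fix \<tau> assume "\<tau> \<in> tangent_directions \<Gamma> v"
    then obtain q :: "nat \<Rightarrow> real^3" where q: "\<And>k. q k \<in> \<Gamma> - {v}" "q \<longlonglongrightarrow> v"
      "(\<lambda>k. (q k - v) /\<^sub>R norm (q k - v)) \<longlonglongrightarrow> \<tau>"
      unfolding tangent_directions_def by blast
    have "open (- (V - {v}))" using fin(2) by (intro open_Compl finite_imp_closed finite_Diff)
    then have "\<forall>\<^sub>F k in sequentially. q k \<in> - (V - {v})"
      by (rule topological_tendstoD[OF q(2)]) simp
    then obtain N where N: "\<And>k. k \<ge> N \<Longrightarrow> q k \<in> - (V - {v})"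
      unfolding eventually_sequentially by blast
    have "{N..} \<subseteq> (\<Union>e\<in>E. {k. q k \<in> e})"
    proof
      fix k assume "k \<in> {N..}"
      then have "q k \<in> \<Union>E" using N[of k] q(1)[of k] cover by simp
      then show "k \<in> (\<Union>e\<in>E. {k. q k \<in> e})" by blast
    qed
    then have "infinite (\<Union>e\<in>E. {k. q k \<in> e})"
      using infinite_Ici infinite_super by blast
    then obtain e where e: "e \<in> E" "infinite {k. q k \<in> e}" using fin(1) by blast
    obtain r :: "nat \<Rightarrow> nat" where r: "strict_mono r" "\<And>n. q (r n) \<in> e"
      using infinite_enumerate[OF e(2)] by blast
    have img: "g e ` {0<..<1} = e" using g[OF e(1)] by (simp add: edge_parametrization_def)
    have "\<forall>n. \<exists>t\<in>{0<..<1}. q (r n) = g e t" using r(2) img by blast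
    then obtain t where t: "\<And>n. t n \<in> {0<..<1}" "\<And>n. q (r n) = g e (t n)" by metis
    have "\<And>n. t n \<in> {0..1}" using t(1) by (meson atLeastAtMost_iff greaterThanLessThan_iff less_imp_le)
    then obtain l s where ls: "l \<in> {0..1}" "strict_mono s" "(t \<circ> s) \<longlonglongrightarrow> l"
      using compact_imp_seq_compact[OF compact_Icc[of "0::real" 1]] unfolding seq_compact_def by metis
    have "(\<lambda>n. g e ((t \<circ> s) n)) \<longlonglongrightarrow> g e l"
      by (rule continuous_on_tendsto_compose[OF edge_parametrization_continuous[OF g[OF e(1)]] ls(3,1)])
        (use \<open>\<And>n. t n \<in> {0..1}\<close> in auto)
    moreover have "(\<lambda>n. g e ((t \<circ> s) n)) \<longlonglongrightarrow> v"
      using LIMSEQ_subseq_LIMSEQ[OF q(2) strict_mono_o[OF r(1) ls(2)]] by (simp add: o_def t(2))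
    ultimately have gl: "g e l = v" by (rule LIMSEQ_unique)
    have "v \<notin> e" using semialgebraic_graph_edge(3)[OF \<Gamma> e(1)] v by blast
    then have "l \<notin> {0<..<1}" using gl img by blast
    then have l: "l = 0 \<or> l = 1" using ls(1) by auto
    have dir: "(\<lambda>n. (g e (t (s n)) - v) /\<^sub>R norm (g e (t (s n)) - v)) \<longlonglongrightarrow> \<tau>"
      using LIMSEQ_subseq_LIMSEQ[OF q(3) strict_mono_o[OF r(1) ls(2)]] by (simp add: o_def t(2))
    have "\<tau> \<in> initial_directions (g e) \<union> initial_directions (reversepath (g e))"
      using l
    proof
      assume "l = 0"
      then have "\<tau> \<in> initial_directions (g e)"
        unfolding initial_directions_def using t(1) ls(3) dir gl
        by (intro CollectI exI[of _ "t \<circ> s"]) (simp add: o_def)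
      then show ?thesis by blast
    next
      assume "l = 1"
      have "(\<lambda>n. 1 - t (s n)) \<longlonglongrightarrow> 1 - l"
        using ls(3) by (intro tendsto_diff tendsto_const) (simp add: o_def)
      then have "\<tau> \<in> initial_directions (reversepath (g e))"
        unfolding initial_directions_def using t(1) dir gl \<open>l = 1\<close>
        by (intro CollectI exI[of _ "\<lambda>n. 1 - t (s n)"]) (simp add: reversepath_def)
      then show ?thesis by blast
    qed
    then show "\<tau> \<in> ?I" using e(1) by blast
  qed
  moreover have "finite ?I"
    using fin(1) g semialgebraic_graph_edge(1)[OF \<Gamma>]
    by (intro finite_UN_I finite_UnI)
      (blast intro: initial_directions_subsingleton edge_parametrization_reversepath)+
  ultimately show ?thesis by (rule finite_subset)
qed

lemma tangent_direction_nonzero: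
  assumes "\<tau> \<in> tangent_directions \<Gamma> v"
  shows "\<tau> \<noteq> 0"
proof -
  obtain q :: "nat \<Rightarrow> real^3" where q: "\<And>k. q k \<in> \<Gamma> - {v}"
      "(\<lambda>k. (q k - v) /\<^sub>R norm (q k - v)) \<longlonglongrightarrow> \<tau>"
    using assms unfolding tangent_directions_def by blast
  have "norm ((q k - v) /\<^sub>R norm (q k - v)) = 1" for k using q(1)[of k] by simp
  then have "(\<lambda>k. 1) \<longlonglongrightarrow> norm \<tau>" using tendsto_norm[OF q(2)] by simp
  then have "norm \<tau> = 1" using LIMSEQ_unique tendsto_const by blast
  then show ?thesis by auto
qed

text \<open>
  The vectors whose height function has a degenerate critical point on the edge: those orthogonal to
  the first and the second derivative of \<open>g\<close> at a common parameter.
\<close>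

definition degenerate_covectors :: "(real \<Rightarrow> real^3) \<Rightarrow> (real^3) set" where
  "degenerate_covectors g = {u. \<exists>t\<in>{0<..<1}.
     (\<Sum>l\<in>UNIV. u $ l * deriv (\<lambda>t. g t $ l) t) = 0 \<and>
     (\<Sum>l\<in>UNIV. u $ l * deriv (deriv (\<lambda>t. g t $ l)) t) = 0}"

lemma
  fixes g :: "real \<Rightarrow> real^3"
  assumes g: "edge_parametrization g e" and t: "t \<in> {0<..<1}"
  shows deriv_inner_edge: "deriv ((\<lambda>x. u \<bullet> x) \<circ> g) t = (\<Sum>l\<in>UNIV. u $ l * deriv (\<lambda>t. g t $ l) t)"
    and deriv_deriv_inner_edge: "deriv (deriv ((\<lambda>x. u \<bullet> x) \<circ> g)) t =
      (\<Sum>l\<in>UNIV. u $ l * deriv (deriv (\<lambda>t. g t $ l)) t)"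
proof -
  note ana = edge_parametrization_analytic[OF g]
  have 1: "deriv ((\<lambda>x. u \<bullet> x) \<circ> g) s = (\<Sum>l\<in>UNIV. u $ l * deriv (\<lambda>t. g t $ l) s)"
    if "s \<in> {0<..<1}" for s
  proof (rule DERIV_imp_deriv)
    have "((\<lambda>t. \<Sum>l\<in>UNIV. u $ l * g t $ l) has_real_derivative
        (\<Sum>l\<in>UNIV. u $ l * deriv (\<lambda>t. g t $ l) s)) (at s)"
      by (intro DERIV_sum DERIV_cmult locally_holomorphic_extendable_has_derivative[OF ana that])
    then show "(((\<lambda>x. u \<bullet> x) \<circ> g) has_real_derivative (\<Sum>l\<in>UNIV. u $ l * deriv (\<lambda>t. g t $ l) s)) (at s)"
      by (simp add: o_def inner_vec_def)
  qed
  from 1[OF t] show "deriv ((\<lambda>x. u \<bullet> x) \<circ> g) t = (\<Sum>l\<in>UNIV. u $ l * deriv (\<lambda>t. g t $ l) t)" .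
  have "((\<lambda>t. \<Sum>l\<in>UNIV. u $ l * deriv (\<lambda>t. g t $ l) t) has_real_derivative
      (\<Sum>l\<in>UNIV. u $ l * deriv (deriv (\<lambda>t. g t $ l)) t)) (at t)"
    by (intro DERIV_sum DERIV_cmult locally_holomorphic_extendable_has_derivative[OF
          locally_holomorphic_extendable_deriv[OF ana] t])
  then have "(deriv ((\<lambda>x. u \<bullet> x) \<circ> g) has_real_derivative
      (\<Sum>l\<in>UNIV. u $ l * deriv (deriv (\<lambda>t. g t $ l)) t)) (at t)"
    by (rule has_field_derivative_transform_within_open[OF _ open_greaterThanLessThan t]) (rule 1[symmetric])
  then show "deriv (deriv ((\<lambda>x. u \<bullet> x) \<circ> g)) t =
      (\<Sum>l\<in>UNIV. u $ l * deriv (deriv (\<lambda>t. g t $ l)) t)"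
    by (rule DERIV_imp_deriv)
qed

lemma nondegenerate_on_edge_if_not_degenerate:
  assumes "edge_parametrization g e" "u \<notin> degenerate_covectors g"
  shows "nondegenerate_on_edge (\<lambda>x. u \<bullet> x) e"
  unfolding nondegenerate_on_edge_def
  using assms deriv_inner_edge[OF assms(1)] deriv_deriv_inner_edge[OF assms(1)]
  unfolding degenerate_covectors_def by (intro exI[of _ g]) auto

text \<open>
  The pairs of a parameter \<open>t\<close> and a vector orthogonal to the velocity at
  \<open>t\<close> form a three-dimensional manifold, and the degenerate vectors are critical values
  of its projection to the space of vectors; so Sard's theorem applies. Where the
  \<open>i\<close>-th component of the velocity is nonzero, the manifold is a graph: in the chart
  \<open>f i\<close> the component \<open>w $ i\<close> of \<open>w\<close> is the parameter, the
  other components are those of the vector, and the \<open>i\<close>-th component of the vector is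
  solved for.
\<close>

lemma negligible_degenerate_covectors:
  fixes g :: "real \<Rightarrow> real^3"
  assumes g: "edge_parametrization g e"
  shows "negligible (degenerate_covectors g)"
proof -
  define a where "a l = deriv (\<lambda>t. g t $ l)" for l
  define b where "b l = deriv (a l)" for l
  define N where "N i w = (\<Sum>m\<in>UNIV - {i}. w $ m * a m (w $ i))" for i and w :: "real^3"
  define f :: "3 \<Rightarrow> real^3 \<Rightarrow> real^3" where "f i w = (\<chi> l. if l = i then - N i w / a i (w $ i) else w $ l)" for i w
  define S where "S i = {w :: real^3. w $ i \<in> {0<..<1} \<and> a i (w $ i) \<noteq> 0 \<and> (\<Sum>l\<in>UNIV. f i w $ l * b l (w $ i)) = 0}" for i
  note ana = edge_parametrization_analytic[OF g]
  have split: "(\<Sum>l\<in>UNIV. h l) = h i + (\<Sum>m\<in>UNIV - {i}. h m)" for h :: "3 \<Rightarrow> real" and i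
    by (simp add: sum.remove)
  have "negligible (f i ` S i)" for i
  proof -
    define f' :: "real^3 \<Rightarrow> real^3 \<Rightarrow> real^3" where "f' w h = (\<chi> l. if l = i
        then - (((\<Sum>m\<in>UNIV - {i}. h $ m * a m (w $ i) + w $ m * (b m (w $ i) * h $ i)) * a i (w $ i)
          - N i w * (b i (w $ i) * h $ i)) / (a i (w $ i) * a i (w $ i)))
        else h $ l)" for w h
    show ?thesis
    proof (rule baby_Sard)
      fix w assume w: "w \<in> S i"
      have da: "((\<lambda>w. a m (w $ i)) has_derivative (\<lambda>h. b m (w $ i) * h $ i)) (at w within S i)" for m
      proof -
        have "(a m has_real_derivative b m (w $ i)) (at (w $ i))"
          unfolding b_def a_def using w
          by (intro locally_holomorphic_extendable_has_derivative[OF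
              locally_holomorphic_extendable_deriv[OF ana]]) (simp add: S_def)
        then show ?thesis
          by (intro has_derivative_compose[of "\<lambda>w. w $ i" _ w "S i" "a m", unfolded o_def]
              bounded_linear_imp_has_derivative bounded_linear_vec_nth)
            (simp add: has_field_derivative_def)
      qed
      have dN: "(N i has_derivative (\<lambda>h. \<Sum>m\<in>UNIV - {i}. w $ m * (b m (w $ i) * h $ i) + h $ m * a m (w $ i)))
          (at w within S i)"
        unfolding N_def
        by (intro has_derivative_sum has_derivative_mult da bounded_linear_imp_has_derivative bounded_linear_vec_nth)
      have "((\<lambda>w. f i w \<bullet> c) has_derivative (\<lambda>h. f' w h \<bullet> c)) (at w within S i)" if c: "c \<in> Basis" for c
      proof -
        obtain l where l: "c = axis l 1" using c by (auto simp: Basis_vec_def)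
        show ?thesis
        proof (cases "l = i")
          case True
          have nz: "a i (w $ i) \<noteq> 0" using w by (simp add: S_def)
          from has_derivative_minus[OF has_derivative_divide'[OF dN da nz]] True l show ?thesis
            by (simp add: inner_axis f_def f'_def add.commute)
        next
          case False
          then show ?thesis
            by (simp add: l inner_axis f_def f'_def bounded_linear_imp_has_derivative bounded_linear_vec_nth)
        qed
      qed
      then show "(f i has_derivative f' w) (at w within S i)"
        by (subst has_derivative_componentwise_within) blast
      then have lin: "linear (f' w)" by (rule has_derivative_linear)
      have "f' w (axis i 1) = 0"
      proof -
        have nz: "a i (w $ i) \<noteq> 0" using w by (simp add: S_def)
        have "(\<Sum>l\<in>UNIV. f i w $ l * b l (w $ i)) = 0" using w by (simp add: S_def)
        then have "f i w $ i * b i (w $ i) + (\<Sum>m\<in>UNIV - {i}. f i w $ m * b m (w $ i)) = 0"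
          by (simp only: split[of _ i])
        moreover have "(\<Sum>m\<in>UNIV - {i}. f i w $ m * b m (w $ i)) = (\<Sum>m\<in>UNIV - {i}. w $ m * b m (w $ i))"
          by (intro sum.cong) (auto simp: f_def)
        moreover have "f i w $ i = - N i w / a i (w $ i)" by (simp add: f_def)
        ultimately have "(\<Sum>m\<in>UNIV - {i}. w $ m * b m (w $ i)) * a i (w $ i) = N i w * b i (w $ i)"
          using nz by (simp add: field_simps)
        moreover have "(\<Sum>m\<in>UNIV - {i}. axis i 1 $ m * a m (w $ i) + w $ m * (b m (w $ i) * axis i 1 $ i))
            = (\<Sum>m\<in>UNIV - {i}. w $ m * b m (w $ i))"
          by (intro sum.cong) (auto simp: axis_def)
        ultimately have "f' w (axis i 1) $ i = 0" by (simp add: f'_def axis_def)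
        moreover have "f' w (axis i 1) $ l = 0" if "l \<noteq> i" for l
          using that by (simp add: f'_def axis_def)
        ultimately show ?thesis unfolding vec_eq_iff by (metis zero_index)
      qed
      moreover have "axis i 1 \<noteq> (0 :: real^3)" by (simp add: axis_eq_0_iff)
      ultimately have "\<not> inj (f' w)" unfolding linear_injective_0[OF lin] by blast
      then show "rank (matrix (f' w)) < CARD(3)"
        unfolding less_rank_noninjective matrix_vector_mul(2)[OF lin] .
    qed simp
  qed
  then have "negligible (\<Union>i\<in>UNIV. f i ` S i)" by (intro negligible_Union) auto
  moreover have "degenerate_covectors g \<subseteq> (\<Union>i\<in>UNIV. f i ` S i)"
  proof
    fix u assume "u \<in> degenerate_covectors g"
    then obtain t where t: "t \<in> {0<..<1}" "(\<Sum>l\<in>UNIV. u $ l * a l t) = 0" "(\<Sum>l\<in>UNIV. u $ l * b l t) = 0"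
      unfolding degenerate_covectors_def a_def b_def by blast
    obtain i where i: "a i t \<noteq> 0"
      using edge_parametrization_deriv_nonzero(2)[OF g t(1)] unfolding a_def by blast
    define w where "w = (\<chi> l. if l = i then t else u $ l)"
    have wi: "w $ i = t" by (simp add: w_def)
    have "N i w = (\<Sum>m\<in>UNIV - {i}. u $ m * a m t)"
      unfolding N_def wi by (intro sum.cong) (auto simp: w_def)
    then have "u $ i * a i t + N i w = 0" using t(2) by (simp add: split[of _ i])
    then have ui: "- N i w / a i t = u $ i" using i by (simp add: field_simps)
    have "f i w = u"
      unfolding vec_eq_iff
    proof
      fix l show "f i w $ l = u $ l"
        using ui by (cases "l = i") (simp_all add: f_def wi, simp add: w_def)
    qed
    moreover have "w \<in> S i" using i t \<open>f i w = u\<close> by (simp add: S_def wi)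
    ultimately show "u \<in> (\<Union>i\<in>UNIV. f i ` S i)" by blast
  qed
  ultimately show ?thesis by (rule negligible_subset)
qed

text \<open>
  The degenerate vectors form a null set in space. It is a union of lines through the origin, so it
  cannot contain all unit vectors near \<open>u0\<close>.
\<close>

lemma nondegenerate_dense:
  assumes \<Gamma>: "semialgebraic_graph \<Gamma> V E" and u0: "u0 \<in> sphere 0 1" and \<epsilon>: "\<epsilon> > 0"
  shows "\<exists>u\<in>sphere 0 1. dist u u0 < \<epsilon> \<and> nondegenerate \<Gamma> V E u"
proof -
  have "\<forall>e\<in>E. \<exists>g. edge_parametrization g e"
    using semialgebraic_graph_edge(2)[OF \<Gamma>] by blast
  then obtain g where g: "\<And>e. e \<in> E \<Longrightarrow> edge_parametrization (g e) e" by metis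
  have fin: "finite E" "finite V" using \<Gamma> unfolding semialgebraic_graph_def by auto
  define D where "D = (\<Union>e\<in>E. degenerate_covectors (g e))"
  define H where "H = (\<Union>v\<in>V. \<Union>\<tau>\<in>tangent_directions \<Gamma> v. {x. \<tau> \<bullet> x = 0})"
  have "negligible D"
    unfolding D_def using fin(1) g negligible_degenerate_covectors by (intro negligible_Union) auto
  moreover have "negligible H"
    unfolding H_def using fin(2) finite_tangent_directions[OF \<Gamma>] tangent_direction_nonzero
    by (intro negligible_Union finite_imageI) (auto intro!: negligible_Union negligible_hyperplane)
  ultimately have "negligible (D \<union> H)" by (rule negligible_Un)
  define U where "U = {x. x \<noteq> 0 \<and> dist (x /\<^sub>R norm x) u0 < \<epsilon>}"
  have "open U"
  proof -
    have "continuous_on (- {0}) (\<lambda>x :: real^3. dist (x /\<^sub>R norm x) u0)"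
      by (intro continuous_intros) auto
    then have "open (- {0} \<inter> (\<lambda>x. dist (x /\<^sub>R norm x) u0) -` {..<\<epsilon>})"
      by (rule continuous_open_preimage) (simp_all add: open_Compl)
    moreover have "U = - {0} \<inter> (\<lambda>x. dist (x /\<^sub>R norm x) u0) -` {..<\<epsilon>}" unfolding U_def by blast
    ultimately show ?thesis by simp
  qed
  moreover have "u0 \<in> U"
  proof -
    have n: "norm u0 = 1" using u0 by simp
    then have "u0 \<noteq> 0" by (metis norm_zero zero_neq_one)
    then show ?thesis using \<epsilon> n by (simp add: U_def)
  qed
  ultimately have "\<not> negligible U" using open_not_negligible by blast
  then have "\<not> U \<subseteq> D \<union> H" using \<open>negligible (D \<union> H)\<close> negligible_subset by blast
  then obtain x where x: "x \<in> U" "x \<notin> D" "x \<notin> H" by blast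
  define c where "c = inverse (norm x)"
  have "c \<noteq> 0" using x(1) by (simp add: c_def U_def)
  have "c *\<^sub>R x \<notin> degenerate_covectors (g e)" if "e \<in> E" for e
  proof
    assume "c *\<^sub>R x \<in> degenerate_covectors (g e)"
    then obtain t where t: "t \<in> {0<..<1}"
      "(\<Sum>l\<in>UNIV. (c *\<^sub>R x) $ l * deriv (\<lambda>t. g e t $ l) t) = 0"
      "(\<Sum>l\<in>UNIV. (c *\<^sub>R x) $ l * deriv (deriv (\<lambda>t. g e t $ l)) t) = 0"
      unfolding degenerate_covectors_def by blast
    have scale: "(\<Sum>l\<in>UNIV. (c *\<^sub>R x) $ l * h l) = c * (\<Sum>l\<in>UNIV. x $ l * h l)" for h
      by (simp add: sum_distrib_left mult.assoc)
    have "x \<in> degenerate_covectors (g e)"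
      unfolding degenerate_covectors_def
      using t \<open>c \<noteq> 0\<close> unfolding scale mult_eq_0_iff by blast
    then show False using x(2) that by (auto simp: D_def)
  qed
  moreover have "(c *\<^sub>R x) \<bullet> \<tau> \<noteq> 0" if "v \<in> V" "\<tau> \<in> tangent_directions \<Gamma> v" for v \<tau>
  proof -
    have "\<tau> \<bullet> x \<noteq> 0" using x(3) that unfolding H_def by blast
    then show ?thesis using \<open>c \<noteq> 0\<close> by (simp add: inner_commute)
  qed
  ultimately have "nondegenerate \<Gamma> V E (c *\<^sub>R x)"
    unfolding nondegenerate_def using g nondegenerate_on_edge_if_not_degenerate by blast
  moreover have "c *\<^sub>R x \<in> sphere 0 1" "dist (c *\<^sub>R x) u0 < \<epsilon>"
    using x(1) by (auto simp: U_def c_def)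
  ultimately show ?thesis by blast
qed

section \<open>Branches at a point and signs of a slope\<close>

lemma lower_degree_eq:
  assumes "\<forall>\<^sub>F \<epsilon> in at_right 0. finite {q \<in> \<Gamma>. dist p q = \<epsilon> \<and> u \<bullet> q < u \<bullet> p} \<and>
      card {q \<in> \<Gamma>. dist p q = \<epsilon> \<and> u \<bullet> q < u \<bullet> p} = n"
  shows "lower_degree \<Gamma> u p = n"
  unfolding lower_degree_def
proof (rule the_equality)
  show "\<forall>\<^sub>F \<epsilon> in at_right 0. finite {q \<in> \<Gamma>. dist p q = \<epsilon> \<and> u \<bullet> q < u \<bullet> p} \<and>
      card {q \<in> \<Gamma>. dist p q = \<epsilon> \<and> u \<bullet> q < u \<bullet> p} = n" by (rule assms)
  fix m
  assume "\<forall>\<^sub>F \<epsilon> in at_right 0. finite {q \<in> \<Gamma>. dist p q = \<epsilon> \<and> u \<bullet> q < u \<bullet> p} \<and>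
      card {q \<in> \<Gamma>. dist p q = \<epsilon> \<and> u \<bullet> q < u \<bullet> p} = m"
  with assms have "\<forall>\<^sub>F \<epsilon> in at_right (0::real). m = n" by eventually_elim simp
  then show "m = n" by (simp add: trivial_limit_at_right_real)
qed

text \<open>
  Near \<open>p\<close> the set is a union of finitely many disjoint branches along which the
  distance to \<open>p\<close> increases, so a small sphere meets each branch exactly once, and each
  branch lies entirely below or entirely above \<open>p\<close>.
\<close>

lemma
  fixes \<Gamma> :: "(real^3) set" and B :: "'b set" and \<gamma> :: "'b \<Rightarrow> real \<Rightarrow> real^3"
  assumes B: "finite B" and a: "a > 0" and \<delta>: "\<delta> > 0" and p: "p \<in> \<Gamma>"
    and cont: "\<And>b. b \<in> B \<Longrightarrow> continuous_on {0..a} (\<gamma> b)"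
    and start: "\<And>b. b \<in> B \<Longrightarrow> \<gamma> b 0 = p"
    and mono: "\<And>b. b \<in> B \<Longrightarrow> strict_mono_on {0..a} (\<lambda>s. dist p (\<gamma> b s))"
    and into: "\<And>b s. b \<in> B \<Longrightarrow> s \<in> {0<..a} \<Longrightarrow> \<gamma> b s \<in> \<Gamma>"
    and disj: "\<And>b c s r. b \<in> B \<Longrightarrow> c \<in> B \<Longrightarrow> s \<in> {0<..a} \<Longrightarrow> r \<in> {0<..a} \<Longrightarrow> \<gamma> b s = \<gamma> c r \<Longrightarrow> b = c"
    and cover: "\<And>q. q \<in> \<Gamma> \<Longrightarrow> q \<noteq> p \<Longrightarrow> dist p q < \<delta> \<Longrightarrow> \<exists>b\<in>B. \<exists>s\<in>{0<..a}. q = \<gamma> b s"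
    and down: "\<And>b s. b \<in> B \<Longrightarrow> dn b \<Longrightarrow> s \<in> {0<..a} \<Longrightarrow> u \<bullet> \<gamma> b s < u \<bullet> p"
    and up: "\<And>b s. b \<in> B \<Longrightarrow> \<not> dn b \<Longrightarrow> s \<in> {0<..a} \<Longrightarrow> u \<bullet> p < u \<bullet> \<gamma> b s"
  shows lower_degree_branches: "lower_degree \<Gamma> u p = card {b \<in> B. dn b}"
    and local_minimum_branches: "local_minimum_on \<Gamma> (\<lambda>x. u \<bullet> x) p \<longleftrightarrow> (\<forall>b\<in>B. \<not> dn b)"
proof -
  have pos: "0 < dist p (\<gamma> b s)" if "b \<in> B" "s \<in> {0<..a}" for b s
    using monotone_onD[OF mono[OF that(1)], of 0 s] that start[OF that(1)] by simp
  have dist_inj: "s = r" if "b \<in> B" "s \<in> {0<..a}" "r \<in> {0<..a}" "dist p (\<gamma> b s) = dist p (\<gamma> b r)" for b s r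
    using monotone_onD[OF mono[OF that(1)], of s r] monotone_onD[OF mono[OF that(1)], of r s] that
    by (cases s r rule: linorder_cases) auto
  define \<epsilon>0 where "\<epsilon>0 = Min (insert \<delta> ((\<lambda>b. dist p (\<gamma> b a)) ` B))"
  have "\<epsilon>0 > 0" unfolding \<epsilon>0_def using B \<delta> pos a by (subst Min_gr_iff) auto
  have \<epsilon>0: "\<epsilon>0 \<le> \<delta>" "\<And>b. b \<in> B \<Longrightarrow> \<epsilon>0 \<le> dist p (\<gamma> b a)"
    unfolding \<epsilon>0_def using B by auto
  have level: "finite {q \<in> \<Gamma>. dist p q = \<epsilon> \<and> u \<bullet> q < u \<bullet> p} \<and>
      card {q \<in> \<Gamma>. dist p q = \<epsilon> \<and> u \<bullet> q < u \<bullet> p} = card {b \<in> B. dn b}"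
    if \<epsilon>: "0 < \<epsilon>" "\<epsilon> < \<epsilon>0" for \<epsilon>
  proof -
    have "\<exists>s. s \<in> {0<..a} \<and> dist p (\<gamma> b s) = \<epsilon>" if b: "b \<in> B" for b
    proof -
      have "\<exists>s\<ge>0. s \<le> a \<and> dist p (\<gamma> b s) = \<epsilon>"
      proof (rule IVT')
        show "continuous_on {0..a} (\<lambda>s. dist p (\<gamma> b s))"
          by (intro continuous_on_dist continuous_on_const cont[OF b])
      qed (use start[OF b] \<epsilon> \<epsilon>0(2)[OF b] a in auto)
      then obtain s where s: "0 \<le> s" "s \<le> a" "dist p (\<gamma> b s) = \<epsilon>" by blast
      then have "s \<noteq> 0" using start[OF b] \<epsilon> by auto
      then show ?thesis using s by (intro exI[of _ s]) auto
    qed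
    then obtain \<sigma> where \<sigma>: "\<And>b. b \<in> B \<Longrightarrow> \<sigma> b \<in> {0<..a}" "\<And>b. b \<in> B \<Longrightarrow> dist p (\<gamma> b (\<sigma> b)) = \<epsilon>"
      by metis
    have eq: "{q \<in> \<Gamma>. dist p q = \<epsilon> \<and> u \<bullet> q < u \<bullet> p} = (\<lambda>b. \<gamma> b (\<sigma> b)) ` {b \<in> B. dn b}"
    proof (intro equalityI subsetI)
      fix q assume q: "q \<in> {q \<in> \<Gamma>. dist p q = \<epsilon> \<and> u \<bullet> q < u \<bullet> p}"
      then have "q \<noteq> p" "dist p q < \<delta>" "q \<in> \<Gamma>" using \<epsilon> \<epsilon>0(1) by auto
      then obtain b s where b: "b \<in> B" "s \<in> {0<..a}" "q = \<gamma> b s" using cover by blast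
      then have "s = \<sigma> b" using dist_inj[OF b(1,2) \<sigma>(1)[OF b(1)]] \<sigma>(2)[OF b(1)] q by simp
      moreover have "dn b" using up[OF b(1) _ b(2)] b(3) q by force
      ultimately show "q \<in> (\<lambda>b. \<gamma> b (\<sigma> b)) ` {b \<in> B. dn b}" using b by blast
    next
      fix q assume "q \<in> (\<lambda>b. \<gamma> b (\<sigma> b)) ` {b \<in> B. dn b}"
      then obtain b where "b \<in> B" "dn b" "q = \<gamma> b (\<sigma> b)" by blast
      then show "q \<in> {q \<in> \<Gamma>. dist p q = \<epsilon> \<and> u \<bullet> q < u \<bullet> p}"
        using \<sigma> into down by simp
    qed
    have "inj_on (\<lambda>b. \<gamma> b (\<sigma> b)) {b \<in> B. dn b}"
      by (rule inj_onI) (use disj \<sigma>(1) in blast)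
    then show ?thesis unfolding eq using B by (simp add: card_image)
  qed
  have "\<forall>\<^sub>F \<epsilon> in at_right 0. 0 < \<epsilon> \<and> \<epsilon> < \<epsilon>0"
    using \<open>\<epsilon>0 > 0\<close> eventually_at_right_less eventually_at_right[of 0 1 "\<lambda>\<epsilon>. 0 < \<epsilon> \<and> \<epsilon> < \<epsilon>0"] by auto
  then have "\<forall>\<^sub>F \<epsilon> in at_right 0. finite {q \<in> \<Gamma>. dist p q = \<epsilon> \<and> u \<bullet> q < u \<bullet> p} \<and>
      card {q \<in> \<Gamma>. dist p q = \<epsilon> \<and> u \<bullet> q < u \<bullet> p} = card {b \<in> B. dn b}"
    by eventually_elim (rule level; simp)
  then show "lower_degree \<Gamma> u p = card {b \<in> B. dn b}" by (rule lower_degree_eq)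
  show "local_minimum_on \<Gamma> (\<lambda>x. u \<bullet> x) p \<longleftrightarrow> (\<forall>b\<in>B. \<not> dn b)"
  proof
    assume "local_minimum_on \<Gamma> (\<lambda>x. u \<bullet> x) p"
    then obtain d where d: "d > 0" "\<And>q. q \<in> \<Gamma> \<Longrightarrow> q \<noteq> p \<Longrightarrow> dist q p < d \<Longrightarrow> u \<bullet> p \<le> u \<bullet> q"
      unfolding local_minimum_on_def eventually_at by blast
    show "\<forall>b\<in>B. \<not> dn b"
    proof (rule ballI, rule notI)
      fix b assume b: "b \<in> B" "dn b"
      define \<epsilon> where "\<epsilon> = min d \<epsilon>0 / 2"
      have \<epsilon>: "0 < \<epsilon>" "\<epsilon> < \<epsilon>0" "\<epsilon> < d" using d(1) \<open>\<epsilon>0 > 0\<close> by (auto simp: \<epsilon>_def)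
      have "{b \<in> B. dn b} \<noteq> {}" using b by blast
      then have "card {b \<in> B. dn b} \<noteq> 0" using B by simp
      then have "{q \<in> \<Gamma>. dist p q = \<epsilon> \<and> u \<bullet> q < u \<bullet> p} \<noteq> {}"
        using level[OF \<epsilon>(1,2)] by (metis card.empty)
      then obtain q where "q \<in> \<Gamma>" "dist p q = \<epsilon>" "u \<bullet> q < u \<bullet> p" by blast
      then show False using d(2)[of q] \<epsilon> by (auto simp: dist_commute)
    qed
  next
    assume nodn: "\<forall>b\<in>B. \<not> dn b"
    have "u \<bullet> p \<le> u \<bullet> q" if "q \<in> \<Gamma>" "q \<noteq> p" "dist q p < \<delta>" for q
    proof -
      have "dist p q < \<delta>" using that(3) by (simp add: dist_commute)
      from cover[OF that(1,2) this] obtain b s where b: "b \<in> B" "s \<in> {0<..a}" "q = \<gamma> b s" by blast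
      show ?thesis unfolding b(3) using up[OF b(1) _ b(2)] nodn b(1) by (intro less_imp_le) blast
    qed
    then show "local_minimum_on \<Gamma> (\<lambda>x. u \<bullet> x) p"
      unfolding local_minimum_on_def eventually_at using p \<delta> by blast
  qed
qed

definition falls_after :: "(real \<Rightarrow> real) \<Rightarrow> real \<Rightarrow> bool" where
  "falls_after \<psi> t \<longleftrightarrow> (\<exists>y>t. \<forall>s\<in>{t<..<y}. \<psi> s < 0)"

definition rises_before :: "(real \<Rightarrow> real) \<Rightarrow> real \<Rightarrow> bool" where
  "rises_before \<psi> t \<longleftrightarrow> (\<exists>x<t. \<forall>s\<in>{x<..<t}. \<psi> s > 0)"

lemma constant_sign_if_no_zero:
  fixes \<psi> :: "real \<Rightarrow> real"
  assumes cont: "continuous_on {x<..<y} \<psi>" and nz: "\<And>t. t \<in> {x<..<y} \<Longrightarrow> \<psi> t \<noteq> 0"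
  shows "(\<forall>t\<in>{x<..<y}. 0 < \<psi> t) \<or> (\<forall>t\<in>{x<..<y}. \<psi> t < 0)"
proof (rule ccontr)
  assume "\<not> ?thesis"
  then obtain s t where st: "s \<in> {x<..<y}" "t \<in> {x<..<y}" "\<psi> s \<le> 0" "0 \<le> \<psi> t"
    by (meson linorder_not_less)
  have "connected (\<psi> ` {x<..<y})" by (rule connected_continuous_image[OF cont]) simp
  then have "0 \<in> \<psi> ` {x<..<y}"
    using connectedD_interval[of "\<psi> ` {x<..<y}" "\<psi> s" "\<psi> t" 0] st by blast
  then obtain r where "r \<in> {x<..<y}" "\<psi> r = 0" by auto
  then show False using nz by blast
qed

lemma end_behaviour_from_sign:
  fixes \<psi> :: "real \<Rightarrow> real"
  assumes "x < y"
  shows "\<forall>t\<in>{x<..<y}. \<psi> t < 0 \<Longrightarrow> falls_after \<psi> x \<and> \<not> rises_before \<psi> y"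
    and "\<forall>t\<in>{x<..<y}. 0 < \<psi> t \<Longrightarrow> \<not> falls_after \<psi> x \<and> rises_before \<psi> y"
proof -
  assume neg: "\<forall>t\<in>{x<..<y}. \<psi> t < 0"
  have "\<not> rises_before \<psi> y"
  proof
    assume "rises_before \<psi> y"
    then obtain z where "z < y" "\<forall>s\<in>{z<..<y}. \<psi> s > 0" unfolding rises_before_def by blast
    moreover obtain t where "max x z < t" "t < y" using dense[of "max x z" y] assms \<open>z < y\<close> by auto
    ultimately have "\<psi> t > 0" "\<psi> t < 0" using neg by auto
    then show False by simp
  qed
  then show "falls_after \<psi> x \<and> \<not> rises_before \<psi> y"
    using neg assms unfolding falls_after_def by blast
next
  assume pos: "\<forall>t\<in>{x<..<y}. 0 < \<psi> t"
  have "\<not> falls_after \<psi> x"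
  proof
    assume "falls_after \<psi> x"
    then obtain z where "x < z" "\<forall>s\<in>{x<..<z}. \<psi> s < 0" unfolding falls_after_def by blast
    moreover obtain t where "x < t" "t < min y z" using dense[of x "min y z"] assms \<open>x < z\<close> by auto
    ultimately have "\<psi> t > 0" "\<psi> t < 0" using pos by auto
    then show False by simp
  qed
  then show "\<not> falls_after \<psi> x \<and> rises_before \<psi> y"
    using pos assms unfolding rises_before_def by blast
qed

text \<open>
  The function \<open>\<psi>\<close> is the slope of a height function. Between consecutive zeros it
  has constant sign, and the piece in between descends either to the right from its left end or to
  the left from its right end. There are \<open>card Z + 1\<close> pieces.
\<close>

lemma count_descending_directions:
  fixes \<psi> :: "real \<Rightarrow> real"
  assumes "finite Z" "Z \<subseteq> {a<..<b}" "a < b" "continuous_on {a<..<b} \<psi>"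
    and "\<And>t. t \<in> {a<..<b} \<Longrightarrow> t \<notin> Z \<Longrightarrow> \<psi> t \<noteq> 0"
  shows "card {t \<in> insert a Z. falls_after \<psi> t} + card {t \<in> insert b Z. rises_before \<psi> t} = card Z + 1"
  using assms
proof (induction Z arbitrary: b rule: finite_linorder_max_induct)
  case empty
  then have "(\<forall>t\<in>{a<..<b}. 0 < \<psi> t) \<or> (\<forall>t\<in>{a<..<b}. \<psi> t < 0)"
    by (intro constant_sign_if_no_zero) auto
  then consider "falls_after \<psi> a" "\<not> rises_before \<psi> b" | "\<not> falls_after \<psi> a" "rises_before \<psi> b"
    using end_behaviour_from_sign[OF empty(2), of \<psi>] by blast
  then show ?case by cases (auto simp: conj_disj_distribR Collect_disj_eq cong: conj_cong)
next
  case (insert c Z)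
  have c: "a < c" "c < b" "c \<notin> Z" using insert by auto
  have IH: "card {t \<in> insert a Z. falls_after \<psi> t} + card {t \<in> insert c Z. rises_before \<psi> t} = card Z + 1"
  proof (rule insert.IH)
    show "Z \<subseteq> {a<..<c}" using insert.hyps insert.prems(1) by auto
    show "continuous_on {a<..<c} \<psi>" by (rule continuous_on_subset[OF insert.prems(3)]) (use c in auto)
    show "\<psi> t \<noteq> 0" if "t \<in> {a<..<c}" "t \<notin> Z" for t
      using that c by (intro insert.prems(4)) auto
  qed (use c in simp)
  have "(\<forall>t\<in>{c<..<b}. 0 < \<psi> t) \<or> (\<forall>t\<in>{c<..<b}. \<psi> t < 0)"
  proof (rule constant_sign_if_no_zero)
    show "continuous_on {c<..<b} \<psi>" by (rule continuous_on_subset[OF insert.prems(3)]) (use c in auto)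
    show "\<psi> t \<noteq> 0" if "t \<in> {c<..<b}" for t
      using that c insert.hyps(2) by (intro insert.prems(4)) (auto dest: less_asym)
  qed
  then consider "falls_after \<psi> c" "\<not> rises_before \<psi> b" | "\<not> falls_after \<psi> c" "rises_before \<psi> b"
    using end_behaviour_from_sign[OF c(2), of \<psi>] by blast
  then have last: "card {t \<in> {c}. falls_after \<psi> t} + card {t \<in> {b}. rises_before \<psi> t} = 1"
    by cases (auto simp: Collect_conv_if)
  have "b \<notin> insert c Z" "c \<notin> insert a Z" using c insert.prems(1) by auto
  have split: "card {t \<in> insert x A. P t} = card {t \<in> A. P t} + card {t \<in> {x}. P t}"
    if "finite A" "x \<notin> A" for x A and P :: "real \<Rightarrow> bool"
  proof -
    have *: "{t \<in> insert x A. P t} = {t \<in> A. P t} \<union> {t \<in> {x}. P t}" by auto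
    show ?thesis unfolding * by (rule card_Un_disjoint) (use that in auto)
  qed
  have "card {t \<in> insert a (insert c Z). falls_after \<psi> t} = card {t \<in> insert a Z. falls_after \<psi> t} + card {t \<in> {c}. falls_after \<psi> t}"
    using split[of "insert a Z" c "falls_after \<psi>"] insert.hyps(1) \<open>c \<notin> insert a Z\<close> by (simp add: insert_commute)
  moreover have "card {t \<in> insert b (insert c Z). rises_before \<psi> t} = card {t \<in> insert c Z. rises_before \<psi> t} + card {t \<in> {b}. rises_before \<psi> t}"
    using split[of "insert c Z" b "rises_before \<psi>"] insert.hyps(1) \<open>b \<notin> insert c Z\<close> by simp
  ultimately show ?case using IH last c(3) insert.hyps(1) by simp
qed

lemma polynomial_on_edge_monotone_if_noncritical:
  fixes g :: "real \<Rightarrow> real^3"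
  assumes g: "edge_parametrization g e" and F: "real_polynomial_function F"
    and xy: "0 \<le> x" "x < y" "y \<le> 1"
  defines "\<phi> \<equiv> (\<lambda>t. F (g t))"
  shows "\<forall>t\<in>{x<..<y}. 0 < deriv \<phi> t \<Longrightarrow> strict_mono_on {x..y} \<phi>"
    and "\<forall>t\<in>{x<..<y}. deriv \<phi> t < 0 \<Longrightarrow> strict_antimono_on {x..y} \<phi>"
proof -
  have der: "(\<phi> has_real_derivative deriv \<phi> x) (at x)" if "0 < x" "x < 1" for x
    using locally_holomorphic_extendable_has_derivative[OF edge_polynomial_analytic[OF g F]] that
    unfolding \<phi>_def by simp
  have cont: "continuous_on {s..t} \<phi>" if "0 \<le> s" "t \<le> 1" for s t
    unfolding \<phi>_def by (rule continuous_on_subset[OF polynomial_on_edge_continuous[OF g F]]) (use that in auto)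
  assume pos: "\<forall>t\<in>{x<..<y}. 0 < deriv \<phi> t"
  have "\<phi> s < \<phi> t" if "x \<le> s" "s < t" "t \<le> y" for s t
  proof (rule DERIV_pos_imp_increasing_open[OF that(2) _ cont])
    fix z assume "s < z" "z < t"
    then show "\<exists>d. (\<phi> has_real_derivative d) (at z) \<and> 0 < d"
      using that xy pos der[of z] by (intro exI[of _ "deriv \<phi> z"]) simp
  qed (use that xy in auto)
  then show "strict_mono_on {x..y} \<phi>" by (auto intro!: monotone_onI)
next
  have der: "(\<phi> has_real_derivative deriv \<phi> x) (at x)" if "0 < x" "x < 1" for x
    using locally_holomorphic_extendable_has_derivative[OF edge_polynomial_analytic[OF g F]] that
    unfolding \<phi>_def by simp
  have cont: "continuous_on {s..t} \<phi>" if "0 \<le> s" "t \<le> 1" for s t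
    unfolding \<phi>_def by (rule continuous_on_subset[OF polynomial_on_edge_continuous[OF g F]]) (use that in auto)
  assume neg: "\<forall>t\<in>{x<..<y}. deriv \<phi> t < 0"
  have "\<phi> t < \<phi> s" if "x \<le> s" "s < t" "t \<le> y" for s t
  proof (rule DERIV_neg_imp_decreasing_open[OF that(2) _ cont])
    fix z assume "s < z" "z < t"
    then show "\<exists>d. (\<phi> has_real_derivative d) (at z) \<and> d < 0"
      using that xy neg der[of z] by (intro exI[of _ "deriv \<phi> z"]) simp
  qed (use that xy in auto)
  then show "strict_antimono_on {x..y} \<phi>" by (auto intro!: monotone_onI)
qed

section \<open>The weight of a graph counts local minima\<close>

lemma polynomial_on_edge_sides:
  fixes g :: "real \<Rightarrow> real^3"
  assumes g: "edge_parametrization g e" and F: "real_polynomial_function F"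
    and xy: "0 \<le> x" "x < y" "y \<le> 1"
    and nz: "\<And>t. t \<in> {x<..<y} \<Longrightarrow> deriv (\<lambda>t. F (g t)) t \<noteq> 0"
  shows "(\<forall>t\<in>{x<..<y}. 0 < deriv (\<lambda>t. F (g t)) t) \<and> strict_mono_on {x..y} (\<lambda>t. F (g t)) \<or>
     (\<forall>t\<in>{x<..<y}. deriv (\<lambda>t. F (g t)) t < 0) \<and> strict_antimono_on {x..y} (\<lambda>t. F (g t))"
proof -
  have "continuous_on {x<..<y} (deriv (\<lambda>t. F (g t)))"
    by (rule continuous_on_subset[OF locally_holomorphic_extendable_continuous_on[OF
          locally_holomorphic_extendable_deriv[OF edge_polynomial_analytic[OF g F]]]]) (use xy in auto)
  from constant_sign_if_no_zero[OF this nz] show ?thesis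
    using polynomial_on_edge_monotone_if_noncritical[OF g F xy] by blast
qed

text \<open>
  The squared distance is a polynomial on the edge and grows from zero, so it is increasing as long
  as it has no critical point.
\<close>

lemma distance_from_edge_point:
  fixes g :: "real \<Rightarrow> real^3"
  assumes g: "edge_parametrization g e" and a: "a > 0"
  shows "\<lbrakk>0 \<le> t; t + a \<le> 1; \<And>s. s \<in> {t<..<t + a} \<Longrightarrow> deriv (\<lambda>s. (dist (g t) (g s))\<^sup>2) s \<noteq> 0\<rbrakk> \<Longrightarrow>
      strict_mono_on {0..a} (\<lambda>s. dist (g t) (g (t + s)))"
    and "\<lbrakk>0 \<le> t - a; t \<le> 1; \<And>s. s \<in> {t - a<..<t} \<Longrightarrow> deriv (\<lambda>s. (dist (g t) (g s))\<^sup>2) s \<noteq> 0\<rbrakk> \<Longrightarrow>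
      strict_mono_on {0..a} (\<lambda>s. dist (g t) (g (t - s)))"
proof -
  assume t: "0 \<le> t" "t + a \<le> 1" "\<And>s. s \<in> {t<..<t + a} \<Longrightarrow> deriv (\<lambda>s. (dist (g t) (g s))\<^sup>2) s \<noteq> 0"
  have "t < t + a" using a by simp
  from polynomial_on_edge_sides[OF g real_polynomial_function_dist_squared t(1) this t(2,3)]
  have "strict_mono_on {t..t + a} (\<lambda>s. (dist (g t) (g s))\<^sup>2) \<or> strict_antimono_on {t..t + a} (\<lambda>s. (dist (g t) (g s))\<^sup>2)"
    by blast
  moreover have "\<not> strict_antimono_on {t..t + a} (\<lambda>s. (dist (g t) (g s))\<^sup>2)"
  proof
    assume "strict_antimono_on {t..t + a} (\<lambda>s. (dist (g t) (g s))\<^sup>2)"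
    from monotone_onD[OF this, of t "t + a"] show False using a by simp
  qed
  ultimately have mono: "strict_mono_on {t..t + a} (\<lambda>s. (dist (g t) (g s))\<^sup>2)" by blast
  show "strict_mono_on {0..a} (\<lambda>s. dist (g t) (g (t + s)))"
  proof (rule monotone_onI)
    fix r s assume rs: "r \<in> {0..a}" "s \<in> {0..a}" "r < s"
    then have "(dist (g t) (g (t + r)))\<^sup>2 < (dist (g t) (g (t + s)))\<^sup>2"
      by (intro monotone_onD[OF mono]) auto
    then show "dist (g t) (g (t + r)) < dist (g t) (g (t + s))"
      by (rule power_less_imp_less_base) simp
  qed
next
  assume t: "0 \<le> t - a" "t \<le> 1" "\<And>s. s \<in> {t - a<..<t} \<Longrightarrow> deriv (\<lambda>s. (dist (g t) (g s))\<^sup>2) s \<noteq> 0"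
  have "t - a < t" using a by simp
  from polynomial_on_edge_sides[OF g real_polynomial_function_dist_squared t(1) this t(2,3)]
  have "strict_mono_on {t - a..t} (\<lambda>s. (dist (g t) (g s))\<^sup>2) \<or> strict_antimono_on {t - a..t} (\<lambda>s. (dist (g t) (g s))\<^sup>2)"
    by blast
  moreover have "\<not> strict_mono_on {t - a..t} (\<lambda>s. (dist (g t) (g s))\<^sup>2)"
  proof
    assume "strict_mono_on {t - a..t} (\<lambda>s. (dist (g t) (g s))\<^sup>2)"
    from monotone_onD[OF this, of "t - a" t] show False using a by simp
  qed
  ultimately have mono: "strict_antimono_on {t - a..t} (\<lambda>s. (dist (g t) (g s))\<^sup>2)" by blast
  show "strict_mono_on {0..a} (\<lambda>s. dist (g t) (g (t - s)))"
  proof (rule monotone_onI)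
    fix r s assume rs: "r \<in> {0..a}" "s \<in> {0..a}" "r < s"
    then have "(dist (g t) (g (t - r)))\<^sup>2 < (dist (g t) (g (t - s)))\<^sup>2"
      by (intro monotone_onD[OF mono]) auto
    then show "dist (g t) (g (t - r)) < dist (g t) (g (t - s))"
      by (rule power_less_imp_less_base) simp
  qed
qed

lemma finite_punctured_avoid:
  assumes "finite (Z :: real set)"
  shows "\<exists>a>0. \<forall>s. s \<noteq> t \<longrightarrow> \<bar>s - t\<bar> < a \<longrightarrow> s \<notin> Z"
proof -
  obtain d where "d > 0" "\<And>x. x \<in> Z \<Longrightarrow> x \<noteq> t \<Longrightarrow> d \<le> dist t x"
    using finite_set_avoid[OF assms, of t] by blast
  then show ?thesis by (intro exI[of _ d]) (force simp: dist_real_def)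
qed

locale parametrized_graph =
  fixes \<Gamma> V :: "(real^3) set" and E :: "(real^3) set set" and g :: "(real^3) set \<Rightarrow> real \<Rightarrow> real^3"
  assumes \<Gamma>: "semialgebraic_graph \<Gamma> V E"
    and g: "\<And>e. e \<in> E \<Longrightarrow> edge_parametrization (g e) e"
    and ends: "\<And>e. e \<in> E \<Longrightarrow> g e 0 \<in> V \<and> g e 1 \<in> V"
begin

text \<open>
  The ways to leave \<open>p\<close> along an edge: an edge, a parameter of \<open>p\<close> on it,
  and the side, where \<open>True\<close> stands for increasing parameters. A point inside an edge
  has two branch directions.
\<close>

definition branch_directions :: "real^3 \<Rightarrow> ((real^3) set \<times> real \<times> bool) set" where
  "branch_directions p = {(e, t, b). e \<in> E \<and> t \<in> {0..1} \<and> g e t = p \<and> (if b then t < 1 else 0 < t)}"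

lemma graph_facts: "finite E" "finite V" "V \<subseteq> \<Gamma>" "\<Gamma> = V \<union> \<Union>E" "compact \<Gamma>" "connected \<Gamma>"
    "\<And>e. e \<in> E \<Longrightarrow> e \<inter> V = {}" "\<And>e e'. e \<in> E \<Longrightarrow> e' \<in> E \<Longrightarrow> e \<noteq> e' \<Longrightarrow> e \<inter> e' = {}"
    "\<And>e. e \<in> E \<Longrightarrow> g e ` {0<..<1} = e"
proof -
  show "finite E" "finite V" "V \<subseteq> \<Gamma>" "compact \<Gamma>" "connected \<Gamma>"
    using \<Gamma> unfolding semialgebraic_graph_def by simp_all
  have U: "\<Union>E = \<Gamma> - V" "pairwise disjnt E" using \<Gamma> unfolding semialgebraic_graph_def by simp_all
  show "\<Gamma> = V \<union> \<Union>E" using U(1) \<open>V \<subseteq> \<Gamma>\<close> by blast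
  show "e \<inter> V = {}" if "e \<in> E" for e using U(1) that by blast
  show "e \<inter> e' = {}" if "e \<in> E" "e' \<in> E" "e \<noteq> e'" for e e'
    using pairwiseD[OF U(2) that] by (simp add: disjnt_def)
  show "g e ` {0<..<1} = e" if "e \<in> E" for e
    using g[OF that] by (simp add: edge_parametrization_def)
qed

lemma edge_param_in: "e \<in> E \<Longrightarrow> 0 < t \<Longrightarrow> t < 1 \<Longrightarrow> g e t \<in> e"
  using graph_facts(9) by (metis greaterThanLessThan_iff image_eqI)

lemma edge_param_in_graph:
  assumes "e \<in> E" "t \<in> {0..1}"
  shows "g e t \<in> \<Gamma>"
proof -
  consider "t = 0" | "t = 1" | "0 < t" "t < 1" using assms(2) by force
  then show ?thesis
    using ends[OF assms(1)] edge_param_in[OF assms(1), of t] assms(1) graph_facts(4) by cases auto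
qed

lemma edge_param_in_V_iff:
  assumes "e \<in> E" "t \<in> {0..1}"
  shows "g e t \<in> V \<longleftrightarrow> t = 0 \<or> t = 1"
proof -
  consider "t = 0" | "t = 1" | "0 < t" "t < 1" using assms(2) by force
  then show ?thesis
    using ends[OF assms(1)] edge_param_in[OF assms(1), of t] graph_facts(7)[OF assms(1)] by cases auto
qed

lemma edge_param_inj: "e \<in> E \<Longrightarrow> s \<in> {0..1} \<Longrightarrow> t \<in> {0..1} \<Longrightarrow> g e s = g e t \<Longrightarrow> s = t"
  using inj_onD[OF edge_parametrization_inj[OF g]] by blast

lemma edge_param_unique:
  assumes "e \<in> E" "e' \<in> E" "0 < s" "s < 1" "t \<in> {0..1}" "g e s = g e' t"
  shows "e = e' \<and> s = t"
proof -
  have s: "g e s \<in> e" by (rule edge_param_in) (use assms in auto)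
  then have "g e' t \<notin> V" using assms(6) graph_facts(7)[OF assms(1)] by auto
  then have "0 < t" "t < 1" using edge_param_in_V_iff[OF assms(2,5)] assms(5) by auto
  then have "g e' t \<in> e'" using edge_param_in assms(2) by blast
  then have "e = e'" using s assms(1,2,6) graph_facts(8)[of e e'] by auto
  then show ?thesis using edge_param_inj[of e s t] assms by auto
qed

lemma finite_branch_directions: "finite (branch_directions p)"
proof (rule finite_imageD)
  show "inj_on (\<lambda>(e, t, b). (e, b)) (branch_directions p)"
    by (rule inj_onI) (auto simp: branch_directions_def intro: edge_param_inj)
  have "(\<lambda>(e, t, b). (e, b)) ` branch_directions p \<subseteq> E \<times> UNIV"
    by (auto simp: branch_directions_def)
  then show "finite ((\<lambda>(e, t, b). (e, b)) ` branch_directions p)"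
    by (rule finite_subset) (simp add: graph_facts(1))
qed

end

text \<open>
  The counting arguments use of a nondegenerate direction only that its height function is not
  constant on any edge.
\<close>

locale height_function_on_graph = parametrized_graph +
  fixes u :: "real^3"
  assumes nonconst: "\<And>e. e \<in> E \<Longrightarrow> \<exists>s\<in>{0..1}. \<exists>t\<in>{0..1}. u \<bullet> g e s \<noteq> u \<bullet> g e t"
begin

definition slope :: "(real^3) set \<Rightarrow> real \<Rightarrow> real" where
  "slope e = deriv (\<lambda>t. u \<bullet> g e t)"

definition descending :: "(real^3) set \<times> real \<times> bool \<Rightarrow> bool" where
  "descending = (\<lambda>(e, t, b). if b then falls_after (slope e) t else rises_before (slope e) t)"

lemma finite_critical_points:
  assumes e: "e \<in> E"
  shows "finite {t\<in>{0<..<1}. slope e t = 0}"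
proof -
  obtain a where "a \<in> {0<..<1}" "deriv (\<lambda>t. u \<bullet> g e t) a \<noteq> 0"
    using polynomial_on_edge_noncritical[OF g[OF e] real_polynomial_function_inner] nonconst[OF e] by blast
  from finite_critical_points_of_polynomial_on_edge[OF semialgebraic_graph_edge(1)[OF \<Gamma> e] g[OF e]
      real_polynomial_function_inner this]
  show ?thesis unfolding slope_def .
qed

lemma finite_distance_critical_points:
  assumes e: "e \<in> E" and t: "t \<in> {0..1}"
  shows "finite {s\<in>{0<..<1}. deriv (\<lambda>s. (dist (g e t) (g e s))\<^sup>2) s = 0}"
proof -
  obtain r where r: "r \<in> {0..1}" "r \<noteq> t" using t by (cases "t = 0") (auto intro: that[of 1] that[of 0])
  then have "(dist (g e t) (g e t))\<^sup>2 \<noteq> (dist (g e t) (g e r))\<^sup>2" using edge_param_inj[OF e] t by auto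
  then obtain a where "a \<in> {0<..<1}" "deriv (\<lambda>s. (dist (g e t) (g e s))\<^sup>2) a \<noteq> 0"
    using polynomial_on_edge_noncritical[OF g[OF e] real_polynomial_function_dist_squared[of "g e t"] t r(1)] by blast
  from finite_critical_points_of_polynomial_on_edge[OF semialgebraic_graph_edge(1)[OF \<Gamma> e] g[OF e]
      real_polynomial_function_dist_squared this]
  show ?thesis .
qed

text \<open>
  Critical points of the height and of the distance are finite in number, so a branch without them
  exists.
\<close>

lemma local_branch_radius:
  assumes d: "(e, t, b) \<in> branch_directions p"
  shows "\<exists>a>0. (if b then t + a < 1 else 0 < t - a) \<and>
    (\<forall>s\<in>{0<..<1}. s \<noteq> t \<longrightarrow> \<bar>s - t\<bar> < a \<longrightarrow>
       slope e s \<noteq> 0 \<and> deriv (\<lambda>s. (dist (g e t) (g e s))\<^sup>2) s \<noteq> 0)"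
proof -
  have e: "e \<in> E" "t \<in> {0..1}" and b: "if b then t < 1 else 0 < t"
    using d by (auto simp: branch_directions_def)
  obtain a1 where a1: "a1 > 0" "\<And>s. s \<noteq> t \<Longrightarrow> \<bar>s - t\<bar> < a1 \<Longrightarrow> s \<notin> {t\<in>{0<..<1}. slope e t = 0}"
    using finite_punctured_avoid[OF finite_critical_points[OF e(1)], of t] by blast
  obtain a2 where a2: "a2 > 0" "\<And>s. s \<noteq> t \<Longrightarrow> \<bar>s - t\<bar> < a2 \<Longrightarrow>
      s \<notin> {s\<in>{0<..<1}. deriv (\<lambda>s. (dist (g e t) (g e s))\<^sup>2) s = 0}"
    using finite_punctured_avoid[OF finite_distance_critical_points[OF e], of t] by blast
  define a where "a = min (min a1 a2) (if b then 1 - t else t) / 2"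
  have "a > 0" "a < a1" "a < a2" "a < (if b then 1 - t else t)"
    using a1(1) a2(1) b by (auto simp: a_def min_def)
  then show ?thesis using a1(2) a2(2) by (intro exI[of _ a]) auto
qed

definition branch :: "(real^3) set \<times> real \<times> bool \<Rightarrow> real \<Rightarrow> real^3" where
  "branch = (\<lambda>(e, t, b) s. g e (if b then t + s else t - s))"

text \<open>
  The branches of \<open>lower_degree_branches\<close> are obtained from the branch directions at
  \<open>p\<close>, cut at a common length \<open>a\<close> for which
  \<open>local_branch_radius\<close> applies. The parts of the edges that remain are compact and
  avoid \<open>p\<close>, so a small ball around \<open>p\<close> meets the branches only.
\<close>

lemma
  assumes p: "p \<in> \<Gamma>"
  shows lower_degree_graph: "lower_degree \<Gamma> u p = card {d \<in> branch_directions p. descending d}"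
    and local_minimum_graph: "local_minimum_on \<Gamma> (\<lambda>x. u \<bullet> x) p \<longleftrightarrow> (\<forall>d\<in>branch_directions p. \<not> descending d)"
proof -
  let ?B = "branch_directions p"
  define good where "good a d = (case d of (e, t, b) \<Rightarrow> (if b then t + a < 1 else 0 < t - a) \<and>
    (\<forall>s\<in>{0<..<1}. s \<noteq> t \<longrightarrow> \<bar>s - t\<bar> < a \<longrightarrow>
       slope e s \<noteq> 0 \<and> deriv (\<lambda>s. (dist (g e t) (g e s))\<^sup>2) s \<noteq> 0))" for a d
  have "\<exists>a. a > 0 \<and> good a d" if "d \<in> ?B" for d
  proof -
    obtain e t b where d: "d = (e, t, b)" by (cases d)
    show ?thesis unfolding good_def d prod.case by (rule local_branch_radius) (use that d in simp)
  qed
  then have "\<forall>d\<in>?B. \<exists>a. a > 0 \<and> good a d" by blast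
  from bchoice[OF this] obtain \<rho> where \<rho>: "\<And>d. d \<in> ?B \<Longrightarrow> \<rho> d > 0" "\<And>d. d \<in> ?B \<Longrightarrow> good (\<rho> d) d"
    by blast
  define a where "a = Min (insert 1 (\<rho> ` ?B))"
  have "a > 0" unfolding a_def using finite_branch_directions \<rho>(1) by (subst Min_gr_iff) auto
  have good: "(if b then t + a < 1 else 0 < t - a)"
    "s \<in> {0<..<1} \<Longrightarrow> s \<noteq> t \<Longrightarrow> \<bar>s - t\<bar> < a \<Longrightarrow>
       slope e s \<noteq> 0 \<and> deriv (\<lambda>s. (dist (g e t) (g e s))\<^sup>2) s \<noteq> 0"
    if "(e, t, b) \<in> ?B" for e t b s
  proof -
    have "a \<le> \<rho> (e, t, b)" unfolding a_def using finite_branch_directions that by simp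
    then show "(if b then t + a < 1 else 0 < t - a)"
      "s \<in> {0<..<1} \<Longrightarrow> s \<noteq> t \<Longrightarrow> \<bar>s - t\<bar> < a \<Longrightarrow>
       slope e s \<noteq> 0 \<and> deriv (\<lambda>s. (dist (g e t) (g e s))\<^sup>2) s \<noteq> 0"
      using \<rho>(2)[OF that] by (auto simp: good_def split: if_splits)
  qed
  have mem: "e \<in> E" "t \<in> {0..1}" "g e t = p" if "(e, t, b) \<in> ?B" for e t b
    using that by (simp_all add: branch_directions_def)
  have fw: "0 \<le> t" "t + a < 1" "s \<in> {t<..<t + a} \<Longrightarrow> slope e s \<noteq> 0"
    "s \<in> {t<..<t + a} \<Longrightarrow> deriv (\<lambda>s. (dist (g e t) (g e s))\<^sup>2) s \<noteq> 0"
    if d: "(e, t, True) \<in> ?B" for e t s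
  proof -
    show 1: "0 \<le> t" "t + a < 1" using mem(2)[OF d] good(1)[OF d] by simp_all
    assume "s \<in> {t<..<t + a}"
    then have "s \<in> {0<..<1}" "s \<noteq> t" "\<bar>s - t\<bar> < a" using 1 by auto
    from good(2)[OF d this] show "slope e s \<noteq> 0" "deriv (\<lambda>s. (dist (g e t) (g e s))\<^sup>2) s \<noteq> 0" by blast+
  qed
  have bw: "0 < t - a" "t \<le> 1" "s \<in> {t - a<..<t} \<Longrightarrow> slope e s \<noteq> 0"
    "s \<in> {t - a<..<t} \<Longrightarrow> deriv (\<lambda>s. (dist (g e t) (g e s))\<^sup>2) s \<noteq> 0"
    if d: "(e, t, False) \<in> ?B" for e t s
  proof -
    show 1: "0 < t - a" "t \<le> 1" using mem(2)[OF d] good(1)[OF d] by simp_all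
    assume "s \<in> {t - a<..<t}"
    then have "s \<in> {0<..<1}" "s \<noteq> t" "\<bar>s - t\<bar> < a" using 1 by auto
    from good(2)[OF d this] show "slope e s \<noteq> 0" "deriv (\<lambda>s. (dist (g e t) (g e s))\<^sup>2) s \<noteq> 0" by blast+
  qed
  have inner: "(if b then t + s else t - s) \<in> {0<..<1}" if "(e, t, b) \<in> ?B" "s \<in> {0<..a}" for e t b s
  proof (cases b)
    case True
    then show ?thesis using fw(1,2)[of e t] that by simp
  next
    case False
    then show ?thesis using bw(1,2)[of e t] that by simp
  qed
  have start: "branch d 0 = p" if "d \<in> ?B" for d
    using that by (auto simp: branch_def branch_directions_def)
  have mono: "strict_mono_on {0..a} (\<lambda>s. dist p (branch d s))" if "d \<in> ?B" for d
  proof -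
    obtain e t b where d: "d = (e, t, b)" by (cases d)
    show ?thesis
    proof (cases b)
      case True
      have m: "(e, t, True) \<in> ?B" using that d True by simp
      have "strict_mono_on {0..a} (\<lambda>s. dist (g e t) (g e (t + s)))"
        by (rule distance_from_edge_point(1)[OF g[OF mem(1)[OF m]] \<open>a > 0\<close> fw(1)[OF m] less_imp_le[OF fw(2)[OF m]] fw(4)[OF m]])
      then show ?thesis using True mem(3)[OF m] by (simp add: d branch_def)
    next
      case False
      have m: "(e, t, False) \<in> ?B" using that d False by simp
      have "strict_mono_on {0..a} (\<lambda>s. dist (g e t) (g e (t - s)))"
        by (rule distance_from_edge_point(2)[OF g[OF mem(1)[OF m]] \<open>a > 0\<close> less_imp_le[OF bw(1)[OF m]] bw(2)[OF m] bw(4)[OF m]])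
      then show ?thesis using False mem(3)[OF m] by (simp add: d branch_def)
    qed
  qed
  have height: "(if descending d then u \<bullet> branch d s < u \<bullet> p else u \<bullet> p < u \<bullet> branch d s)"
    if "d \<in> ?B" and s: "s \<in> {0<..a}" for d s
  proof -
    obtain e t b where d: "d = (e, t, b)" by (cases d)
    show ?thesis
    proof (cases b)
      case True
      have m: "(e, t, True) \<in> ?B" using that d True by simp
      have less: "t < t + a" using \<open>a > 0\<close> by simp
      have ts: "t \<in> {t..t + a}" "t + s \<in> {t..t + a}" "t < t + s" using s by auto
      consider "\<forall>r\<in>{t<..<t + a}. 0 < slope e r" "strict_mono_on {t..t + a} (\<lambda>t. u \<bullet> g e t)" |
          "\<forall>r\<in>{t<..<t + a}. slope e r < 0" "strict_antimono_on {t..t + a} (\<lambda>t. u \<bullet> g e t)"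
        using polynomial_on_edge_sides[OF g[OF mem(1)[OF m]] real_polynomial_function_inner fw(1)[OF m]
            less less_imp_le[OF fw(2)[OF m]] fw(3)[OF m, unfolded slope_def]]
        unfolding slope_def by blast
      then show ?thesis
      proof cases
        case 1
        then show ?thesis using end_behaviour_from_sign(2)[OF less, of "slope e"] monotone_onD[OF 1(2) ts] mem(3)[OF m]
          by (simp add: d True descending_def branch_def)
      next
        case 2
        then show ?thesis using end_behaviour_from_sign(1)[OF less, of "slope e"] monotone_onD[OF 2(2) ts] mem(3)[OF m]
          by (simp add: d True descending_def branch_def)
      qed
    next
      case False
      have m: "(e, t, False) \<in> ?B" using that d False by simp
      have less: "t - a < t" using \<open>a > 0\<close> by simp
      have ts: "t - s \<in> {t - a..t}" "t \<in> {t - a..t}" "t - s < t" using s by auto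
      consider "\<forall>r\<in>{t - a<..<t}. 0 < slope e r" "strict_mono_on {t - a..t} (\<lambda>t. u \<bullet> g e t)" |
          "\<forall>r\<in>{t - a<..<t}. slope e r < 0" "strict_antimono_on {t - a..t} (\<lambda>t. u \<bullet> g e t)"
        using polynomial_on_edge_sides[OF g[OF mem(1)[OF m]] real_polynomial_function_inner less_imp_le[OF bw(1)[OF m]]
            less bw(2)[OF m] bw(3)[OF m, unfolded slope_def]]
        unfolding slope_def by blast
      then show ?thesis
      proof cases
        case 1
        then show ?thesis using end_behaviour_from_sign(2)[OF less, of "slope e"] monotone_onD[OF 1(2) ts] mem(3)[OF m]
          by (simp add: d False descending_def branch_def)
      next
        case 2
        then show ?thesis using end_behaviour_from_sign(1)[OF less, of "slope e"] monotone_onD[OF 2(2) ts] mem(3)[OF m]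
          by (simp add: d False descending_def branch_def)
      qed
    qed
  qed
  \<comment> \<open>away from the branches the graph keeps a positive distance from \<open>p\<close>\<close>
  define T where "T e = {s\<in>{0..1}. \<forall>t\<in>{0..1}. g e t = p \<longrightarrow> a \<le> \<bar>s - t\<bar>}" for e
  define K where "K = (V - {p}) \<union> (\<Union>e\<in>E. g e ` T e)"
  have "closed (T e)" if "e \<in> E" for e
  proof -
    have "T e = {0..1} \<inter> (\<Inter>t\<in>{t\<in>{0..1}. g e t = p}. {s. a \<le> \<bar>s - t\<bar>})" by (auto simp: T_def)
    moreover have "closed {s. a \<le> \<bar>s - t\<bar>}" for t
      by (intro closed_Collect_le continuous_intros)
    ultimately show ?thesis by (auto intro!: closed_Int closed_INT)
  qed
  then have "compact (T e)" if "e \<in> E" for e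
    using that by (auto simp: compact_eq_bounded_closed T_def intro: bounded_subset[OF bounded_closed_interval[of 0 1]])
  then have "compact (g e ` T e)" if "e \<in> E" for e
    using that by (intro compact_continuous_image continuous_on_subset[OF edge_parametrization_continuous[OF g[OF that]]])
      (auto simp: T_def)
  then have "closed K"
    unfolding K_def using graph_facts(1,2)
    by (intro closed_Un closed_UN finite_imp_closed) (auto intro: compact_imp_closed)
  moreover have "p \<notin> K"
    unfolding K_def T_def using \<open>a > 0\<close> by force
  ultimately obtain \<delta> where \<delta>: "\<delta> > 0" "ball p \<delta> \<subseteq> - K"
    using open_contains_ball[of "- K"] by auto
  have cover: "\<exists>d\<in>?B. \<exists>s\<in>{0<..a}. q = branch d s" if q: "q \<in> \<Gamma>" "q \<noteq> p" "dist p q < \<delta>" for q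
  proof -
    have "q \<notin> K" using q(3) \<delta>(2) by auto
    then have "q \<notin> V" using q(2) by (auto simp: K_def)
    then obtain e where e: "e \<in> E" "q \<in> e" using q(1) graph_facts(4) by blast
    then obtain s where s: "s \<in> {0<..<1}" "q = g e s" using graph_facts(9)[OF e(1)] by blast
    then have "s \<notin> T e" using \<open>q \<notin> K\<close> e(1) by (auto simp: K_def)
    then obtain t where t: "t \<in> {0..1}" "g e t = p" "\<bar>s - t\<bar> < a" using s(1) by (force simp: T_def)
    have "s \<noteq> t" using t(2) s(2) q(2) by auto
    then have "(e, t, s > t) \<in> ?B" using e(1) t s(1) by (auto simp: branch_directions_def)
    moreover have "q = branch (e, t, s > t) \<bar>s - t\<bar>" using s(2) by (auto simp: branch_def)
    ultimately show ?thesis using t(3) \<open>s \<noteq> t\<close> by (intro bexI[of _ "(e, t, s > t)"] bexI[of _ "\<bar>s - t\<bar>"]) auto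
  qed
  have cont: "continuous_on {0..a} (branch d)" if "d \<in> ?B" for d
  proof -
    obtain e t b where d: "d = (e, t, b)" by (cases d)
    have m: "(e, t, b) \<in> ?B" using that d by simp
    have "continuous_on {0..a} (\<lambda>s. g e (if b then t + s else t - s))"
    proof (rule continuous_on_compose2[OF edge_parametrization_continuous[OF g[OF mem(1)[OF m]]]])
      show "continuous_on {0..a} (\<lambda>s. if b then t + s else t - s)" by (cases b) (auto intro!: continuous_intros)
      show "(\<lambda>s. if b then t + s else t - s) ` {0..a} \<subseteq> {0..1}"
      proof (rule image_subsetI)
        fix s assume s: "s \<in> {0..a}"
        show "(if b then t + s else t - s) \<in> {0..1}"
        proof (cases "s = 0")
          case True
          then show ?thesis using mem(2)[OF m] by simp
        next
          case False
          then have "s \<in> {0<..a}" using s by simp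
          from inner[OF m this] show ?thesis by (meson atLeastAtMost_iff greaterThanLessThan_iff less_imp_le)
        qed
      qed
    qed
    then show ?thesis by (simp add: d branch_def)
  qed
  have into: "branch d s \<in> \<Gamma>" if "d \<in> ?B" "s \<in> {0<..a}" for d s
  proof -
    obtain e t b where d: "d = (e, t, b)" by (cases d)
    have m: "(e, t, b) \<in> ?B" using that d by simp
    have "(if b then t + s else t - s) \<in> {0..1}"
      using inner[OF m that(2)] by (meson atLeastAtMost_iff greaterThanLessThan_iff less_imp_le)
    from edge_param_in_graph[OF mem(1)[OF m] this] show ?thesis by (simp add: d branch_def)
  qed
  have disj: "d = c" if dc: "d \<in> ?B" "c \<in> ?B" "s \<in> {0<..a}" "r \<in> {0<..a}" "branch d s = branch c r" for d c s r
  proof -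
    obtain e t b where d: "d = (e, t, b)" by (cases d)
    obtain e' t' b' where c: "c = (e', t', b')" by (cases c)
    have m: "(e, t, b) \<in> ?B" "(e', t', b') \<in> ?B" using dc d c by simp_all
    define x where "x = (if b then t + s else t - s)"
    define y where "y = (if b' then t' + r else t' - r)"
    have xy: "x \<in> {0<..<1}" "y \<in> {0<..<1}"
      unfolding x_def y_def using inner m dc(3,4) by blast+
    have "e = e' \<and> x = y"
      by (rule edge_param_unique[OF mem(1)[OF m(1)] mem(1)[OF m(2)]])
        (use xy dc(5) in \<open>simp_all add: d c branch_def x_def y_def\<close>)
    moreover from this have "t = t'"
      using edge_param_inj[OF mem(1)[OF m(1)] mem(2)[OF m(1)] mem(2)[OF m(2)]] mem(3)[OF m(1)] mem(3)[OF m(2)] by simp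
    moreover from calculation have "b = b'" using dc(3,4) by (auto simp: x_def y_def split: if_splits)
    ultimately show ?thesis by (simp add: d c)
  qed
  have down: "u \<bullet> branch d s < u \<bullet> p" if "d \<in> ?B" "descending d" "s \<in> {0<..a}" for d s
    using height[OF that(1,3)] that(2) by simp
  have up: "u \<bullet> p < u \<bullet> branch d s" if "d \<in> ?B" "\<not> descending d" "s \<in> {0<..a}" for d s
    using height[OF that(1,3)] that(2) by simp
  show "lower_degree \<Gamma> u p = card {d \<in> ?B. descending d}"
    by (rule lower_degree_branches[OF finite_branch_directions \<open>a > 0\<close> \<delta>(1) p cont start mono into disj cover down up])
  show "local_minimum_on \<Gamma> (\<lambda>x. u \<bullet> x) p \<longleftrightarrow> (\<forall>d\<in>?B. \<not> descending d)"
    by (rule local_minimum_branches[OF finite_branch_directions \<open>a > 0\<close> \<delta>(1) p cont start mono into disj cover down up])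
qed

definition critical_parameters :: "(real^3) set \<Rightarrow> real set" where
  "critical_parameters e = {t\<in>{0<..<1}. slope e t = 0}"

text \<open>The points at which the weight can be nonzero.\<close>

definition special_points :: "(real^3) set" where
  "special_points = V \<union> (\<Union>e\<in>E. g e ` critical_parameters e)"

lemma finite_critical_parameters: "e \<in> E \<Longrightarrow> finite (critical_parameters e)"
  unfolding critical_parameters_def by (rule finite_critical_points)

lemma finite_special_points: "finite special_points"
  unfolding special_points_def using graph_facts(1,2) finite_critical_parameters by blast

lemma special_points_subset: "special_points \<subseteq> \<Gamma>"
  unfolding special_points_def using graph_facts(3) edge_param_in_graph
  by (auto simp: critical_parameters_def)

lemma edge_param_special_iff:
  assumes "e \<in> E" "t \<in> {0..1}"
  shows "g e t \<in> special_points \<longleftrightarrow> t = 0 \<or> t = 1 \<or> t \<in> critical_parameters e"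
proof
  assume "g e t \<in> special_points"
  then consider "g e t \<in> V" | e' s where "e' \<in> E" "s \<in> critical_parameters e'" "g e t = g e' s"
    unfolding special_points_def by blast
  then show "t = 0 \<or> t = 1 \<or> t \<in> critical_parameters e"
  proof cases
    case 1
    then show ?thesis using edge_param_in_V_iff[OF assms] by blast
  next
    case 2
    then have "0 < s" "s < 1" by (auto simp: critical_parameters_def)
    then have "e' = e \<and> s = t" using edge_param_unique[OF 2(1) assms(1) _ _ assms(2)] 2(3) by simp
    then show ?thesis using 2 by simp
  qed
next
  assume "t = 0 \<or> t = 1 \<or> t \<in> critical_parameters e"
  then show "g e t \<in> special_points"
    unfolding special_points_def using edge_param_in_V_iff[OF assms] assms(1) by blast
qed

lemma slope_continuous: "e \<in> E \<Longrightarrow> continuous_on {0<..<1} (slope e)"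
  unfolding slope_def
  by (intro locally_holomorphic_extendable_continuous_on locally_holomorphic_extendable_deriv
      edge_polynomial_analytic[OF g real_polynomial_function_inner])

lemma card_special_points:
  "card special_points = card V + (\<Sum>e\<in>E. card (critical_parameters e))"
proof -
  have "card (\<Union>e\<in>E. g e ` critical_parameters e) = (\<Sum>e\<in>E. card (g e ` critical_parameters e))"
  proof (rule card_UN_disjoint)
    show "\<forall>i\<in>E. \<forall>j\<in>E. i \<noteq> j \<longrightarrow> g i ` critical_parameters i \<inter> g j ` critical_parameters j = {}"
    proof (intro ballI impI)
      fix i j assume ij: "i \<in> E" "j \<in> E" "i \<noteq> j"
      have "g i ` critical_parameters i \<subseteq> i" "g j ` critical_parameters j \<subseteq> j"
        using edge_param_in ij by (auto simp: critical_parameters_def)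
      then show "g i ` critical_parameters i \<inter> g j ` critical_parameters j = {}"
        using graph_facts(8)[OF ij] by blast
    qed
  qed (use graph_facts(1) finite_critical_parameters in auto)
  also have "\<dots> = (\<Sum>e\<in>E. card (critical_parameters e))"
  proof (rule sum.cong[OF refl card_image])
    fix e assume e: "e \<in> E"
    show "inj_on (g e) (critical_parameters e)"
      by (rule inj_on_subset[OF edge_parametrization_inj[OF g[OF e]]]) (auto simp: critical_parameters_def)
  qed
  finally have "card (\<Union>e\<in>E. g e ` critical_parameters e) = (\<Sum>e\<in>E. card (critical_parameters e))" .
  moreover have "V \<inter> (\<Union>e\<in>E. g e ` critical_parameters e) = {}"
  proof -
    have "g e ` critical_parameters e \<subseteq> e" if "e \<in> E" for e
      using edge_param_in[OF that] by (auto simp: critical_parameters_def)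
    then show ?thesis using graph_facts(7) by blast
  qed
  ultimately show ?thesis
    unfolding special_points_def using graph_facts(1,2) finite_critical_parameters
    by (subst card_Un_disjoint) auto
qed

text \<open>
  Sorting the descending branches by their edge reduces the count to
  \<open>count_descending_directions\<close>.
\<close>

lemma sum_descending_branches:
  "(\<Sum>p\<in>special_points. card {d \<in> branch_directions p. descending d}) =
     (\<Sum>e\<in>E. card (critical_parameters e)) + card E"
proof -
  let ?A = "\<lambda>e. {t \<in> insert 0 (critical_parameters e). falls_after (slope e) t}"
  let ?B = "\<lambda>e. {t \<in> insert 1 (critical_parameters e). rises_before (slope e) t}"
  let ?D = "\<lambda>e. (\<lambda>t. (e, t, True)) ` ?A e \<union> (\<lambda>t. (e, t, False)) ` ?B e"
  have "(\<Sum>p\<in>special_points. card {d \<in> branch_directions p. descending d}) =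
      card (\<Union>p\<in>special_points. {d \<in> branch_directions p. descending d})"
  proof (rule card_UN_disjoint[symmetric])
    show "finite special_points" by (rule finite_special_points)
    show "\<forall>p\<in>special_points. finite {d \<in> branch_directions p. descending d}"
      using finite_branch_directions by simp
  qed (auto simp: branch_directions_def)
  also have "(\<Union>p\<in>special_points. {d \<in> branch_directions p. descending d}) = (\<Union>e\<in>E. ?D e)"
  proof (intro equalityI subsetI)
    fix d assume "d \<in> (\<Union>p\<in>special_points. {d \<in> branch_directions p. descending d})"
    then obtain p e t b where d: "d = (e, t, b)" "p \<in> special_points" "(e, t, b) \<in> branch_directions p"
      "descending (e, t, b)" by (cases d) auto
    then have e: "e \<in> E" "t \<in> {0..1}" "g e t = p" "if b then t < 1 else 0 < t"
      by (auto simp: branch_directions_def)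
    then have "t = 0 \<or> t = 1 \<or> t \<in> critical_parameters e"
      using edge_param_special_iff d(2) by blast
    then have "d \<in> ?D e"
      using d(4) e(4) by (cases b) (auto simp: d(1) descending_def)
    then show "d \<in> (\<Union>e\<in>E. ?D e)" using e(1) by blast
  next
    fix d assume "d \<in> (\<Union>e\<in>E. ?D e)"
    then obtain e where e: "e \<in> E" "d \<in> ?D e" by blast
    have goal: "d \<in> (\<Union>p\<in>special_points. {d \<in> branch_directions p. descending d})"
      if d: "d = (e, t, b)" "descending (e, t, b)" "t \<in> insert (if b then 0 else 1) (critical_parameters e)" for t b
    proof -
      have t: "t \<in> {0..1}" "if b then t < 1 else 0 < t"
        using d(3) by (auto simp: critical_parameters_def split: if_splits)
      have "g e t \<in> special_points" using edge_param_special_iff[OF e(1) t(1)] d(3) by (auto split: if_splits)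
      moreover have "d \<in> branch_directions (g e t)" using e(1) t d(1) by (simp add: branch_directions_def)
      ultimately show ?thesis using d(1,2) by blast
    qed
    from e(2) consider t where "d = (e, t, True)" "t \<in> ?A e" | t where "d = (e, t, False)" "t \<in> ?B e" by blast
    then show "d \<in> (\<Union>p\<in>special_points. {d \<in> branch_directions p. descending d})"
    proof cases
      case 1
      then show ?thesis by (intro goal[of t True]) (simp_all add: descending_def)
    next
      case 2
      then show ?thesis by (intro goal[of t False]) (simp_all add: descending_def)
    qed
  qed
  also have "card (\<Union>e\<in>E. ?D e) = (\<Sum>e\<in>E. card (?D e))"
    by (rule card_UN_disjoint) (use graph_facts(1) finite_critical_parameters in auto)
  also have "\<dots> = (\<Sum>e\<in>E. card (critical_parameters e) + 1)"
  proof (rule sum.cong[OF refl])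
    fix e assume e: "e \<in> E"
    have "card (?D e) = card ((\<lambda>t. (e, t, True)) ` ?A e) + card ((\<lambda>t. (e, t, False)) ` ?B e)"
      by (rule card_Un_disjoint) (use finite_critical_parameters[OF e] in auto)
    also have "\<dots> = card (?A e) + card (?B e)"
      by (simp add: card_image inj_on_def)
    also have "\<dots> = card (critical_parameters e) + 1"
      by (rule count_descending_directions[OF finite_critical_parameters[OF e]])
        (use slope_continuous[OF e] in \<open>auto simp: critical_parameters_def\<close>)
    finally show "card (?D e) = card (critical_parameters e) + 1" .
  qed
  also have "\<dots> = (\<Sum>e\<in>E. card (critical_parameters e)) + card E" unfolding sum.distrib by simp
  finally show ?thesis .
qed

text \<open>
  A local minimum has no descending branch, so the formula of the other points would give
  \<open>-1\<close> instead of \<open>1\<close>.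
\<close>

lemma point_weight_graph:
  assumes p: "p \<in> \<Gamma>"
  shows "point_weight \<Gamma> u p = int (card {d \<in> branch_directions p. descending d}) - 1 +
    (if local_minimum_on \<Gamma> (\<lambda>x. u \<bullet> x) p then 2 else 0)"
proof (cases "local_minimum_on \<Gamma> (\<lambda>x. u \<bullet> x) p")
  case True
  then have empty: "{d \<in> branch_directions p. descending d} = {}" using local_minimum_graph[OF p] by blast
  show ?thesis unfolding empty using True by (simp add: point_weight_def)
next
  case False
  then show ?thesis by (simp add: point_weight_def lower_degree_graph[OF p])
qed

text \<open>A regular point of an edge has two branches, one going up and one going down.\<close>

lemma one_descending_branch_if_not_special:
  assumes p: "p \<in> \<Gamma>" "p \<notin> special_points"
  shows "card {d \<in> branch_directions p. descending d} = 1"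
proof -
  have "p \<notin> V" using p(2) by (auto simp: special_points_def)
  then obtain e where e: "e \<in> E" "p \<in> e" using p(1) graph_facts(4) by blast
  then obtain t where t: "t \<in> {0<..<1}" "p = g e t" using graph_facts(9)[OF e(1)] by blast
  have dirs: "branch_directions p = {(e, t, True), (e, t, False)}"
  proof (intro equalityI subsetI)
    fix d assume d: "d \<in> branch_directions p"
    obtain e' s b where d_eq: "d = (e', s, b)" by (cases d)
    have e': "e' \<in> E" "s \<in> {0..1}" "g e t = g e' s"
      using d t(2) by (simp_all add: d_eq branch_directions_def)
    have "e = e' \<and> t = s" by (rule edge_param_unique[OF e(1) e'(1) _ _ e'(2,3)]) (use t(1) in auto)
    then show "d \<in> {(e, t, True), (e, t, False)}" by (cases b) (simp_all add: d_eq)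
  next
    fix d assume "d \<in> {(e, t, True), (e, t, False)}"
    then show "d \<in> branch_directions p" using t e(1) by (auto simp: branch_directions_def)
  qed
  have nz: "slope e t \<noteq> 0"
    using p(2) t e(1) by (auto simp: special_points_def critical_parameters_def)
  have "isCont (slope e) t"
    using slope_continuous[OF e(1)] t(1) by (simp add: continuous_on_eq_continuous_at)
  from eventually_same_sign[OF this nz] obtain r where r: "r > 0"
    "\<And>s. dist s t < r \<Longrightarrow> slope e s \<noteq> 0 \<and> (0 < slope e s \<longleftrightarrow> 0 < slope e t)"
    unfolding eventually_nhds_metric by blast
  have lr: "t - r < t" "t < t + r" using r(1) by auto
  show ?thesis
  proof (cases "0 < slope e t")
    case True
    then have "0 < slope e s" if "s \<in> {t - r<..<t + r}" for s
      using r(2)[of s] that by (auto simp: dist_real_def)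
    then have "rises_before (slope e) t" "\<not> falls_after (slope e) t"
      using end_behaviour_from_sign(2)[OF lr(1), of "slope e"] end_behaviour_from_sign(2)[OF lr(2), of "slope e"] by auto
    then have "{d \<in> branch_directions p. descending d} = {(e, t, False)}"
      unfolding dirs by (auto simp: descending_def)
    then show ?thesis by simp
  next
    case False
    have "slope e s < 0" if "s \<in> {t - r<..<t + r}" for s
    proof -
      have "dist s t < r" using that by (auto simp: dist_real_def)
      from r(2)[OF this] False show ?thesis by linarith
    qed
    then have "\<not> rises_before (slope e) t" "falls_after (slope e) t"
      using end_behaviour_from_sign(1)[OF lr(1), of "slope e"] end_behaviour_from_sign(1)[OF lr(2), of "slope e"] by auto
    then have "{d \<in> branch_directions p. descending d} = {(e, t, True)}"
      unfolding dirs by (auto simp: descending_def)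
    then show ?thesis by simp
  qed
qed

lemma local_minimum_special:
  assumes "local_minimum_on \<Gamma> (\<lambda>x. u \<bullet> x) p"
  shows "p \<in> special_points"
proof (rule ccontr)
  assume special: "p \<notin> special_points"
  have p: "p \<in> \<Gamma>" using assms by (simp add: local_minimum_on_def)
  have "\<forall>d\<in>branch_directions p. \<not> descending d" by (rule iffD1[OF local_minimum_graph[OF p] assms])
  then have "{d \<in> branch_directions p. descending d} = {}" by blast
  then have "card {d \<in> branch_directions p. descending d} = 0" by (simp only: card.empty)
  then show False using one_descending_branch_if_not_special[OF p special] by linarith
qed

text \<open>
  The Morse inequality as an identity: the contributions of the critical points in the sum of the
  descending branches and in the number of special points cancel.
\<close>

theorem graph_weight_eq:
  "finite {p. local_minimum_on \<Gamma> (\<lambda>x. u \<bullet> x) p}"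
  "graph_weight \<Gamma> u = 2 * int (card {p. local_minimum_on \<Gamma> (\<lambda>x. u \<bullet> x) p}) + int (card E) - int (card V)"
proof -
  let ?M = "{p. local_minimum_on \<Gamma> (\<lambda>x. u \<bullet> x) p}"
  let ?D = "\<lambda>p. card {d \<in> branch_directions p. descending d}"
  have M: "?M \<subseteq> special_points" using local_minimum_special by blast
  show "finite ?M" by (rule finite_subset[OF M finite_special_points])
  have zero: "point_weight \<Gamma> u p = 0" if "p \<in> \<Gamma>" "p \<notin> special_points" for p
  proof -
    have "\<not> local_minimum_on \<Gamma> (\<lambda>x. u \<bullet> x) p" using M that(2) by blast
    then show ?thesis
      using point_weight_graph[OF that(1)] one_descending_branch_if_not_special[OF that] by simp
  qed
  have "graph_weight \<Gamma> u = (\<Sum>p\<in>special_points. point_weight \<Gamma> u p)"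
    unfolding graph_weight_def
    by (rule sum.mono_neutral_left) (use finite_special_points zero special_points_subset in auto)
  also have "\<dots> = (\<Sum>p\<in>special_points. int (?D p) - 1 + (if p \<in> ?M then 2 else 0))"
  proof (rule sum.cong[OF refl])
    fix p assume "p \<in> special_points"
    then have "p \<in> \<Gamma>" using special_points_subset by blast
    from point_weight_graph[OF this]
    show "point_weight \<Gamma> u p = int (?D p) - 1 + (if p \<in> ?M then 2 else 0)" by simp
  qed
  also have "\<dots> = int (\<Sum>p\<in>special_points. ?D p) - int (card special_points) + (\<Sum>p\<in>special_points. if p \<in> ?M then 2 else 0)"
    by (simp add: sum.distrib sum_subtractf)
  also have "(\<Sum>p\<in>special_points. if p \<in> ?M then 2 else 0 :: int) = (\<Sum>p\<in>special_points \<inter> ?M. 2)"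
    by (rule sum.inter_restrict[symmetric]) (rule finite_special_points)
  also have "special_points \<inter> ?M = ?M" using M by blast
  finally show "graph_weight \<Gamma> u = 2 * int (card ?M) + int (card E) - int (card V)"
    unfolding sum_descending_branches card_special_points by simp
qed

end

section \<open>Rank of abelian groups\<close>

definition int_combination :: "('a, 'b) monoid_scheme \<Rightarrow> ('a \<Rightarrow> int) \<Rightarrow> 'a set \<Rightarrow> 'a" where
  "int_combination G k B = finprod G (\<lambda>b. b [^]\<^bsub>G\<^esub> k b) B"

text \<open>
  A finite independent subset of \<open>S\<close> such that every element of \<open>S\<close> has a
  nonzero multiple in its span. Defining this for subsets of a fixed group avoids forming subgroups
  for kernels and images.
\<close>

definition has_rank_on :: "('a, 'b) monoid_scheme \<Rightarrow> 'a set \<Rightarrow> nat \<Rightarrow> bool" where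
  "has_rank_on G S n \<longleftrightarrow> (\<exists>B\<subseteq>S. int_independent G B \<and> card B = n \<and>
     (\<forall>x\<in>S. \<exists>m k. m \<noteq> (0::int) \<and> x [^]\<^bsub>G\<^esub> m = int_combination G k B))"

lemma has_rank_onI:
  assumes "B \<subseteq> S" "int_independent G B" "card B = n"
    "\<And>x. x \<in> S \<Longrightarrow> \<exists>m k. m \<noteq> (0::int) \<and> x [^]\<^bsub>G\<^esub> m = int_combination G k B"
  shows "has_rank_on G S n"
  unfolding has_rank_on_def by (intro exI[of _ B] conjI ballI assms)

lemma has_rank_onE:
  assumes "has_rank_on G S n"
  obtains B where "B \<subseteq> S" "int_independent G B" "card B = n"
    "\<forall>x\<in>S. \<exists>m k. m \<noteq> (0::int) \<and> x [^]\<^bsub>G\<^esub> m = int_combination G k B"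
proof -
  from assms obtain B where B: "B \<subseteq> S \<and> int_independent G B \<and> card B = n \<and>
     (\<forall>x\<in>S. \<exists>m k. m \<noteq> (0::int) \<and> x [^]\<^bsub>G\<^esub> m = int_combination G k B)"
    unfolding has_rank_on_def by (rule exE)
  show ?thesis by (rule that[of B]) (use B in simp_all)
qed

context comm_group
begin

lemma int_combination_closed [simp]:
  assumes "B \<subseteq> carrier G"
  shows "int_combination G k B \<in> carrier G"
  unfolding int_combination_def using assms by (intro finprod_closed) auto

lemma int_combination_add:
  assumes "finite B" "B \<subseteq> carrier G"
  shows "int_combination G (\<lambda>b. k b + l b) B = int_combination G k B \<otimes> int_combination G l B"
proof -
  have "int_combination G (\<lambda>b. k b + l b) B = finprod G (\<lambda>b. b [^] k b \<otimes> b [^] l b) B"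
    unfolding int_combination_def using assms by (intro finprod_cong') (auto simp: int_pow_mult)
  also have "\<dots> = int_combination G k B \<otimes> int_combination G l B"
    unfolding int_combination_def using assms by (intro finprod_multf) auto
  finally show ?thesis .
qed

lemma int_combination_zero: "int_combination G (\<lambda>_. 0) B = \<one>"
  unfolding int_combination_def by (simp add: finprod_one_eqI)

lemma int_combination_insert:
  assumes "finite B" "insert x B \<subseteq> carrier G" "x \<notin> B"
  shows "int_combination G k (insert x B) = x [^] k x \<otimes> int_combination G k B"
  unfolding int_combination_def using assms by (intro finprod_insert) auto

lemma int_combination_scale:
  assumes "finite B" "B \<subseteq> carrier G"
  shows "int_combination G k B [^] (m::int) = int_combination G (\<lambda>b. m * k b) B"
  using assms
proof (induction B rule: finite_induct)
  case empty
  then show ?case by (simp add: int_combination_def)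
next
  case (insert x B)
  then have "int_combination G k (insert x B) [^] m = (x [^] k x) [^] m \<otimes> int_combination G k B [^] m"
    by (simp add: int_combination_insert int_pow_distrib)
  then show ?case using insert by (simp add: int_combination_insert int_pow_pow mult.commute)
qed

lemma int_combination_Un:
  assumes "finite A" "finite B" "A \<inter> B = {}" "A \<subseteq> carrier G" "B \<subseteq> carrier G"
  shows "int_combination G k (A \<union> B) = int_combination G k A \<otimes> int_combination G k B"
  unfolding int_combination_def using assms by (intro finprod_Un_disjoint) auto

lemma int_combination_cong:
  assumes "B \<subseteq> carrier G" "\<And>b. b \<in> B \<Longrightarrow> k b = l b"
  shows "int_combination G k B = int_combination G l B"
  unfolding int_combination_def using assms by (intro finprod_cong') auto

lemma int_combination_single:
  assumes "finite B" "B \<subseteq> carrier G" "x \<in> B"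
  shows "int_combination G (\<lambda>b. if b = x then m else 0) B = x [^] m"
proof -
  have B: "B = insert x (B - {x})" using assms by blast
  have "int_combination G (\<lambda>b. if b = x then m else 0) (insert x (B - {x})) =
      x [^] m \<otimes> int_combination G (\<lambda>b. if b = x then m else 0) (B - {x})"
    using assms by (subst int_combination_insert) auto
  also have "int_combination G (\<lambda>b. if b = x then m else 0) (B - {x}) = int_combination G (\<lambda>_. 0) (B - {x})"
    using assms by (intro int_combination_cong) auto
  finally show ?thesis using assms B by (auto simp: int_combination_zero)
qed

text \<open>
  The coefficients are multiplied like matrices; the multipliers \<open>m b\<close> come from
  working with multiples of the elements.
\<close>

lemma int_combination_of_combinations:
  assumes D: "finite D" "D \<subseteq> carrier G" and B: "finite B" "B \<subseteq> carrier G"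
    and eq: "\<And>b. b \<in> B \<Longrightarrow> b [^] m b = int_combination G (\<kappa> b) D"
  shows "int_combination G (\<lambda>b. m b * x b) B = int_combination G (\<lambda>d. \<Sum>b\<in>B. \<kappa> b d * x b) D"
  using B eq
proof (induction B rule: finite_induct)
  case empty
  then show ?case using D by (simp add: int_combination_zero) (simp add: int_combination_def)
next
  case (insert c B)
  have "c [^] (m c * x c) = int_combination G (\<kappa> c) D [^] x c"
    using insert.prems by (simp add: int_pow_pow flip: insert.prems(2))
  also have "\<dots> = int_combination G (\<lambda>d. \<kappa> c d * x c) D"
    using D by (simp add: int_combination_scale mult.commute)
  finally have c: "c [^] (m c * x c) = int_combination G (\<lambda>d. \<kappa> c d * x c) D" .
  have "int_combination G (\<lambda>b. m b * x b) (insert c B) = c [^] (m c * x c) \<otimes> int_combination G (\<lambda>b. m b * x b) B"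
    using insert by (intro int_combination_insert) auto
  also have "\<dots> = int_combination G (\<lambda>d. \<kappa> c d * x c + (\<Sum>b\<in>B. \<kappa> b d * x b)) D"
    using insert D by (simp add: c int_combination_add)
  finally show ?case using insert.hyps by simp
qed

text \<open>
  Were \<open>B\<close> larger than \<open>D\<close>, the homogeneous linear system for a relation
  between the elements of \<open>B\<close> would have more unknowns than equations.
\<close>

lemma independent_card_le_spanning:
  assumes D: "finite D" "D \<subseteq> carrier G"
    and span: "\<And>b. b \<in> B \<Longrightarrow> \<exists>m k. m \<noteq> (0::int) \<and> b [^] m = int_combination G k D"
    and B: "int_independent G B"
  shows "card B \<le> card D"
proof (rule ccontr)
  assume "\<not> card B \<le> card D"
  then have less: "card D < card B" by simp
  have B': "finite B" "B \<subseteq> carrier G" "\<And>k. int_combination G k B = \<one> \<Longrightarrow> \<forall>b\<in>B. k b = 0"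
    using B unfolding int_independent_def int_combination_def by blast+
  define m where "m b = (SOME m. m \<noteq> (0::int) \<and> (\<exists>k. b [^] m = int_combination G k D))" for b
  define \<kappa> where "\<kappa> b = (SOME k. b [^] m b = int_combination G k D)" for b
  have m_ex: "m b \<noteq> 0 \<and> (\<exists>k. b [^] m b = int_combination G k D)" if "b \<in> B" for b
    unfolding m_def by (rule someI_ex) (use span[OF that] in blast)
  have m: "m b \<noteq> 0" "b [^] m b = int_combination G (\<kappa> b) D" if "b \<in> B" for b
  proof -
    show "m b \<noteq> 0" using m_ex[OF that] by blast
    show "b [^] m b = int_combination G (\<kappa> b) D"
      unfolding \<kappa>_def by (rule someI_ex[OF conjunct2[OF m_ex[OF that]]])
  qed
  obtain x where x: "\<exists>b\<in>B. x b \<noteq> 0" "\<forall>d\<in>D. (\<Sum>b\<in>B. \<kappa> b d * x b) = (0::int)"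
    using homogeneous_system_nontrivial_solution[OF D(1) B'(1) less, of "\<lambda>d b. \<kappa> b d"] by blast
  have "int_combination G (\<lambda>b. m b * x b) B = int_combination G (\<lambda>d. \<Sum>b\<in>B. \<kappa> b d * x b) D"
    by (rule int_combination_of_combinations[OF D B'(1,2) m(2)])
  also have "\<dots> = int_combination G (\<lambda>_. 0) D" using D x(2) by (intro int_combination_cong) auto
  finally have "\<forall>b\<in>B. m b * x b = 0" by (intro B'(3)) (simp add: int_combination_zero)
  then show False using x(1) m(1) by auto
qed

lemma independent_card_le_rank:
  assumes "has_rank_on G S n" "int_independent G B" "B \<subseteq> S"
  shows "card B \<le> n"
proof -
  obtain D where D: "D \<subseteq> S" "int_independent G D" "card D = n"
    "\<forall>x\<in>S. \<exists>m k. m \<noteq> (0::int) \<and> x [^] m = int_combination G k D"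
    by (rule has_rank_onE[OF assms(1)]) (rule that; assumption)
  have "card B \<le> card D"
  proof (rule independent_card_le_spanning)
    show "finite D" "D \<subseteq> carrier G" using D(2) by (auto simp: int_independent_def)
    show "\<exists>m k. m \<noteq> (0::int) \<and> b [^] m = int_combination G k D" if "b \<in> B" for b
      by (rule bspec[OF D(4)]) (use that assms(3) in blast)
  qed (rule assms(2))
  then show ?thesis using D(3) by simp
qed

lemma has_rank_on_unique:
  assumes "has_rank_on G S n" "has_rank_on G S m"
  shows "n = m"
proof -
  have "a \<le> b" if a: "has_rank_on G S a" and b: "has_rank_on G S b" for a b
  proof -
    obtain B where B: "B \<subseteq> S" "int_independent G B" "card B = a"
      by (rule has_rank_onE[OF a]) (rule that; assumption)
    show ?thesis using independent_card_le_rank[OF b B(2,1)] B(3) by simp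
  qed
  then show ?thesis using assms by (simp add: order_antisym)
qed

lemma abelian_rank_eq:
  assumes "has_rank_on G (carrier G) n"
  shows "abelian_rank G = n"
  unfolding abelian_rank_def
proof (rule cSup_eq_maximum)
  obtain B where "int_independent G B" "card B = n"
    by (rule has_rank_onE[OF assms]) (rule that; assumption)
  then show "n \<in> {card B |B. int_independent G B}" by (intro CollectI exI[of _ B]) simp
  show "x \<le> n" if "x \<in> {card B |B. int_independent G B}" for x
    using that independent_card_le_rank[OF assms] by (auto simp: int_independent_def)
qed

text \<open>
  An independent subset of \<open>S\<close> of maximal size spans \<open>S\<close> up to multiples,
  and the rank of the group bounds the sizes.
\<close>

lemma has_rank_on_subset:
  assumes rank: "has_rank_on G (carrier G) n" and S: "S \<subseteq> carrier G"
  shows "\<exists>k. has_rank_on G S k"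
proof -
  let ?P = "\<lambda>B. B \<subseteq> S \<and> int_independent G B"
  have "?P {}" by (simp add: int_independent_def)
  moreover have "\<forall>B. ?P B \<longrightarrow> card B < Suc n"
    using independent_card_le_rank[OF rank] by (auto simp: int_independent_def less_Suc_eq_le)
  ultimately obtain B where B: "?P B" "\<And>B'. ?P B' \<Longrightarrow> card B' \<le> card B"
    using ex_has_greatest_nat[of ?P "{}" card "Suc n"] by blast
  have B': "finite B" "B \<subseteq> carrier G" "\<And>k. int_combination G k B = \<one> \<Longrightarrow> \<forall>b\<in>B. k b = 0"
    using B(1) unfolding int_independent_def int_combination_def by blast+
  have "\<exists>m k. m \<noteq> (0::int) \<and> x [^] m = int_combination G k B" if x: "x \<in> S" for x
  proof (cases "x \<in> B")
    case True
    have "x [^] (1::int) = int_combination G (\<lambda>b. if b = x then 1 else 0) B"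
      by (rule int_combination_single[OF B'(1,2) True, symmetric])
    then show ?thesis by (intro exI[of _ 1] exI[of _ "\<lambda>b. if b = x then 1 else 0"]) simp
  next
    case False
    have xB: "insert x B \<subseteq> carrier G" "finite (insert x B)" using x S B' by auto
    have "\<not> int_independent G (insert x B)"
      using B(2)[of "insert x B"] B(1) x False B'(1) by auto
    then obtain k where k: "int_combination G k (insert x B) = \<one>" "\<exists>b\<in>insert x B. k b \<noteq> 0"
      using xB unfolding int_independent_def int_combination_def by blast
    have ins: "x [^] k x \<otimes> int_combination G k B = \<one>"
      using k(1) int_combination_insert[OF B'(1) xB(1) False] by simp
    have "k x \<noteq> 0"
    proof
      assume "k x = 0"
      then have "int_combination G k B = \<one>" using ins B'(2) by simp
      then show False using B'(3) k(2) \<open>k x = 0\<close> by blast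
    qed
    have "x [^] k x = inv (int_combination G k B)"
      using ins xB(1) B'(2) by (intro inv_equality[symmetric]) auto
    also have "\<dots> = int_combination G k B [^] (-1 :: int)"
      using B'(2) by (simp add: int_pow_neg)
    also have "\<dots> = int_combination G (\<lambda>b. (-1) * k b) B"
      by (rule int_combination_scale[OF B'(1,2)])
    finally have "x [^] k x = int_combination G (\<lambda>b. (-1) * k b) B" .
    with \<open>k x \<noteq> 0\<close> show ?thesis
      by (intro exI[of _ "k x"] exI[of _ "\<lambda>b. (-1) * k b"] conjI)
  qed
  then have "has_rank_on G S (card B)" using B(1) by (intro has_rank_onI[of B]) simp_all
  then show ?thesis by (rule exI)
qed

lemma has_rank_on_trivial: "has_rank_on G {\<one>} 0"
  unfolding has_rank_on_def
proof (intro exI[of _ "{}"] conjI ballI)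
  show "int_independent G {}" by (simp add: int_independent_def)
  fix x assume "x \<in> {\<one>}"
  then have "x [^] (1::int) = int_combination G (\<lambda>_. 0) {}" by (simp add: int_combination_def)
  then show "\<exists>m k. m \<noteq> (0::int) \<and> x [^] m = int_combination G k {}"
    by (intro exI[of _ 1] exI[of _ "\<lambda>_. 0"]) simp
qed simp_all

end

lemma hom_int_combination:
  assumes "comm_group G" "comm_group H" "f \<in> hom G H" "finite B" "B \<subseteq> carrier G"
  shows "f (int_combination G k B) = finprod H (\<lambda>b. f b [^]\<^bsub>H\<^esub> k b) B"
proof -
  interpret G: comm_group G by fact
  interpret H: comm_group H by fact
  interpret f: group_hom G H f by unfold_locales (rule assms(3))
  show ?thesis using assms(4,5)
  proof (induction B rule: finite_induct)
    case empty
    then show ?case by (simp add: int_combination_def)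
  next
    case (insert x B)
    then have "f (int_combination G k (insert x B)) = f (x [^]\<^bsub>G\<^esub> k x) \<otimes>\<^bsub>H\<^esub> f (int_combination G k B)"
      by (subst G.int_combination_insert) auto
    also have "\<dots> = f x [^]\<^bsub>H\<^esub> k x \<otimes>\<^bsub>H\<^esub> finprod H (\<lambda>b. f b [^]\<^bsub>H\<^esub> k b) B"
      using insert.IH insert.prems by (simp add: f.hom_int_pow)
    also have "\<dots> = finprod H (\<lambda>b. f b [^]\<^bsub>H\<^esub> k b) (insert x B)"
      by (rule H.finprod_insert[symmetric]) (use insert.hyps insert.prems in auto)
    finally show ?case .
  qed
qed

text \<open>
  The rank theorem: a maximal independent subset of the kernel together with preimages of one of the
  image.
\<close>

theorem has_rank_on_exact:
  assumes G: "comm_group G" and H: "comm_group H" and f: "f \<in> hom G H"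
    and K: "has_rank_on G (kernel G H f) k" and I: "has_rank_on H (f ` carrier G) h"
  shows "has_rank_on G (carrier G) (k + h)"
proof -
  interpret G: comm_group G by fact
  interpret H: comm_group H by fact
  interpret f: group_hom G H f by unfold_locales (rule f)
  obtain B where B: "B \<subseteq> kernel G H f" "int_independent G B" "card B = k"
    "\<forall>x\<in>kernel G H f. \<exists>m k. m \<noteq> (0::int) \<and> x [^]\<^bsub>G\<^esub> m = int_combination G k B"
    by (rule has_rank_onE[OF K]) (rule that; assumption)
  obtain C where C: "C \<subseteq> f ` carrier G" "int_independent H C" "card C = h"
    "\<forall>x\<in>f ` carrier G. \<exists>m k. m \<noteq> (0::int) \<and> x [^]\<^bsub>H\<^esub> m = int_combination H k C"
    by (rule has_rank_onE[OF I]) (rule that; assumption)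
  have B': "finite B" "B \<subseteq> carrier G" "\<And>k. int_combination G k B = \<one>\<^bsub>G\<^esub> \<Longrightarrow> \<forall>b\<in>B. k b = 0"
    using B(2) unfolding int_independent_def int_combination_def by blast+
  have C': "finite C" "C \<subseteq> carrier H" "\<And>k. int_combination H k C = \<one>\<^bsub>H\<^esub> \<Longrightarrow> \<forall>b\<in>C. k b = 0"
    using C(2) unfolding int_independent_def int_combination_def by blast+
  have "\<forall>c\<in>C. \<exists>x. x \<in> carrier G \<and> f x = c" using C(1) by blast
  then obtain l where l: "\<And>c. c \<in> C \<Longrightarrow> l c \<in> carrier G" "\<And>c. c \<in> C \<Longrightarrow> f (l c) = c" by metis
  define L where "L = l ` C"
  have inj: "inj_on l C" by (rule inj_onI) (metis l(2))
  have L: "finite L" "L \<subseteq> carrier G" "card L = h" using C'(1) l(1) C(3) inj by (auto simp: L_def card_image)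
  have fB: "f b = \<one>\<^bsub>H\<^esub>" if "b \<in> B" for b using B(1) that by (auto simp: kernel_def)
  have "\<one>\<^bsub>H\<^esub> \<notin> C"
  proof
    assume 1: "\<one>\<^bsub>H\<^esub> \<in> C"
    have "int_combination H (\<lambda>b. if b = \<one>\<^bsub>H\<^esub> then 1 else 0) C = \<one>\<^bsub>H\<^esub>"
      using H.int_combination_single[OF C'(1,2) 1, of 1] by simp
    then show False using C'(3)[of "\<lambda>b. if b = \<one>\<^bsub>H\<^esub> then 1 else 0"] 1 by auto
  qed
  then have disj: "B \<inter> L = {}" using fB l(2) by (force simp: L_def)
  have fcombL: "f (int_combination G \<kappa> L) = int_combination H (\<lambda>c. \<kappa> (l c)) C" for \<kappa>
  proof -
    have "f (int_combination G \<kappa> L) = finprod H (\<lambda>b. f b [^]\<^bsub>H\<^esub> \<kappa> b) (l ` C)"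
      unfolding L_def[symmetric] by (rule hom_int_combination[OF G H f L(1,2)])
    also have "\<dots> = finprod H (\<lambda>c. f (l c) [^]\<^bsub>H\<^esub> \<kappa> (l c)) C"
      by (rule H.finprod_reindex) (use l(1) inj in auto)
    also have "\<dots> = int_combination H (\<lambda>c. \<kappa> (l c)) C"
      unfolding int_combination_def using l(2) C'(2) by (intro H.finprod_cong') auto
    finally show ?thesis .
  qed
  have fcombB: "f (int_combination G \<kappa> B) = \<one>\<^bsub>H\<^esub>" for \<kappa>
    unfolding hom_int_combination[OF G H f B'(1,2)] by (rule H.finprod_one_eqI) (simp add: fB)
  have Un: "int_combination G \<kappa> (B \<union> L) = int_combination G \<kappa> B \<otimes>\<^bsub>G\<^esub> int_combination G \<kappa> L" for \<kappa>
    by (rule G.int_combination_Un[OF B'(1) L(1) disj B'(2) L(2)])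
  have indep: "\<forall>b\<in>B \<union> L. \<kappa> b = 0" if \<kappa>: "int_combination G \<kappa> (B \<union> L) = \<one>\<^bsub>G\<^esub>" for \<kappa>
  proof -
    have "f (int_combination G \<kappa> B \<otimes>\<^bsub>G\<^esub> int_combination G \<kappa> L) = \<one>\<^bsub>H\<^esub>"
      using \<kappa> unfolding Un by simp
    then have "int_combination H (\<lambda>c. \<kappa> (l c)) C = \<one>\<^bsub>H\<^esub>"
      using B'(2) L(2) C'(2) by (simp add: fcombB fcombL)
    then have 0: "\<forall>c\<in>C. \<kappa> (l c) = 0" by (rule C'(3))
    then have "int_combination G \<kappa> L = int_combination G (\<lambda>_. 0) L"
      using L(2) by (intro G.int_combination_cong) (auto simp: L_def)
    then have "int_combination G \<kappa> B = \<one>\<^bsub>G\<^esub>"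
      using \<kappa> B'(2) unfolding Un by (simp add: G.int_combination_zero)
    then show ?thesis using B'(3) 0 by (auto simp: L_def)
  qed
  have span: "\<exists>m \<kappa>. m \<noteq> (0::int) \<and> x [^]\<^bsub>G\<^esub> m = int_combination G \<kappa> (B \<union> L)" if x: "x \<in> carrier G" for x
  proof -
    obtain n \<kappa> where n_conj: "n \<noteq> (0::int) \<and> f x [^]\<^bsub>H\<^esub> n = int_combination H \<kappa> C"
      using bspec[OF C(4) imageI[OF x]] by blast
    note n = conjunct1[OF n_conj] conjunct2[OF n_conj]
    define z where "z = int_combination G (\<kappa> \<circ> f) L"
    have z: "z \<in> carrier G" using L(2) by (simp add: z_def)
    have fz: "f z = f x [^]\<^bsub>H\<^esub> n"
      unfolding z_def fcombL n(2) using C'(2) l(2) by (intro H.int_combination_cong) auto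
    define y where "y = x [^]\<^bsub>G\<^esub> n \<otimes>\<^bsub>G\<^esub> inv\<^bsub>G\<^esub> z"
    have "y \<in> kernel G H f"
      using x z fz by (simp add: y_def kernel_def f.hom_int_pow)
    from bspec[OF B(4) this] obtain m \<mu>
      where m_conj: "m \<noteq> (0::int) \<and> y [^]\<^bsub>G\<^esub> m = int_combination G \<mu> B" by blast
    note m = conjunct1[OF m_conj] conjunct2[OF m_conj]
    have "x [^]\<^bsub>G\<^esub> n = y \<otimes>\<^bsub>G\<^esub> z" using x z by (simp add: y_def G.m_assoc)
    then have "x [^]\<^bsub>G\<^esub> (n * m) = (y \<otimes>\<^bsub>G\<^esub> z) [^]\<^bsub>G\<^esub> m" using x by (simp flip: G.int_pow_pow)
    also have "\<dots> = y [^]\<^bsub>G\<^esub> m \<otimes>\<^bsub>G\<^esub> z [^]\<^bsub>G\<^esub> m" using x z by (simp add: G.int_pow_distrib y_def)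
    also have "z [^]\<^bsub>G\<^esub> m = int_combination G (\<lambda>b. m * (\<kappa> \<circ> f) b) L"
      unfolding z_def by (rule G.int_combination_scale[OF L(1,2)])
    also have "y [^]\<^bsub>G\<^esub> m = int_combination G (\<lambda>b. if b \<in> B then \<mu> b else m * (\<kappa> \<circ> f) b) B"
      unfolding m(2) using B'(2) by (intro G.int_combination_cong) auto
    also have "int_combination G (\<lambda>b. m * (\<kappa> \<circ> f) b) L = int_combination G (\<lambda>b. if b \<in> B then \<mu> b else m * (\<kappa> \<circ> f) b) L"
      using L(2) disj by (intro G.int_combination_cong) auto
    finally have "x [^]\<^bsub>G\<^esub> (n * m) = int_combination G (\<lambda>b. if b \<in> B then \<mu> b else m * (\<kappa> \<circ> f) b) (B \<union> L)"
      unfolding Un .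
    then have "n * m \<noteq> 0 \<and> x [^]\<^bsub>G\<^esub> (n * m) = int_combination G (\<lambda>b. if b \<in> B then \<mu> b else m * (\<kappa> \<circ> f) b) (B \<union> L)"
      using n(1) m(1) by simp
    then show ?thesis by (intro exI)
  qed
  have ind: "int_independent G (B \<union> L)"
    unfolding int_independent_def int_combination_def[symmetric] using B'(1,2) L(1,2) indep by simp
  have card: "card (B \<union> L) = k + h" using card_Un_disjoint[OF B'(1) L(1) disj] B(3) L(3) by simp
  have sub: "B \<union> L \<subseteq> carrier G" using B'(2) L(2) by blast
  show ?thesis
  proof (rule has_rank_onI)
    show "B \<union> L \<subseteq> carrier G" by (rule sub)
    show "int_independent G (B \<union> L)" by (rule ind)
    show "card (B \<union> L) = k + h" by (rule card)
  qed (rule span)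
qed

corollary has_rank_on_inj:
  assumes "comm_group G" "comm_group H" "f \<in> hom G H" "inj_on f (carrier G)" "has_rank_on H (f ` carrier G) h"
  shows "has_rank_on G (carrier G) h"
proof -
  interpret G: comm_group G by fact
  interpret H: comm_group H by fact
  interpret f: group_hom G H f by unfold_locales (rule assms(3))
  have "kernel G H f = {\<one>\<^bsub>G\<^esub>}"
    using assms(4) f.inj_iff_trivial_ker by blast
  then have "has_rank_on G (kernel G H f) 0" using G.has_rank_on_trivial by simp
  from has_rank_on_exact[OF assms(1-3) this assms(5)] show ?thesis by simp
qed

corollary has_rank_on_iso:
  assumes "comm_group G" "comm_group H" "G \<cong> H" "has_rank_on H (carrier H) h"
  shows "has_rank_on G (carrier G) h"
proof -
  obtain f where "f \<in> iso G H" using assms(3) unfolding is_iso_def by blast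
  then have "f \<in> hom G H" "inj_on f (carrier G)" "f ` carrier G = carrier H"
    by (auto simp: iso_def bij_betw_def)
  then show ?thesis using has_rank_on_inj[OF assms(1,2)] assms(4) by metis
qed

text \<open>The generators are independent because coefficients can be compared, and they span.\<close>

lemma has_rank_on_free_Abelian_group:
  assumes "finite S"
  shows "has_rank_on (free_Abelian_group S) (carrier (free_Abelian_group S)) (card S)"
proof -
  let ?F = "free_Abelian_group S"
  interpret F: comm_group ?F by (rule abelian_free_Abelian_group)
  have frag_inj: "s = t" if "frag_of s = frag_of t" for s t :: 'a
  proof -
    have "Poly_Mapping.keys (frag_of s) = Poly_Mapping.keys (frag_of t)" using that by simp
    then show ?thesis by simp
  qed
  have comb: "int_combination ?F \<kappa> (frag_of ` A) = (\<Sum>s\<in>A. frag_cmul (\<kappa> (frag_of s)) (frag_of s))"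
    if "A \<subseteq> S" for A \<kappa>
  proof -
    have "finite A" using that assms finite_subset by blast
    then show ?thesis using that
    proof (induction A rule: finite_induct)
      case empty
      then show ?case by (simp add: int_combination_def)
    next
      case (insert s A)
      have "frag_of s \<notin> frag_of ` A"
      proof
        assume "frag_of s \<in> frag_of ` A"
        then obtain c where "c \<in> A" "frag_of s = frag_of c" by blast
        then show False using insert.hyps(2) frag_inj by blast
      qed
      moreover have "insert (frag_of s) (frag_of ` A) \<subseteq> carrier ?F" using insert.prems by auto
      ultimately have "int_combination ?F \<kappa> (insert (frag_of s) (frag_of ` A)) =
          frag_of s [^]\<^bsub>?F\<^esub> \<kappa> (frag_of s) \<otimes>\<^bsub>?F\<^esub> int_combination ?F \<kappa> (frag_of ` A)"
        using insert.hyps by (intro F.int_combination_insert) auto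
      then show ?case using insert by simp
    qed
  qed
  have inj: "inj_on frag_of S" by (rule inj_onI) (rule frag_inj)
  have sub: "frag_of ` S \<subseteq> carrier ?F" by auto
  have lookup: "Poly_Mapping.lookup (\<Sum>s\<in>S. frag_cmul (\<kappa> (frag_of s)) (frag_of s)) t = \<kappa> (frag_of t)"
    if "t \<in> S" for \<kappa> t
  proof -
    have "Poly_Mapping.lookup (\<Sum>s\<in>S. frag_cmul (\<kappa> (frag_of s)) (frag_of s)) t
        = (\<Sum>s\<in>S. if s = t then \<kappa> (frag_of s) else 0)"
      unfolding lookup_sum by (intro sum.cong) (auto simp: lookup_single when_def)
    then show ?thesis using assms that by simp
  qed
  have ind: "int_independent ?F (frag_of ` S)"
    unfolding int_independent_def int_combination_def[symmetric]
  proof (intro conjI allI impI ballI)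
    fix \<kappa> b assume 0: "int_combination ?F \<kappa> (frag_of ` S) = \<one>\<^bsub>?F\<^esub>" and "b \<in> frag_of ` S"
    then obtain t where t: "t \<in> S" "b = frag_of t" by blast
    have "(\<Sum>s\<in>S. frag_cmul (\<kappa> (frag_of s)) (frag_of s)) = 0" using 0 comb[OF subset_refl] by simp
    then show "\<kappa> b = 0" using lookup[OF t(1), of \<kappa>] t(2) by simp
  qed (use assms sub in auto)
  have span: "\<exists>m \<kappa>. m \<noteq> (0::int) \<and> x [^]\<^bsub>?F\<^esub> m = int_combination ?F \<kappa> (frag_of ` S)"
    if x: "x \<in> carrier ?F" for x
  proof -
    define \<kappa> where "\<kappa> b = Poly_Mapping.lookup x (the_inv_into S frag_of b)" for b
    have \<kappa>: "\<kappa> (frag_of s) = Poly_Mapping.lookup x s" if "s \<in> S" for s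
      unfolding \<kappa>_def using the_inv_into_f_f[OF inj that] by simp
    have "(\<Sum>s\<in>S. frag_cmul (\<kappa> (frag_of s)) (frag_of s)) = x"
    proof (rule poly_mapping_eqI)
      fix t
      show "Poly_Mapping.lookup (\<Sum>s\<in>S. frag_cmul (\<kappa> (frag_of s)) (frag_of s)) t = Poly_Mapping.lookup x t"
      proof (cases "t \<in> S")
        case True
        show ?thesis by (rule trans[OF lookup[OF True, of \<kappa>] \<kappa>[OF True]])
      next
        case False
        then have "Poly_Mapping.lookup x t = 0" using x by (auto simp: in_keys_iff)
        moreover have "Poly_Mapping.lookup (\<Sum>s\<in>S. frag_cmul (\<kappa> (frag_of s)) (frag_of s)) t = 0"
          unfolding lookup_sum using False by (intro sum.neutral) (auto simp: lookup_single when_def)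
        ultimately show ?thesis by simp
      qed
    qed
    then show ?thesis using comb[OF subset_refl, of \<kappa>] x by (intro exI[of _ 1] exI[of _ \<kappa>]) simp
  qed
  show ?thesis
  proof (rule has_rank_onI)
    show "frag_of ` S \<subseteq> carrier ?F" by (rule sub)
    show "int_independent ?F (frag_of ` S)" by (rule ind)
    show "card (frag_of ` S) = card S" by (rule card_image[OF inj])
  qed (rule span)
qed

section \<open>Homology of spaces with finitely many path components\<close>

text \<open>
  A decomposition of a space into finitely many nonempty open pieces. Since it carries the relevant
  homotopical information only if the pieces are path connected, this is assumed where it is needed.
\<close>

locale open_partition =
  fixes X :: "'a topology" and \<C> :: "'a set set"
  assumes disj: "pairwise disjnt \<C>" and cover: "\<Union>\<C> = topspace X"
    and opens: "\<And>C. C \<in> \<C> \<Longrightarrow> openin X C" and nonempty: "\<And>C. C \<in> \<C> \<Longrightarrow> C \<noteq> {}"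
    and fin: "finite \<C>"
begin

lemma closed_part: "C \<in> \<C> \<Longrightarrow> closedin X C"
proof -
  assume C: "C \<in> \<C>"
  have "topspace X - C = \<Union>(\<C> - {C})"
    using disj C unfolding cover[symmetric] pairwise_def disjnt_def by blast
  then have "openin X (topspace X - C)" using opens by auto
  then show "closedin X C" using openin_subset[OF opens[OF C]] by (simp add: closedin_def)
qed

lemma connected_in_part:
  assumes "connectedin X S" "C \<in> \<C>" "S \<inter> C \<noteq> {}"
  shows "S \<subseteq> C"
  using connectedin_clopen_cases[OF assms(1) closed_part[OF assms(2)] opens[OF assms(2)]] assms(3)
  by (auto simp: disjnt_def)

lemma path_components_eq:
  assumes pc: "\<And>C. C \<in> \<C> \<Longrightarrow> path_connectedin X C"
  shows "path_components_of X = \<C>"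
proof -
  have eq: "path_component_of_set X x = C" if C: "C \<in> \<C>" "x \<in> C" for x C
  proof
    show "C \<subseteq> path_component_of_set X x" by (rule path_component_of_maximal[OF pc[OF C(1)] C(2)])
    have "x \<in> topspace X" using C cover by blast
    then have "path_connectedin X (path_component_of_set X x)" "x \<in> path_component_of_set X x"
      by (simp_all add: path_connectedin_path_component_of path_component_of_refl)
    then show "path_component_of_set X x \<subseteq> C"
      using connected_in_part[OF path_connectedin_imp_connectedin C(1)] C(2) by blast
  qed
  show ?thesis
  proof (intro equalityI subsetI)
    fix D assume "D \<in> path_components_of X"
    then obtain x where x: "x \<in> topspace X" "D = path_component_of_set X x"
      unfolding path_components_of_def by blast
    then obtain C where "C \<in> \<C>" "x \<in> C" using cover by blast
    then show "D \<in> \<C>" using eq x(2) by simp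
  next
    fix C assume C: "C \<in> \<C>"
    then obtain x where x: "x \<in> C" using nonempty by blast
    then have "x \<in> topspace X" using C cover by blast
    then show "C \<in> path_components_of X" using eq[OF C x] unfolding path_components_of_def by blast
  qed
qed

lemma zeroth_homology_rank:
  assumes "\<And>C. C \<in> \<C> \<Longrightarrow> path_connectedin X C"
  shows "has_rank_on (homology_group 0 X) (carrier (homology_group 0 X)) (card \<C>)"
proof (rule has_rank_on_iso[OF _ abelian_free_Abelian_group])
  show "homology_group 0 X \<cong> free_Abelian_group \<C>"
    using zeroth_homology_group[of X] path_components_eq[OF assms] by simp
  show "has_rank_on (free_Abelian_group \<C>) (carrier (free_Abelian_group \<C>)) (card \<C>)"
    by (rule has_rank_on_free_Abelian_group[OF fin])
qed simp

text \<open>Homology is additive over disjoint open pieces.\<close>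

lemma trivial_homology:
  assumes triv: "\<And>C. C \<in> \<C> \<Longrightarrow> trivial_group (homology_group p (subtopology X C))"
  shows "trivial_group (homology_group p X)"
proof -
  let ?S = "sum_group \<C> (\<lambda>C. homology_group p (subtopology X C))"
  have iso: "(\<lambda>x. gfinprod (homology_group p X)
       (\<lambda>V. hom_induced p (subtopology X V) {} X {} id (x V)) \<C>) \<in> iso ?S (homology_group p X)"
    by (rule homology_additivity_axiom[OF disj cover opens])
  have "carrier ?S \<subseteq> {\<one>\<^bsub>?S\<^esub>}"
  proof
    fix x assume x: "x \<in> carrier ?S"
    have "x \<in> (\<Pi>\<^sub>E C\<in>\<C>. carrier (homology_group p (subtopology X C)))"
      using x by (simp add: carrier_sum_group)
    then have "x = (\<lambda>C\<in>\<C>. \<one>\<^bsub>homology_group p (subtopology X C)\<^esub>)"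
      using triv unfolding trivial_group_def by (intro ext) (auto simp: PiE_iff extensional_def)
    then show "x \<in> {\<one>\<^bsub>?S\<^esub>}" by simp
  qed
  moreover have grp: "group ?S" by simp
  ultimately have "trivial_group ?S"
    using group.is_monoid monoid.one_closed unfolding trivial_group_def by blast
  then show ?thesis
    using isomorphic_group_triviality[OF is_isoI[OF iso] grp] by simp
qed

text \<open>Mapping each piece to its representative is continuous because the pieces are open.\<close>

lemma representatives_retract:
  assumes p: "\<And>C. C \<in> \<C> \<Longrightarrow> p C \<in> C"
  shows "(p ` \<C>) retract_of_space X"
proof -
  define part where "part x = (THE C. C \<in> \<C> \<and> x \<in> C)" for x
  have part: "part x = C" if C: "C \<in> \<C>" and x: "x \<in> C" for x C
    unfolding part_def
  proof (rule the_equality)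
    show "C \<in> \<C> \<and> x \<in> C" using C x by (rule conjI)
    fix D assume D: "D \<in> \<C> \<and> x \<in> D"
    show "D = C"
    proof (rule ccontr)
      assume "D \<noteq> C"
      from pairwiseD[OF disj conjunct1[OF D] C this] have "D \<inter> C = {}" by (simp only: disjnt_def)
      moreover have "x \<in> D \<inter> C" using D x by (intro IntI) (rule conjunct2)
      ultimately show False by (simp only: empty_iff)
    qed
  qed
  have pt: "\<exists>C\<in>\<C>. x \<in> C \<and> (p \<circ> part) x = p C" if "x \<in> topspace X" for x
  proof -
    have "x \<in> \<Union>\<C>" unfolding cover by (rule that)
    then obtain C where C: "C \<in> \<C>" "x \<in> C" by (rule UnionE)
    have "(p \<circ> part) x = p C" using part[OF C] by simp
    then show ?thesis using C by (intro bexI[of _ C] conjI)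
  qed
  have into: "p C \<in> topspace X" if "C \<in> \<C>" for C
    unfolding cover[symmetric] using that p[OF that] by (rule UnionI)
  have "continuous_map X (subtopology X (p ` \<C>)) (p \<circ> part)"
    unfolding continuous_map_in_subtopology
  proof
    show "continuous_map X X (p \<circ> part)"
      unfolding continuous_map
    proof (intro conjI allI impI)
      show "(p \<circ> part) ` topspace X \<subseteq> topspace X"
      proof
        fix y assume "y \<in> (p \<circ> part) ` topspace X"
        then obtain x where "x \<in> topspace X" "y = (p \<circ> part) x" by blast
        then show "y \<in> topspace X" using pt[of x] into by metis
      qed
      fix U assume "openin X U"
      have "{x \<in> topspace X. (p \<circ> part) x \<in> U} = \<Union>{C \<in> \<C>. p C \<in> U}"
      proof (intro equalityI subsetI)
        fix x assume "x \<in> {x \<in> topspace X. (p \<circ> part) x \<in> U}"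
        then have x: "x \<in> topspace X" "(p \<circ> part) x \<in> U" by simp_all
        from pt[OF x(1)] obtain C where "C \<in> \<C>" "x \<in> C" "(p \<circ> part) x = p C" by blast
        then show "x \<in> \<Union>{C \<in> \<C>. p C \<in> U}" using x(2) by auto
      next
        fix x assume "x \<in> \<Union>{C \<in> \<C>. p C \<in> U}"
        then obtain C where C: "C \<in> \<C>" "p C \<in> U" "x \<in> C" by blast
        have "x \<in> topspace X" using C(1,3) cover by blast
        then show "x \<in> {x \<in> topspace X. (p \<circ> part) x \<in> U}" using part[OF C(1,3)] C(2) by simp
      qed
      then show "openin X {x \<in> topspace X. (p \<circ> part) x \<in> U}" using opens by auto
    qed
    show "(p \<circ> part) \<in> topspace X \<rightarrow> p ` \<C>"
    proof
      fix x assume "x \<in> topspace X"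
      from pt[OF this] obtain C where "C \<in> \<C>" "(p \<circ> part) x = p C" by blast
      then show "(p \<circ> part) x \<in> p ` \<C>" by simp
    qed
  qed
  moreover have "(p \<circ> part) y = y" if y: "y \<in> p ` \<C>" for y
  proof -
    obtain C where C: "C \<in> \<C>" "y = p C" using y by blast
    then have "part y = C" using part[OF C(1)] p[OF C(1)] by simp
    then show ?thesis using C(2) by simp
  qed
  moreover have "p ` \<C> \<subseteq> topspace X" using p cover by blast
  ultimately show ?thesis unfolding retract_of_space_def by blast
qed

text \<open>
  The map in question is onto up to rank: choosing a point of \<open>A\<close> in each piece gives a
  retract of \<open>X\<close> whose homology injects into that of \<open>X\<close> and has the full
  rank.
\<close>

lemma rank_of_zeroth_homology_image:
  assumes pc: "\<And>C. C \<in> \<C> \<Longrightarrow> path_connectedin X C"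
    and A: "A \<subseteq> topspace X" "\<And>C. C \<in> \<C> \<Longrightarrow> C \<inter> A \<noteq> {}"
  defines "i \<equiv> hom_induced 0 (subtopology X A) {} X {} id"
  shows "has_rank_on (homology_group 0 X) (i ` carrier (homology_group 0 (subtopology X A))) (card \<C>)"
proof -
  let ?H = "homology_group 0 X" and ?I = "i ` carrier (homology_group 0 (subtopology X A))"
  interpret H: comm_group ?H by simp
  have i: "i \<in> hom (homology_group 0 (subtopology X A)) ?H" unfolding i_def by (simp add: hom_induced_hom)
  have "\<forall>C\<in>\<C>. \<exists>x. x \<in> C \<inter> A" using A(2) by blast
  then obtain p where p: "\<And>C. C \<in> \<C> \<Longrightarrow> p C \<in> C" "\<And>C. C \<in> \<C> \<Longrightarrow> p C \<in> A" by (metis IntE)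
  define P where "P = p ` \<C>"
  have PA: "P \<subseteq> A" using p(2) by (auto simp: P_def)
  let ?HP = "homology_group 0 (subtopology X P)"
  let ?k = "hom_induced 0 (subtopology X P) {} X {} id"
  have retract: "P retract_of_space X" unfolding P_def by (rule representatives_retract[OF p(1)])
  have inj_k: "inj_on ?k (carrier ?HP)" by (rule inj_on_hom_induced_inclusion) (use retract in blast)
  have k: "?k \<in> hom ?HP ?H" by (simp add: hom_induced_hom)
  interpret HP: comm_group ?HP by simp
  have "?k ` carrier ?HP \<subseteq> ?I"
  proof -
    have c1: "continuous_map (subtopology X P) (subtopology X A) id"
      using PA by (auto simp: continuous_map_in_subtopology)
    have "?k c = i (hom_induced 0 (subtopology X P) {} (subtopology X A) {} id c)" for c
      unfolding i_def using hom_induced_compose'[OF c1, of "{}" "{}" X id "{}" 0 c] by simp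
    then show ?thesis using hom_induced_carrier[of 0 "subtopology X P" "{}" "subtopology X A" "{}" id] by auto
  qed
  have inj_p: "inj_on p \<C>"
  proof (rule inj_onI, rule ccontr)
    fix C D assume "C \<in> \<C>" "D \<in> \<C>" "p C = p D" "C \<noteq> D"
    then show False using pairwiseD[OF disj, of C D] p(1)[of C] p(1)[of D] by (auto simp: disjnt_def)
  qed
  have "discrete": "open_partition (subtopology X P) ((\<lambda>x. {x}) ` P)"
  proof
    show "openin (subtopology X P) C" if C: "C \<in> (\<lambda>x. {x}) ` P" for C
    proof -
      obtain D where D: "D \<in> \<C>" "C = {p D}" using C by (auto simp: P_def)
      have "C = D \<inter> P"
      proof (intro equalityI subsetI)
        fix x assume "x \<in> C"
        then show "x \<in> D \<inter> P" using D p(1)[OF D(1)] by (simp add: P_def)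
      next
        fix x assume x: "x \<in> D \<inter> P"
        then obtain D' where D': "D' \<in> \<C>" "x = p D'" by (auto simp: P_def)
        have "D' = D"
        proof (rule ccontr)
          assume "D' \<noteq> D"
          from pairwiseD[OF disj D'(1) D(1) this] show False
            using x D'(2) p(1)[OF D'(1)] by (auto simp: disjnt_def)
        qed
        then show "x \<in> C" using D(2) D'(2) by simp
      qed
      then show ?thesis using openin_subtopology_Int[OF opens[OF D(1)], of P] by simp
    qed
    show "\<Union> ((\<lambda>x. {x}) ` P) = topspace (subtopology X P)" using PA A(1) by auto
  qed (auto simp: pairwise_def P_def fin)
  then interpret Q: open_partition "subtopology X P" "(\<lambda>x. {x}) ` P" .
  have "has_rank_on ?HP (carrier ?HP) (card ((\<lambda>x. {x}) ` P))"
  proof (rule Q.zeroth_homology_rank)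
    fix C assume "C \<in> (\<lambda>x. {x}) ` P"
    then obtain x where "x \<in> P" "C = {x}" by blast
    then show "path_connectedin (subtopology X P) C" using PA A(1) by (auto simp: path_connectedin_singleton)
  qed
  moreover have "card ((\<lambda>x. {x}) ` P) = card \<C>"
    unfolding P_def using inj_p by (simp add: card_image)
  ultimately have rank_P: "has_rank_on ?HP (carrier ?HP) (card \<C>)" by simp
  obtain B where B: "B \<subseteq> carrier ?HP" "int_independent ?HP B" "card B = card \<C>"
    by (rule has_rank_onE[OF rank_P]) (rule that; assumption)
  have kB: "int_independent ?H (?k ` B)"
    unfolding int_independent_def
  proof (intro conjI allI impI)
    have fB: "finite B" using B(2) by (simp add: int_independent_def)
    then show "finite (?k ` B)" by simp
    show kB_sub: "?k ` B \<subseteq> carrier ?H" using hom_in_carrier[OF k] B(1) by blast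
    fix \<kappa> :: "_ \<Rightarrow> int"
    assume 1: "finprod ?H (\<lambda>b. b [^]\<^bsub>?H\<^esub> \<kappa> b) (?k ` B) = \<one>\<^bsub>?H\<^esub>"
    have "?k (int_combination ?HP (\<kappa> \<circ> ?k) B) = finprod ?H (\<lambda>b. ?k b [^]\<^bsub>?H\<^esub> (\<kappa> \<circ> ?k) b) B"
      by (rule hom_int_combination[OF abelian_homology_group abelian_homology_group k fB B(1)])
    also have "\<dots> = finprod ?H (\<lambda>b. b [^]\<^bsub>?H\<^esub> \<kappa> b) (?k ` B)"
    proof -
      have "(\<lambda>b. b [^]\<^bsub>?H\<^esub> \<kappa> b) \<in> ?k ` B \<rightarrow> carrier ?H"
        using kB_sub H.int_pow_closed by blast
      from H.finprod_reindex[OF this inj_on_subset[OF inj_k B(1)]] show ?thesis by (simp only: o_def)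
    qed
    also have "\<dots> = ?k \<one>\<^bsub>?HP\<^esub>" unfolding 1 by (rule hom_one[OF k HP.is_group H.is_group, symmetric])
    finally have eq: "?k (int_combination ?HP (\<kappa> \<circ> ?k) B) = ?k \<one>\<^bsub>?HP\<^esub>" .
    have "int_combination ?HP (\<kappa> \<circ> ?k) B = \<one>\<^bsub>?HP\<^esub>"
      by (rule inj_onD[OF inj_k eq HP.int_combination_closed[OF B(1)] HP.one_closed])
    then have "\<forall>b\<in>B. (\<kappa> \<circ> ?k) b = 0"
      using B(2) unfolding int_independent_def int_combination_def by blast
    then show "\<forall>b\<in>?k ` B. \<kappa> b = 0" by simp
  qed
  have I_sub: "?I \<subseteq> carrier ?H" using hom_in_carrier[OF i] by blast
  have rank_H: "has_rank_on ?H (carrier ?H) (card \<C>)" by (rule zeroth_homology_rank[OF pc])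
  obtain h where h: "has_rank_on ?H ?I h" using H.has_rank_on_subset[OF rank_H I_sub] by blast
  have "card (?k ` B) = card \<C>" using card_image[OF inj_on_subset[OF inj_k B(1)]] B(3) by simp
  moreover have "?k ` B \<subseteq> ?I" using B(1) \<open>?k ` carrier ?HP \<subseteq> ?I\<close> by blast
  ultimately have "card \<C> \<le> h" using H.independent_card_le_rank[OF h kB] by simp
  moreover have "h \<le> card \<C>"
  proof -
    obtain D where D: "D \<subseteq> ?I" "int_independent ?H D" "card D = h"
      by (rule has_rank_onE[OF h]) (rule that; assumption)
    then show ?thesis using H.independent_card_le_rank[OF rank_H D(2)] I_sub by blast
  qed
  ultimately show ?thesis using h by simp
qed

end

text \<open>
  By exactness the image of the boundary is the kernel of the map induced on zeroth homology by the
  inclusion of \<open>A\<close>, whose source has rank \<open>card \<D>\<close> and whose image has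
  rank \<open>card \<C>\<close>.
\<close>

lemma boundary_rank:
  assumes X: "open_partition X \<C>" and pcX: "\<And>C. C \<in> \<C> \<Longrightarrow> path_connectedin X C"
    and A: "A \<subseteq> topspace X" "\<And>C. C \<in> \<C> \<Longrightarrow> C \<inter> A \<noteq> {}"
    and D: "open_partition (subtopology X A) \<D>" and pcD: "\<And>C. C \<in> \<D> \<Longrightarrow> path_connectedin (subtopology X A) C"
  shows "\<exists>h. has_rank_on (homology_group 0 (subtopology X A))
      (hom_boundary 1 X A ` carrier (relative_homology_group 1 X A)) h \<and> h + card \<C> = card \<D>"
proof -
  interpret X: open_partition X \<C> by fact
  interpret D: open_partition "subtopology X A" \<D> by fact
  let ?HA = "homology_group 0 (subtopology X A)" and ?HX = "homology_group 0 X"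
  let ?i = "hom_induced 0 (subtopology X A) {} X {} id"
  interpret HA: comm_group ?HA by simp
  have i: "?i \<in> hom ?HA ?HX" by (simp add: hom_induced_hom)
  have ker: "kernel ?HA ?HX ?i = hom_boundary 1 X A ` carrier (relative_homology_group 1 X A)"
    using homology_exactness_axiom_2[of 1 X A] by simp
  have rank_A: "has_rank_on ?HA (carrier ?HA) (card \<D>)" by (rule D.zeroth_homology_rank[OF pcD])
  obtain h where h: "has_rank_on ?HA (kernel ?HA ?HX ?i) h"
    using HA.has_rank_on_subset[OF rank_A, of "kernel ?HA ?HX ?i"] by (auto simp: kernel_def)
  have "has_rank_on ?HA (carrier ?HA) (h + card \<C>)"
    by (rule has_rank_on_exact[OF _ _ i h X.rank_of_zeroth_homology_image[OF pcX A]]) simp_all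
  then have "h + card \<C> = card \<D>" using HA.has_rank_on_unique rank_A by blast
  then show ?thesis using h ker by auto
qed

text \<open>If the first homology of \<open>X\<close> vanishes, the boundary map is injective.\<close>

lemma relative_homology_rank:
  assumes h: "has_rank_on (homology_group 0 (subtopology X A))
      (hom_boundary 1 X A ` carrier (relative_homology_group 1 X A)) h"
    and X: "trivial_group (homology_group 1 X)"
  shows "has_rank_on (relative_homology_group 1 X A) (carrier (relative_homology_group 1 X A)) h"
proof -
  let ?R = "relative_homology_group 1 X A" and ?HA = "homology_group 0 (subtopology X A)"
  interpret R: comm_group ?R by simp
  have d: "hom_boundary 1 X A \<in> hom ?R ?HA" using hom_boundary_hom[of 1 X A] by simp
  have j: "hom_induced 1 X {} X A id \<in> hom (homology_group 1 X) ?R" by (simp add: hom_induced_hom)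
  have "kernel ?R ?HA (hom_boundary 1 X A) = hom_induced 1 X {} X A id ` carrier (homology_group 1 X)"
    using homology_exactness_axiom_1[of 1 X A] by simp
  also have "\<dots> = {\<one>\<^bsub>?R\<^esub>}"
    using X hom_one[OF j] unfolding trivial_group_def by simp
  finally have "has_rank_on ?R (kernel ?R ?HA (hom_boundary 1 X A)) 0"
    using R.has_rank_on_trivial by simp
  from has_rank_on_exact[OF _ _ d this h] show ?thesis by simp
qed

text \<open>
  If the first homology of \<open>A\<close> vanishes, that of \<open>X\<close> is the kernel of the
  boundary map.
\<close>

lemma absolute_homology_rank:
  assumes h: "has_rank_on (homology_group 0 (subtopology X A))
      (hom_boundary 1 X A ` carrier (relative_homology_group 1 X A)) h"
    and A: "trivial_group (homology_group 1 (subtopology X A))"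
    and n: "has_rank_on (relative_homology_group 1 X A) (carrier (relative_homology_group 1 X A)) n"
  shows "\<exists>b. has_rank_on (homology_group 1 X) (carrier (homology_group 1 X)) b \<and> n = b + h"
proof -
  let ?R = "relative_homology_group 1 X A" and ?HA = "homology_group 0 (subtopology X A)"
  let ?j = "hom_induced 1 X {} X A id" and ?HX = "homology_group 1 X" and ?i = "hom_induced 1 (subtopology X A) {} X {} id"
  interpret R: comm_group ?R by simp
  interpret HX: comm_group ?HX by simp
  have d: "hom_boundary 1 X A \<in> hom ?R ?HA" using hom_boundary_hom[of 1 X A] by simp
  have j: "?j \<in> hom ?HX ?R" by (simp add: hom_induced_hom)
  have i: "?i \<in> hom (homology_group 1 (subtopology X A)) ?HX" by (simp add: hom_induced_hom)
  interpret j: group_hom ?HX ?R ?j by unfold_locales (rule j)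
  have ker_d: "kernel ?R ?HA (hom_boundary 1 X A) = ?j ` carrier ?HX"
    using homology_exactness_axiom_1[of 1 X A] by simp
  have "kernel ?HX ?R ?j = ?i ` carrier (homology_group 1 (subtopology X A))"
    using homology_exactness_axiom_3[of 1 X A] by simp
  also have "\<dots> = {\<one>\<^bsub>?HX\<^esub>}"
    using A hom_one[OF i] unfolding trivial_group_def by simp
  finally have inj: "inj_on ?j (carrier ?HX)" using j.inj_iff_trivial_ker by blast
  have "?j ` carrier ?HX \<subseteq> carrier ?R" using hom_in_carrier[OF j] by blast
  from R.has_rank_on_subset[OF n this] obtain b where b: "has_rank_on ?R (?j ` carrier ?HX) b" by blast
  have "has_rank_on ?HX (carrier ?HX) b" by (rule has_rank_on_inj[OF _ _ j inj b]) simp_all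
  moreover have "has_rank_on ?R (carrier ?R) (b + h)"
    by (rule has_rank_on_exact[OF _ _ d _ h]) (use b ker_d in simp_all)
  then have "n = b + h" by (rule R.has_rank_on_unique[OF n])
  ultimately show ?thesis by blast
qed

section \<open>The first Betti number of a graph\<close>

lemma open_partition_closed_sets:
  assumes "finite \<C>" "pairwise disjnt \<C>" "\<And>C. C \<in> \<C> \<Longrightarrow> closed C" "\<And>C. C \<in> \<C> \<Longrightarrow> C \<noteq> {}"
  shows "open_partition (top_of_set (\<Union>\<C>)) \<C>"
proof
  fix C assume C: "C \<in> \<C>"
  have cl: "closed (\<Union>(\<C> - {C}))" using assms(1,3) by (intro closed_Union) auto
  have "C = \<Union>\<C> \<inter> - \<Union>(\<C> - {C})"
  proof (intro equalityI subsetI)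
    fix x assume x: "x \<in> C"
    have "x \<notin> D" if D: "D \<in> \<C> - {C}" for D
      using pairwiseD[OF assms(2), of C D] C D x by (auto simp: disjnt_def)
    then show "x \<in> \<Union>\<C> \<inter> - \<Union>(\<C> - {C})" using C x by auto
  next
    fix x assume "x \<in> \<Union>\<C> \<inter> - \<Union>(\<C> - {C})"
    then show "x \<in> C" by auto
  qed
  then show "openin (top_of_set (\<Union>\<C>)) C"
    using openin_open_Int[of "- \<Union>(\<C> - {C})" "\<Union>\<C>"] cl by (simp add: open_Compl)
qed (use assms in auto)

text \<open>
  Absolute retracts are used because they can be glued along a point and are contractible.
\<close>

lemma AR_bouquet:
  fixes v :: "'a::euclidean_space"
  assumes "finite \<P>" "\<And>P. P \<in> \<P> \<Longrightarrow> closed P \<and> AR P \<and> v \<in> P"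
    and "\<And>P Q. P \<in> \<P> \<Longrightarrow> Q \<in> \<P> \<Longrightarrow> P \<noteq> Q \<Longrightarrow> P \<inter> Q \<subseteq> {v}"
  shows "closed (insert v (\<Union>\<P>)) \<and> AR (insert v (\<Union>\<P>))"
  using assms
proof (induction \<P> rule: finite_induct)
  case empty
  then show ?case by (simp add: AR_singleton)
next
  case (insert P \<P>)
  have IH: "closed (insert v (\<Union>\<P>)) \<and> AR (insert v (\<Union>\<P>))"
    by (rule insert.IH) (use insert.prems in auto)
  have P: "closed P" "AR P" "v \<in> P" using insert.prems(1) by auto
  have "P \<inter> Q \<subseteq> {v}" if "Q \<in> \<P>" for Q
    using insert.prems(2)[of P Q] that insert.hyps(2) by auto
  then have "insert v (\<Union>\<P>) \<inter> P = {v}" using P(3) by blast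
  then have "AR (insert v (\<Union>\<P>) \<inter> P)" by (simp only: AR_singleton)
  from AR_closed_Un[OF conjunct1[OF IH] P(1) conjunct2[OF IH] P(2) this]
  have "AR (insert v (\<Union>\<P>) \<union> P)" .
  moreover have "closed (insert v (\<Union>\<P>) \<union> P)" by (rule closed_Un[OF conjunct1[OF IH] P(1)])
  moreover have "insert v (\<Union>(insert P \<P>)) = insert v (\<Union>\<P>) \<union> P" by auto
  ultimately show ?case by (simp only:)
qed

lemma path_connectedin_top_of_set:
  fixes C :: "'a::real_normed_vector set"
  shows "path_connected C \<Longrightarrow> C \<subseteq> S \<Longrightarrow> path_connectedin (top_of_set S) C"
  by (simp add: path_connectedin_subtopology)

lemma trivial_first_homology_contractible:
  assumes "contractible S"
  shows "trivial_group (homology_group 1 (top_of_set S))"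
  using trivial_reduced_homology_group_contractible_space[of "top_of_set S" 1] assms
  by (simp add: un_reduced_homology_group)

context parametrized_graph
begin

lemma piece_homeomorphic:
  assumes "e \<in> E" "S \<subseteq> {0..1}"
  shows "S homeomorphic (g e ` S)"
proof -
  obtain h where "homeomorphism {0..1} (g e ` {0..1}) (g e) h"
    using homeomorphism_compact[OF compact_Icc edge_parametrization_continuous[OF g[OF assms(1)]] refl
        edge_parametrization_inj[OF g[OF assms(1)]]] by blast
  from homeomorphism_of_subsets[OF this assms(2) image_mono[OF assms(2)] refl]
  show ?thesis unfolding homeomorphic_def by blast
qed

lemma piece_contractible:
  assumes "e \<in> E" "S \<subseteq> {0..1}" "convex S"
  shows "contractible (g e ` S)"
  using homeomorphic_contractible_eq[OF piece_homeomorphic[OF assms(1,2)]] convex_imp_contractible[OF assms(3)]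
  by blast

lemma piece_closed:
  assumes "e \<in> E" "0 \<le> a" "b \<le> 1"
  shows "closed (g e ` {a..b})"
proof (intro compact_imp_closed compact_continuous_image compact_Icc)
  show "continuous_on {a..b} (g e)"
    by (rule continuous_on_subset[OF edge_parametrization_continuous[OF g[OF assms(1)]]]) (use assms in auto)
qed

lemma piece_AR:
  assumes "e \<in> E" "0 \<le> a" "a \<le> b" "b \<le> 1"
  shows "AR (g e ` {a..b})"
proof (rule AR_homeomorphic_AR)
  have "{a..b} = cball ((a + b) / 2) ((b - a) / 2)"
    unfolding cball_eq_atLeastAtMost by (simp add: field_simps)
  then show "AR {a..b}" using AR_cball[of "(b - a) / 2" "(a + b) / 2"] assms(3) by simp
  show "g e ` {a..b} homeomorphic {a..b}"
    by (rule homeomorphic_sym[THEN iffD1, OF piece_homeomorphic[OF assms(1)]]) (use assms in auto)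
qed

text \<open>
  The complement in the graph is the union of the vertices, the other edges and the rest of the
  edge, all compact.
\<close>

lemma open_piece:
  assumes e: "e \<in> E" and ab: "0 \<le> a" "a < b" "b \<le> 1"
  shows "openin (top_of_set \<Gamma>) (g e ` {a<..<b})"
proof -
  define K where "K = V \<union> (\<Union>e'\<in>E - {e}. g e' ` {0..1}) \<union> g e ` {0..a} \<union> g e ` {b..1}"
  have "closed (g e' ` {0..1})" if "e' \<in> E" for e' by (rule piece_closed[OF that]) simp_all
  then have "closed (\<Union>e'\<in>E - {e}. g e' ` {0..1})" using graph_facts(1) by (intro closed_UN) auto
  moreover have "closed (g e ` {0..a})" "closed (g e ` {b..1})"
    using ab by (simp_all add: piece_closed[OF e])
  ultimately have "closed K"
    unfolding K_def using finite_imp_closed[OF graph_facts(2)] by (intro closed_Un)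
  have "g e ` {a<..<b} = \<Gamma> \<inter> - K"
  proof (intro equalityI subsetI)
    fix x assume "x \<in> g e ` {a<..<b}"
    then obtain s where s: "a < s" "s < b" "x = g e s" by auto
    have s01: "0 < s" "s < 1" "s \<in> {0..1}" using s ab by auto
    have "x \<notin> V" using edge_param_in_V_iff[OF e s01(3)] s01 s(3) by auto
    moreover have "x \<notin> (\<Union>e'\<in>E - {e}. g e' ` {0..1})"
    proof
      assume "x \<in> (\<Union>e'\<in>E - {e}. g e' ` {0..1})"
      then obtain e' t where t: "e' \<in> E" "e' \<noteq> e" "t \<in> {0..1}" "x = g e' t" by blast
      from t(4) have "g e s = g e' t" by (simp only: s(3))
      from edge_param_unique[OF e t(1) s01(1,2) t(3) this] show False using t(2) by simp
    qed
    moreover have "x \<notin> g e ` {0..a} \<union> g e ` {b..1}"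
    proof
      assume "x \<in> g e ` {0..a} \<union> g e ` {b..1}"
      then obtain t where t: "t \<in> {0..a} \<union> {b..1}" "x = g e t" by blast
      have "t \<in> {0..1}" using t(1) ab by auto
      moreover from t(2) have "g e s = g e t" by (simp only: s(3))
      ultimately have "e = e \<and> s = t" by (rule edge_param_unique[OF e e s01(1,2)])
      then show False using t(1) s by auto
    qed
    moreover have "x \<in> \<Gamma>" using edge_param_in_graph[OF e s01(3)] s(3) by simp
    ultimately show "x \<in> \<Gamma> \<inter> - K" unfolding K_def by blast
  next
    fix x assume x: "x \<in> \<Gamma> \<inter> - K"
    then have "x \<notin> V" "x \<in> \<Gamma>" unfolding K_def by blast+
    then obtain e' where e': "e' \<in> E" "x \<in> e'" using graph_facts(4) by blast
    then obtain s where s: "s \<in> {0<..<1}" "x = g e' s" using graph_facts(9)[OF e'(1)] by blast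
    have "x \<in> g e' ` {0..1}" using s by (intro image_eqI[of _ _ s]) auto
    then have "e' = e" using x e'(1) unfolding K_def by blast
    have "s \<notin> {0..a}" "s \<notin> {b..1}" using x s(2) unfolding K_def \<open>e' = e\<close> by blast+
    then have "s \<in> {a<..<b}" using s(1) by auto
    then show "x \<in> g e ` {a<..<b}" using s(2) \<open>e' = e\<close> by blast
  qed
  then show ?thesis using openin_open_Int[of "- K" \<Gamma>] \<open>closed K\<close> by (simp add: open_Compl)
qed

text \<open>
  The vertex with the closed first or last thirds of the edges that start or end there.
\<close>

definition star :: "real^3 \<Rightarrow> (real^3) set" where
  "star v = insert v
     ((\<Union>e\<in>{e\<in>E. g e 0 = v}. g e ` {0..1/3}) \<union> (\<Union>e\<in>{e\<in>E. g e 1 = v}. g e ` {2/3..1}))"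

lemma star_left: "e \<in> E \<Longrightarrow> s \<in> {0..1/3} \<Longrightarrow> g e s \<in> star (g e 0)"
  and star_right: "e \<in> E \<Longrightarrow> s \<in> {2/3..1} \<Longrightarrow> g e s \<in> star (g e 1)"
  unfolding star_def by blast+

lemma star_cases:
  assumes "x \<in> star v"
  obtains "x = v" | e s where "e \<in> E" "0 < s" "s \<le> 1/3" "x = g e s" "g e 0 = v"
    | e s where "e \<in> E" "2/3 \<le> s" "s < 1" "x = g e s" "g e 1 = v"
proof -
  consider "x = v" | e s where "e \<in> E" "x = g e s" "0 \<le> s" "s \<le> 1/3" "g e 0 = v"
    | e s where "e \<in> E" "x = g e s" "2/3 \<le> s" "s \<le> 1" "g e 1 = v"
    using assms unfolding star_def by force
  then show thesis
  proof cases
    case 1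
    then show ?thesis by (rule that(1))
  next
    case (2 e s)
    then show ?thesis using that(1) that(2)[of e s] by (cases "s = 0") auto
  next
    case (3 e s)
    then show ?thesis using that(1) that(3)[of e s] by (cases "s = 1") auto
  qed
qed

lemma star_subset: "v \<in> V \<Longrightarrow> star v \<subseteq> \<Gamma>"
  using graph_facts(3) edge_param_in_graph unfolding star_def by auto

lemma star_Int_V: "v \<in> V \<Longrightarrow> w \<in> V \<Longrightarrow> w \<in> star v \<Longrightarrow> w = v"
  by (erule star_cases) (use edge_param_in_V_iff in force)+

lemma star_disjoint:
  assumes "v \<in> V" "w \<in> V" "x \<in> star v" "x \<in> star w"
  shows "v = w"
  using assms(3)
proof (cases rule: star_cases)
  case 1
  then show ?thesis using star_Int_V[OF assms(2,1)] assms(4) by simp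
next
  case (2 e s)
  have s: "0 < s" "s < 1" "s \<in> {0..1}" using \<open>0 < s\<close> \<open>s \<le> 1/3\<close> by auto
  then have xV: "x \<notin> V" using edge_param_in_V_iff[OF \<open>e \<in> E\<close> s(3)] \<open>x = g e s\<close> by auto
  have eq: "e = e' \<and> s = s'" if "e' \<in> E" "0 \<le> s'" "s' \<le> 1" "x = g e' s'" for e' s'
    by (rule edge_param_unique[OF \<open>e \<in> E\<close> that(1) s(1,2)]) (use that \<open>x = g e s\<close> in auto)
  show ?thesis using assms(4)
  proof (cases rule: star_cases)
    case 1
    then show ?thesis using xV assms(2) by simp
  next
    case (2 e' s')
    have "e = e' \<and> s = s'" by (rule eq) (use 2 in simp_all)
    then show ?thesis using 2 \<open>g e 0 = v\<close> by simp
  next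
    case (3 e' s')
    have "e = e' \<and> s = s'" by (rule eq) (use 3 in simp_all)
    then show ?thesis using 3 \<open>s \<le> 1/3\<close> by simp
  qed
next
  case (3 e s)
  have s: "0 < s" "s < 1" "s \<in> {0..1}" using \<open>s < 1\<close> \<open>2/3 \<le> s\<close> by auto
  then have xV: "x \<notin> V" using edge_param_in_V_iff[OF \<open>e \<in> E\<close> s(3)] \<open>x = g e s\<close> by auto
  have eq: "e = e' \<and> s = s'" if "e' \<in> E" "0 \<le> s'" "s' \<le> 1" "x = g e' s'" for e' s'
    by (rule edge_param_unique[OF \<open>e \<in> E\<close> that(1) s(1,2)]) (use that \<open>x = g e s\<close> in auto)
  show ?thesis using assms(4)
  proof (cases rule: star_cases)
    case 1
    then show ?thesis using xV assms(2) by simp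
  next
    case (2 e' s')
    have "e = e' \<and> s = s'" by (rule eq) (use 2 in simp_all)
    then show ?thesis using 2 \<open>2/3 \<le> s\<close> by simp
  next
    case (3 e' s')
    have "e = e' \<and> s = s'" by (rule eq) (use 3 in simp_all)
    then show ?thesis using 3 \<open>g e 1 = v\<close> by simp
  qed
qed

text \<open>A star is a bouquet of arcs, as an edge meets it in at most one of its ends.\<close>

lemma star_closed_AR:
  assumes v: "v \<in> V"
  shows "closed (star v) \<and> AR (star v)"
proof -
  define \<P> where "\<P> = (\<lambda>e. g e ` {0..1/3}) ` {e\<in>E. g e 0 = v} \<union> (\<lambda>e. g e ` {2/3..1}) ` {e\<in>E. g e 1 = v}"
  have rep: "\<exists>e s. e \<in> E \<and> x = g e s \<and> 0 < s \<and> s < 1 \<and>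
      (if s \<le> 1/3 then P = g e ` {0..1/3} else P = g e ` {2/3..1})" if P: "P \<in> \<P>" "x \<in> P" "x \<noteq> v" for P x
  proof -
    from P(1) consider e where "e \<in> E" "g e 0 = v" "P = g e ` {0..1/3}" | e where "e \<in> E" "g e 1 = v" "P = g e ` {2/3..1}"
      unfolding \<P>_def by blast
    then show ?thesis
    proof cases
      case 1
      then obtain s where s: "0 \<le> s" "s \<le> 1/3" "x = g e s" using P(2) by auto
      then have "s \<noteq> 0" using 1(2) P(3) by auto
      then show ?thesis using 1 s by (intro exI[of _ e] exI[of _ s]) auto
    next
      case 2
      then obtain s where s: "2/3 \<le> s" "s \<le> 1" "x = g e s" using P(2) by auto
      then have "s \<noteq> 1" using 2(2) P(3) by auto
      then show ?thesis using 2 s by (intro exI[of _ e] exI[of _ s]) auto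
    qed
  qed
  have "closed (insert v (\<Union>\<P>)) \<and> AR (insert v (\<Union>\<P>))"
  proof (rule AR_bouquet)
    show "finite \<P>" unfolding \<P>_def using graph_facts(1) by simp
    fix P assume "P \<in> \<P>"
    then consider e where "e \<in> E" "g e 0 = v" "P = g e ` {0..1/3}" | e where "e \<in> E" "g e 1 = v" "P = g e ` {2/3..1}"
      unfolding \<P>_def by blast
    then show "closed P \<and> AR P \<and> v \<in> P"
    proof cases
      case 1
      then have "v \<in> P" by (auto intro!: image_eqI[of _ _ 0])
      then show ?thesis using 1 piece_closed[of e 0 "1/3"] piece_AR[of e 0 "1/3"] by simp
    next
      case 2
      then have "v \<in> P" by (auto intro!: image_eqI[of _ _ 1])
      then show ?thesis using 2 piece_closed[of e "2/3" 1] piece_AR[of e "2/3" 1] by simp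
    qed
  next
    fix P Q assume PQ: "P \<in> \<P>" "Q \<in> \<P>" "P \<noteq> Q"
    show "P \<inter> Q \<subseteq> {v}"
    proof (rule subsetI, rule ccontr)
      fix x assume x: "x \<in> P \<inter> Q" "x \<notin> {v}"
      obtain e s where 1: "e \<in> E" "x = g e s" "0 < s" "s < 1" "if s \<le> 1/3 then P = g e ` {0..1/3} else P = g e ` {2/3..1}"
        using rep[OF PQ(1)] x by blast
      obtain e' s' where 2: "e' \<in> E" "x = g e' s'" "0 < s'" "s' < 1" "if s' \<le> 1/3 then Q = g e' ` {0..1/3} else Q = g e' ` {2/3..1}"
        using rep[OF PQ(2)] x by blast
      have "e = e' \<and> s = s'" by (rule edge_param_unique[OF 1(1) 2(1) 1(3,4)]) (use 1 2 in auto)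
      then show False using 1(5) 2(5) PQ(3) by (auto split: if_splits)
    qed
  qed
  moreover have "insert v (\<Union>\<P>) = star v"
    unfolding \<P>_def star_def by (simp only: Union_Un_distrib)
  ultimately show ?thesis by simp
qed

text \<open>
  The graph is a finite union of closed path-connected pieces. Each of them lies inside a path
  component or is disjoint from it, so path components are open and closed.
\<close>

lemma path_connected_graph: "path_connected \<Gamma>"
proof (cases "\<Gamma> = {}")
  case True
  then show ?thesis by simp
next
  case False
  then obtain x0 where x0: "x0 \<in> \<Gamma>" by blast
  define \<Q> where "\<Q> = (\<lambda>v. {v}) ` V \<union> (\<lambda>e. g e ` {0..1}) ` E"
  have Q: "finite \<Q>" "\<Gamma> = \<Union>\<Q>" "\<And>Q. Q \<in> \<Q> \<Longrightarrow> closed Q \<and> path_connected Q"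
  proof -
    show "finite \<Q>" unfolding \<Q>_def using graph_facts(1,2) by simp
    have "x \<in> \<Union>\<Q>" if xG: "x \<in> \<Gamma>" for x
    proof (cases "x \<in> V")
      case True
      then show ?thesis by (auto simp: \<Q>_def)
    next
      case False
      then obtain e where e: "e \<in> E" "x \<in> e" using xG graph_facts(4) by blast
      then obtain s where "s \<in> {0<..<1}" "x = g e s" using graph_facts(9)[OF e(1)] by blast
      then have "x \<in> g e ` {0..1}" by (intro image_eqI[of _ _ s]) auto
      then show ?thesis using e(1) unfolding \<Q>_def by blast
    qed
    moreover have "\<Union>\<Q> \<subseteq> \<Gamma>" using graph_facts(3) edge_param_in_graph by (auto simp: \<Q>_def)
    ultimately show "\<Gamma> = \<Union>\<Q>" by blast
    fix Q assume "Q \<in> \<Q>"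
    then consider v where "Q = {v}" | e where "e \<in> E" "Q = g e ` {0..1}" by (auto simp: \<Q>_def)
    then show "closed Q \<and> path_connected Q"
    proof cases
      case 2
      then show ?thesis
        using piece_closed[of e 0 1] path_connected_continuous_image[OF edge_parametrization_continuous[OF g]] by simp
    qed simp
  qed
  define C where "C = path_component_set \<Gamma> x0"
  have piece: "Q \<subseteq> C \<or> Q \<inter> C = {}" if "Q \<in> \<Q>" for Q
  proof (cases "Q \<inter> C = {}")
    case False
    then obtain y where y: "y \<in> Q" "path_component \<Gamma> x0 y" by (auto simp: C_def)
    have "Q \<subseteq> path_component_set \<Gamma> y"
      by (rule path_component_maximal) (use y Q that in auto)
    then have "Q \<subseteq> C" unfolding C_def using y(2) path_component_eq by blast
    then show ?thesis by blast
  qed simp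
  have "C \<subseteq> \<Gamma>" unfolding C_def by (rule path_component_subset)
  then have "C = \<Union>{Q\<in>\<Q>. Q \<subseteq> C}" "\<Gamma> - C = \<Union>{Q\<in>\<Q>. Q \<inter> C = {}}"
    using piece Q(2) by blast+
  moreover have "closed (\<Union>{Q\<in>\<Q>. Q \<subseteq> C})" "closed (\<Union>{Q\<in>\<Q>. Q \<inter> C = {}})"
    using Q(1,3) by (auto intro!: closed_Union)
  ultimately have cl: "closed C" "closed (\<Gamma> - C)" by simp_all
  have "closedin (top_of_set \<Gamma>) C" using closed_subset[OF \<open>C \<subseteq> \<Gamma>\<close> cl(1)] .
  moreover have "openin (top_of_set \<Gamma>) C"
  proof -
    have "closedin (top_of_set \<Gamma>) (\<Gamma> - C)" by (rule closed_subset[OF _ cl(2)]) blast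
    then show ?thesis using \<open>C \<subseteq> \<Gamma>\<close> by (simp add: openin_closedin_eq)
  qed
  moreover have "x0 \<in> C" using x0 by (simp add: C_def path_component_refl)
  ultimately have "C = \<Gamma>" using graph_facts(6) unfolding connected_clopen by blast
  then show ?thesis
    using path_connected_path_component[of \<Gamma> x0] by (simp add: C_def)
qed

text \<open>
  Let \<open>A\<close> be the union of the stars. Removing the vertices leaves the intervals
  \<open>E\<close>, which have no first homology, and from each of them two end pieces in \<open>A -
  V\<close>. The exact sequence gives rank \<open>2 * card E - card E\<close> for the relative
  group, and excision identifies this group with the one of the pair of the graph and
  \<open>A\<close>. As \<open>A\<close> has \<open>card V\<close> contractible components and the
  graph is connected, the boundary map of this pair has rank \<open>card V - 1\<close>, and its
  kernel is the first homology of the graph.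
\<close>

theorem first_betti_number_graph:
  assumes nonempty: "\<Gamma> \<noteq> {}"
  shows "first_betti_number \<Gamma> + card V = card E + 1"
proof -
  define A where "A = (\<Union>v\<in>V. star v)"
  let ?X = "top_of_set \<Gamma>" and ?Y = "top_of_set (\<Gamma> - V)"
  have A_sub: "A \<subseteq> \<Gamma>" unfolding A_def using star_subset by blast
  have V_A: "V \<subseteq> A" unfolding A_def star_def by blast
  have sub_A: "subtopology ?X A = top_of_set A" using A_sub by (simp add: subtopology_subtopology inf_absorb2)
  have sub_AV: "subtopology ?Y (A - V) = top_of_set (A - V)"
    using A_sub by (simp add: subtopology_subtopology inf_absorb2 Diff_mono)
  have AV: "A - V = (\<Union>e\<in>E. g e ` {0<..1/3} \<union> g e ` {2/3..<1})"
  proof (intro equalityI subsetI)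
    fix x assume "x \<in> A - V"
    then obtain v where v: "v \<in> V" "x \<in> star v" "x \<notin> V" by (auto simp: A_def)
    obtain e where "e \<in> E" "x \<in> g e ` {0<..1/3} \<or> x \<in> g e ` {2/3..<1}"
      using v(2)
    proof (cases rule: star_cases)
      case 1
      then show ?thesis using v(1,3) by simp
    next
      case (2 e s)
      then have "x \<in> g e ` {0<..1/3}" by (intro image_eqI[of _ _ s]) simp_all
      then show ?thesis using that 2(1) by blast
    next
      case (3 e s)
      then have "x \<in> g e ` {2/3..<1}" by (intro image_eqI[of _ _ s]) simp_all
      then show ?thesis using that 3(1) by blast
    qed
    then show "x \<in> (\<Union>e\<in>E. g e ` {0<..1/3} \<union> g e ` {2/3..<1})" by blast
  next
    fix x assume "x \<in> (\<Union>e\<in>E. g e ` {0<..1/3} \<union> g e ` {2/3..<1})"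
    then obtain e s where s: "e \<in> E" "x = g e s" "0 < s \<and> s \<le> 1/3 \<or> 2/3 \<le> s \<and> s < 1" by auto
    have "x \<notin> V" using edge_param_in_V_iff[OF s(1), of s] s by auto
    moreover have "x \<in> star (if s \<le> 1/3 then g e 0 else g e 1)"
      using s star_left[OF s(1), of s] star_right[OF s(1), of s] by auto
    ultimately show "x \<in> A - V" using ends[OF s(1)] unfolding A_def by (auto split: if_splits)
  qed
  \<comment> \<open>the pair of the whole graph and the stars\<close>
  have pX: "open_partition ?X {\<Gamma>}"
    by unfold_locales (use nonempty in auto)
  have "path_connectedin ?X \<Gamma>" by (rule path_connectedin_top_of_set[OF path_connected_graph subset_refl])
  then have pc_X: "path_connectedin ?X C" if "C \<in> {\<Gamma>}" for C
    using singletonD[OF that] by (simp only:)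
  have "V \<noteq> {}"
  proof
    assume "V = {}"
    then have "E = {}" using ends by auto
    then show False using nonempty graph_facts(4) \<open>V = {}\<close> by simp
  qed
  have star_inj: "inj_on star V"
  proof (rule inj_onI)
    fix v w assume vw: "v \<in> V" "w \<in> V" "star v = star w"
    have "v \<in> star v" by (simp add: star_def)
    then show "v = w" using star_disjoint[OF vw(1,2)] vw(3) by simp
  qed
  have pA: "open_partition (top_of_set A) (star ` V)"
    unfolding A_def
  proof (rule open_partition_closed_sets)
    show "pairwise disjnt (star ` V)"
    proof (rule pairwiseI)
      fix C D assume "C \<in> star ` V" "D \<in> star ` V" "C \<noteq> D"
      then obtain v w where vw: "v \<in> V" "w \<in> V" "C = star v" "D = star w" "star v \<noteq> star w" by auto
      show "disjnt C D"
        unfolding disjnt_iff vw(3,4) using star_disjoint[OF vw(1,2)] vw(5) by auto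
    qed
    show "finite (star ` V)" using graph_facts(2) by simp
    fix C assume "C \<in> star ` V"
    then obtain v where v: "v \<in> V" "C = star v" by auto
    show "closed C" using star_closed_AR[OF v(1)] v(2) by simp
    show "C \<noteq> {}" unfolding v(2) star_def by simp
  qed
  have contr_A: "contractible C" if "C \<in> star ` V" for C
    using that star_closed_AR by (auto intro: AR_imp_contractible)
  have pc_A: "path_connectedin (top_of_set A) C" if C: "C \<in> star ` V" for C
  proof -
    have "C \<subseteq> A" using C by (auto simp: A_def)
    then show ?thesis
      by (rule path_connectedin_top_of_set[OF contractible_imp_path_connected[OF contr_A[OF C]]])
  qed
  have triv_A: "trivial_group (homology_group 1 (top_of_set A))"
  proof (rule open_partition.trivial_homology[OF pA])
    fix C assume C: "C \<in> star ` V"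
    then have "C \<subseteq> A" by (auto simp: A_def)
    then show "trivial_group (homology_group 1 (subtopology (top_of_set A) C))"
      using trivial_first_homology_contractible[OF contr_A[OF C]] by (simp add: subtopology_subtopology inf_absorb2)
  qed
  obtain h1 where h1: "has_rank_on (homology_group 0 (subtopology ?X A))
      (hom_boundary 1 ?X A ` carrier (relative_homology_group 1 ?X A)) h1" "h1 + card {\<Gamma>} = card (star ` V)"
  proof -
    have 1: "A \<subseteq> topspace ?X" using A_sub by simp
    have 2: "C \<inter> A \<noteq> {}" if "C \<in> {\<Gamma>}" for C
      using singletonD[OF that] A_sub V_A \<open>V \<noteq> {}\<close> by blast
    from boundary_rank[OF pX pc_X 1 2, unfolded sub_A, OF _ _ pA pc_A]
    show thesis using that unfolding sub_A by blast
  qed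
  \<comment> \<open>the pair without the vertices, a disjoint union of intervals\<close>
  have e_img: "g e ` {0<..<1} = e" if "e \<in> E" for e by (rule graph_facts(9)[OF that])
  have openY: "openin ?Y (g e ` {a<..<b})" if "e \<in> E" "0 \<le> a" "a < b" "b \<le> 1" for e a b
  proof -
    have "g e ` {a<..<b} \<subseteq> \<Gamma> - V"
    proof
      fix x assume "x \<in> g e ` {a<..<b}"
      then obtain s where s: "s \<in> {a<..<b}" "x = g e s" by blast
      then have s01: "s \<in> {0..1}" "s \<noteq> 0" "s \<noteq> 1" using that(2,4) by auto
      show "x \<in> \<Gamma> - V"
        using edge_param_in_graph[OF that(1) s01(1)] edge_param_in_V_iff[OF that(1) s01(1)] s01(2,3) s(2) by blast
    qed
    from openin_subset_trans[OF open_piece[OF that] this Diff_subset] show ?thesis .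
  qed
  have pY: "open_partition ?Y E"
  proof
    show "pairwise disjnt E" "\<Union>E = topspace ?Y" using \<Gamma> by (simp_all add: semialgebraic_graph_def)
    show "finite E" by (rule graph_facts(1))
    fix e assume e: "e \<in> E"
    show "openin ?Y e" using openY[OF e, of 0 1] e_img[OF e] by simp
    show "e \<noteq> {}" using edge_param_in[OF e, of "1/2"] by auto
  qed
  have contr_e: "contractible e" if "e \<in> E" for e
    using piece_contractible[OF that, of "{0<..<1}"] e_img[OF that] by (auto simp: subset_iff)
  have e_sub: "e \<subseteq> \<Gamma> - V" if "e \<in> E" for e using semialgebraic_graph_edge(3)[OF \<Gamma> that] .
  have pc_Y: "path_connectedin ?Y e" if e: "e \<in> E" for e
    by (rule path_connectedin_top_of_set[OF contractible_imp_path_connected[OF contr_e[OF e]] e_sub[OF e]])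
  have triv_Y: "trivial_group (homology_group 1 ?Y)"
  proof (rule open_partition.trivial_homology[OF pY])
    fix e assume e: "e \<in> E"
    show "trivial_group (homology_group 1 (subtopology ?Y e))"
      using trivial_first_homology_contractible[OF contr_e[OF e]] e_sub[OF e] by (simp add: subtopology_subtopology inf_absorb2)
  qed
  define D where "D = (\<lambda>(e, b). g e ` (if b then {0<..1/3} else {2/3..<1::real}))"
  have D_sub: "D (e, b) \<subseteq> A - V" if "e \<in> E" for e b
    unfolding AV D_def using that by (cases b) auto
  have D_uniq: "d = d'" if d: "d \<in> E \<times> UNIV" "d' \<in> E \<times> UNIV" and x: "x \<in> D d" "x \<in> D d'" for d d' x
  proof -
    obtain e b where [simp]: "d = (e, b)" by (cases d)
    obtain e' b' where [simp]: "d' = (e', b')" by (cases d')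
    obtain s where s: "s \<in> (if b then {0<..1/3} else {2/3..<1::real})" "x = g e s" using x(1) by (auto simp: D_def)
    obtain s' where s': "s' \<in> (if b' then {0<..1/3} else {2/3..<1::real})" "x = g e' s'" using x(2) by (auto simp: D_def)
    have "0 < s" "s < 1" "s' \<in> {0..1}" using s(1) s'(1) by (auto split: if_splits)
    moreover have "e \<in> E" "e' \<in> E" "g e s = g e' s'" using d s(2) s'(2) by simp_all
    ultimately have "e = e' \<and> s = s'" by (intro edge_param_unique)
    then show ?thesis using s(1) s'(1) by (auto split: if_splits)
  qed
  have D_ne: "D d \<noteq> {}" for d by (cases d) (auto simp: D_def)
  have D_inj: "inj_on D (E \<times> UNIV)"
  proof (rule inj_onI)
    fix d d' assume dd: "d \<in> E \<times> UNIV" "d' \<in> E \<times> UNIV" "D d = D d'"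
    then show "d = d'" using D_uniq[OF dd(1,2)] D_ne[of d] by auto
  qed
  have pAV: "open_partition (top_of_set (A - V)) (D ` (E \<times> UNIV))"
  proof
    show "pairwise disjnt (D ` (E \<times> UNIV))"
    proof (rule pairwiseI)
      fix C C' assume "C \<in> D ` (E \<times> UNIV)" "C' \<in> D ` (E \<times> UNIV)" "C \<noteq> C'"
      then obtain d d' where d: "d \<in> E \<times> UNIV" "d' \<in> E \<times> UNIV" "C = D d" "C' = D d'" "d \<noteq> d'" by blast
      show "disjnt C C'"
      proof (rule ccontr)
        assume "\<not> disjnt C C'"
        then obtain x where "x \<in> D d" "x \<in> D d'" using d(3,4) by (auto simp: disjnt_iff)
        from D_uniq[OF d(1,2) this] show False using d(5) by simp
      qed
    qed
    show "\<Union> (D ` (E \<times> UNIV)) = topspace (top_of_set (A - V))"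
    proof (rule trans)
      have "D (e, True) \<union> D (e, False) = g e ` {0<..1/3} \<union> g e ` {2/3..<1}" for e by (simp add: D_def)
      then have "(\<Union>e\<in>E. D (e, True) \<union> D (e, False)) = A - V" unfolding AV by simp
      moreover have "\<Union> (D ` (E \<times> UNIV)) = (\<Union>e\<in>E. D (e, True) \<union> D (e, False))"
      proof (intro equalityI subsetI)
        fix x assume "x \<in> \<Union> (D ` (E \<times> UNIV))"
        then obtain e b where "e \<in> E" "x \<in> D (e, b)" by blast
        then show "x \<in> (\<Union>e\<in>E. D (e, True) \<union> D (e, False))" by (cases b) auto
      qed blast
      ultimately show "\<Union> (D ` (E \<times> UNIV)) = A - V" by simp
    qed simp
    show "finite (D ` (E \<times> UNIV))" using graph_facts(1) by simp
    fix C assume "C \<in> D ` (E \<times> UNIV)"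
    then obtain e b where C: "e \<in> E" "C = D (e, b)" by auto
    show "C \<noteq> {}" using C D_ne by simp
    define I where "I = (if b then {0<..<1/2} else {1/2<..<1::real})"
    have "openin ?Y (g e ` I)" using openY[OF C(1), of 0 "1/2"] openY[OF C(1), of "1/2" 1] by (simp add: I_def)
    then have "openin (subtopology ?Y (A - V)) ((A - V) \<inter> g e ` I)" by (rule openin_subtopology_Int2)
    moreover have "(A - V) \<inter> g e ` I = C"
    proof (intro equalityI subsetI)
      fix x assume x: "x \<in> (A - V) \<inter> g e ` I"
      then obtain s where s: "s \<in> I" "x = g e s" by blast
      obtain e' s' where s': "e' \<in> E" "x = g e' s'" "0 < s' \<and> s' \<le> 1/3 \<or> 2/3 \<le> s' \<and> s' < 1"
        using x unfolding AV by auto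
      have "0 < s" "s < 1" "s' \<in> {0..1}" using s(1) s'(3) by (auto simp: I_def split: if_splits)
      moreover have "g e s = g e' s'" using s(2) s'(2) by simp
      ultimately have "e = e' \<and> s = s'" by (intro edge_param_unique[OF C(1) s'(1)])
      then show "x \<in> C" using C(2) s s' by (auto simp: D_def I_def split: if_splits)
    next
      fix x assume "x \<in> C"
      then show "x \<in> (A - V) \<inter> g e ` I" using D_sub[OF C(1), of b] C(2) by (auto simp: D_def I_def split: if_splits)
    qed
    ultimately show "openin (top_of_set (A - V)) C" unfolding sub_AV by simp
  qed
  have pc_AV: "path_connectedin (top_of_set (A - V)) C" if C: "C \<in> D ` (E \<times> UNIV)" for C
  proof -
    obtain e b where eb: "e \<in> E" "C = D (e, b)" using C by auto
    have "contractible C"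
      using piece_contractible[OF eb(1), of "{0<..1/3}"] piece_contractible[OF eb(1), of "{2/3..<1}"]
      by (auto simp: eb(2) D_def subset_iff)
    then show ?thesis
      by (intro path_connectedin_top_of_set contractible_imp_path_connected) (use D_sub[OF eb(1), of b] eb(2) in simp_all)
  qed
  have meets: "e \<inter> (A - V) \<noteq> {}" if e: "e \<in> E" for e
  proof -
    have "g e (1/4) \<in> D (e, True)" by (auto simp: D_def)
    moreover have "g e (1/4) \<in> e" by (rule edge_param_in[OF e]) simp_all
    ultimately show ?thesis using D_sub[OF e] by blast
  qed
  have "A - V \<subseteq> topspace ?Y" using A_sub by auto
  from boundary_rank[OF pY pc_Y this meets, unfolded sub_AV, OF _ _ pAV pc_AV]
  obtain h2 where h2: "has_rank_on (homology_group 0 (subtopology ?Y (A - V)))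
      (hom_boundary 1 ?Y (A - V) ` carrier (relative_homology_group 1 ?Y (A - V))) h2"
    "h2 + card E = card (D ` (E \<times> (UNIV :: bool set)))"
    unfolding sub_AV by blast
  have "card (D ` (E \<times> (UNIV :: bool set))) = 2 * card E"
    by (simp add: card_image[OF D_inj] card_cartesian_product)
  then have h2E: "h2 = card E" using h2(2) by simp
  have rank_Y: "has_rank_on (relative_homology_group 1 ?Y (A - V)) (carrier (relative_homology_group 1 ?Y (A - V))) (card E)"
    using relative_homology_rank[OF h2(1) triv_Y] unfolding h2E .
  \<comment> \<open>excision of the vertices\<close>
  have exc: "relative_homology_group 1 ?Y (A - V) \<cong> relative_homology_group 1 ?X A"
  proof -
    define W where "W = \<Gamma> \<inter> - (\<Union>e\<in>E. g e ` {1/3..2/3})"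
    have "closed (\<Union>e\<in>E. g e ` {1/3..2/3})" using graph_facts(1) by (intro closed_UN ballI piece_closed) simp_all
    then have "openin ?X W" unfolding W_def by (intro openin_open_Int open_Compl)
    moreover have "W \<subseteq> A"
    proof
      fix x assume x: "x \<in> W"
      show "x \<in> A"
      proof (cases "x \<in> V")
        case True
        then show ?thesis using V_A by blast
      next
        case False
        have "x \<in> \<Gamma>" using x unfolding W_def by (rule IntD1)
        then have "x \<in> \<Union>E" using False graph_facts(4) by (metis UnE)
        then obtain e where e: "e \<in> E" "x \<in> e" by (rule UnionE)
        from e(2) have "x \<in> g e ` {0<..<1}" by (simp only: e_img[OF e(1)])
        then obtain s where s: "x = g e s" "s \<in> {0<..<1}" by (rule imageE)
        have "x \<notin> g e ` {1/3..2/3}"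
        proof
          assume "x \<in> g e ` {1/3..2/3}"
          then have "x \<in> (\<Union>e\<in>E. g e ` {1/3..2/3})" by (rule UN_I[OF e(1)])
          with ComplD[OF IntD2[OF x[unfolded W_def]]] show False by (rule notE)
        qed
        have "s \<notin> {1/3..2/3}"
        proof
          assume "s \<in> {1/3..2/3}"
          then have "x \<in> g e ` {1/3..2/3}" unfolding s(1) by (rule imageI)
          with \<open>x \<notin> g e ` {1/3..2/3}\<close> show False by (rule notE)
        qed
        then have "s \<in> {0<..1/3} \<or> s \<in> {2/3..<1}" using s(2) by auto
        then have "x \<in> g e ` {0<..1/3} \<union> g e ` {2/3..<1}"
          unfolding s(1) image_Un[symmetric] by (intro imageI) simp
        then have "x \<in> A - V" unfolding AV by (rule UN_I[OF e(1)])
        then show ?thesis by (rule DiffD1)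
      qed
    qed
    ultimately have W_int: "W \<subseteq> ?X interior_of A" by (rule interior_of_maximal[rotated])
    have "V \<subseteq> W"
    proof
      fix v assume v: "v \<in> V"
      have "v \<notin> g e ` {1/3..2/3}" if e: "e \<in> E" for e
      proof
        assume "v \<in> g e ` {1/3..2/3}"
        then obtain s where s: "v = g e s" "s \<in> {1/3..2/3}" by (rule imageE)
        then have s01: "s \<in> {0..1}" "s \<noteq> 0" "s \<noteq> 1" by auto
        show False using edge_param_in_V_iff[OF e s01(1)] v s01(2,3) unfolding s(1) by simp
      qed
      then have "v \<notin> (\<Union>e\<in>E. g e ` {1/3..2/3})" by (intro notI) (elim UN_E, simp)
      moreover have "v \<in> \<Gamma>" using v graph_facts(3) by (rule subsetD[rotated])
      ultimately show "v \<in> W" unfolding W_def Int_iff Compl_iff by (intro conjI)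
    qed
    moreover have "?X closure_of V = V"
      using graph_facts(2,3) by (intro closure_of_closedin closed_subset finite_imp_closed)
    ultimately have "?X closure_of V \<subseteq> ?X interior_of A" using W_int by simp
    from homology_excision_axiom[OF this A_sub, of 1]
    have "hom_induced 1 (subtopology ?X (\<Gamma> - V)) (A - V) (subtopology ?X \<Gamma>) A id
        \<in> iso (relative_homology_group 1 (subtopology ?X (\<Gamma> - V)) (A - V)) (relative_homology_group 1 (subtopology ?X \<Gamma>) A)" .
    moreover have "subtopology ?X (\<Gamma> - V) = ?Y" "subtopology ?X \<Gamma> = ?X"
      by (simp_all add: subtopology_subtopology inf_absorb2)
    ultimately show ?thesis by (auto intro: is_isoI)
  qed
  have rank_X: "has_rank_on (relative_homology_group 1 ?X A) (carrier (relative_homology_group 1 ?X A)) (card E)"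
    by (rule has_rank_on_iso[OF _ _ group.iso_sym[OF _ exc] rank_Y]) simp_all
  obtain b where b: "has_rank_on (homology_group 1 ?X) (carrier (homology_group 1 ?X)) b" "card E = b + h1"
    using absolute_homology_rank[OF h1(1) _ rank_X] triv_A unfolding sub_A by blast
  have "first_betti_number \<Gamma> = b"
    unfolding first_betti_number_def by (rule comm_group.abelian_rank_eq[OF abelian_homology_group b(1)])
  moreover have "h1 + 1 = card V" using h1(2) card_image[OF star_inj] by simp
  ultimately show ?thesis using b(2) by simp
qed

end

section \<open>Half-spaces and tightness\<close>

text \<open>
  On a constant height function every point would be a degenerate critical point, for whatever
  parametrization witnesses the nondegeneracy.
\<close>

lemma nondegenerate_height_nonconstant:
  assumes g: "edge_parametrization g e" and u: "nondegenerate_on_edge (\<lambda>x. u \<bullet> x) e"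
  shows "\<exists>s\<in>{0..1}. \<exists>t\<in>{0..1}. u \<bullet> g s \<noteq> u \<bullet> g t"
proof (rule ccontr)
  assume const: "\<not> ?thesis"
  obtain g' where g': "edge_parametrization g' e"
      "\<forall>t\<in>{0<..<1}. deriv ((\<lambda>x. u \<bullet> x) \<circ> g') t = 0 \<longrightarrow> deriv (deriv ((\<lambda>x. u \<bullet> x) \<circ> g')) t \<noteq> 0"
    using u unfolding nondegenerate_on_edge_def by (elim exE conjE)
  define h where "h = (\<lambda>x. u \<bullet> x) \<circ> g'"
  have e: "g ` {0<..<1} = e" "g' ` {0<..<1} = e" using g g'(1) by (simp_all add: edge_parametrization_def)
  have h: "h t = u \<bullet> g 0" if t: "t \<in> {0<..<1}" for t
  proof -
    have "g' t \<in> g ` {0<..<1}" unfolding e(1) e(2)[symmetric] using t by (rule imageI)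
    then obtain s where s: "s \<in> {0<..<1}" "g' t = g s" by (rule imageE)
    from s(1) have "s \<in> {0..1}" by simp
    moreover have "0 \<in> {0..1::real}" by simp
    ultimately have "u \<bullet> g s = u \<bullet> g 0" using const by blast
    then show ?thesis by (simp add: h_def s(2))
  qed
  have ev: "\<forall>\<^sub>F x in nhds t. x \<in> {0<..<1}" if "t \<in> {0<..<1}" for t :: real
    by (rule eventually_nhds_in_open[OF open_greaterThanLessThan that])
  have d1: "deriv h t = 0" if t: "t \<in> {0<..<1}" for t
  proof -
    have "\<forall>\<^sub>F x in nhds t. h x = u \<bullet> g 0" using ev[OF t] by (rule eventually_mono) (rule h)
    from deriv_cong_ev[OF this refl] show ?thesis by simp
  qed
  have half: "1/2 \<in> {0<..<1::real}" by simp
  have "\<forall>\<^sub>F x in nhds (1/2). deriv h x = 0" using ev[OF half] by (rule eventually_mono) (rule d1)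
  from deriv_cong_ev[OF this refl] have "deriv (deriv h) (1/2) = 0" by simp
  then show False using bspec[OF g'(2) half, folded h_def] d1[OF half] by simp
qed

lemma parametrized_graph_exists:
  assumes \<Gamma>: "semialgebraic_graph \<Gamma> V E"
  shows "\<exists>g. parametrized_graph \<Gamma> V E g"
proof -
  have "\<forall>e\<in>E. \<exists>g. edge_parametrization g e \<and> g 0 \<in> V \<and> g 1 \<in> V"
    using semialgebraic_graph_edge(2)[OF \<Gamma>] by blast
  from bchoice[OF this] obtain g where "\<forall>e\<in>E. edge_parametrization (g e) e \<and> g e 0 \<in> V \<and> g e 1 \<in> V" by blast
  then show ?thesis using \<Gamma> by (intro exI[of _ g]) (simp add: parametrized_graph_def)
qed

lemma coordinate_cell_nonempty: "coordinate_cell I \<noteq> ({} :: 'a::euclidean_space set)"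
proof -
  define x :: 'a where "x = (\<Sum>b\<in>Basis. (if b \<in> I then 1/2 else 0) *\<^sub>R b)"
  have "x \<bullet> b = (if b \<in> I then 1/2 else 0)" if "b \<in> Basis" for b
    unfolding x_def by (rule inner_sum_left_Basis[OF that])
  then have "x \<in> coordinate_cell I" by (simp add: coordinate_cell_def)
  then show ?thesis by blast
qed

text \<open>A set of dimension one contains the image of a nonempty cell.\<close>

lemma semialgebraic_graph_nonempty:
  assumes "semialgebraic_graph \<Gamma> V E"
  shows "\<Gamma> \<noteq> {}"
proof -
  have "contains_cell \<Gamma> 1" using assms by (simp add: semialgebraic_graph_def has_semialgebraic_dim_def)
  then obtain I :: "(real^3) set" and f :: "real^3 \<Rightarrow> real^3" where "f ` coordinate_cell I \<subseteq> \<Gamma>"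
    unfolding contains_cell_def by (elim exE conjE)
  moreover have "f ` coordinate_cell I \<noteq> {}" using coordinate_cell_nonempty by simp
  ultimately show ?thesis by (metis subset_empty)
qed

lemma height_attains_minimum:
  fixes K :: "(real^3) set"
  assumes "compact K" "K \<noteq> {}"
  obtains p where "p \<in> K" "\<forall>x\<in>K. u \<bullet> p \<le> u \<bullet> x"
proof -
  have "continuous_on K (\<lambda>x. u \<bullet> x)" by (intro continuous_intros)
  from continuous_attains_inf[OF assms this] show ?thesis using that by blast
qed

lemma closed_half_space: "closed (half_space u c)"
  unfolding half_space_def by (rule closed_halfspace_le)

text \<open>
  Separate the two parts of the section by disjoint open sets. The rest of the set is compact and
  lies strictly above the bounding plane, by some \<open>2 * \<delta>\<close>. So the plane can be
  moved up by \<open>\<delta>\<close>, and then both the level and the normal vector can be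
  perturbed, without reaching the rest and without losing the section.
\<close>

lemma disconnected_half_space_stable:
  fixes \<Gamma> :: "(real^3) set"
  assumes \<Gamma>: "compact \<Gamma>" and disc: "\<not> connected (\<Gamma> \<inter> half_space u c)"
  obtains U1 U2 :: "(real^3) set" and c0 \<epsilon> :: real
  where "open U1" "open U2" "U1 \<inter> U2 = {}" "\<epsilon> > 0"
    "\<forall>u' c'. dist u' u < \<epsilon> \<longrightarrow> \<bar>c' - c0\<bar> < \<epsilon> \<longrightarrow>
       \<Gamma> \<inter> half_space u' c' \<subseteq> U1 \<union> U2 \<and> \<Gamma> \<inter> half_space u' c' \<inter> U1 \<noteq> {} \<and> \<Gamma> \<inter> half_space u' c' \<inter> U2 \<noteq> {}"
proof -
  have "closed (\<Gamma> \<inter> half_space u c)"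
    using compact_imp_closed[OF \<Gamma>] closed_half_space by (rule closed_Int)
  with disc obtain A B where AB: "closed A" "closed B" "A \<noteq> {}" "B \<noteq> {}" "A \<union> B = \<Gamma> \<inter> half_space u c" "A \<inter> B = {}"
    unfolding connected_closed_set[OF \<open>closed (\<Gamma> \<inter> half_space u c)\<close>] by blast
  obtain U1 U2 where U: "open U1" "open U2" "A \<subseteq> U1" "B \<subseteq> U2" "U1 \<inter> U2 = {}"
    using separation_normal[OF AB(1,2,6)] by blast
  define F where "F = \<Gamma> - (U1 \<union> U2)"
  have "compact F" unfolding F_def using \<Gamma> U(1,2) by (intro compact_diff open_Un)
  have F_gt: "c < u \<bullet> x" if "x \<in> F" for x
  proof (rule ccontr)
    assume "\<not> c < u \<bullet> x"
    then have "x \<in> \<Gamma> \<inter> half_space u c" using that by (simp add: F_def half_space_def)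
    then show False using AB(5) U(3,4) that unfolding F_def by blast
  qed
  obtain \<delta> where \<delta>: "\<delta> > 0" "\<And>x. x \<in> F \<Longrightarrow> c + 2 * \<delta> \<le> u \<bullet> x"
  proof (cases "F = {}")
    case True
    then show ?thesis using that[of 1] by simp
  next
    case False
    obtain y where y: "y \<in> F" "\<forall>x\<in>F. u \<bullet> y \<le> u \<bullet> x"
      by (rule height_attains_minimum[OF \<open>compact F\<close> False, where u = u])
    show ?thesis
      by (rule that[of "(u \<bullet> y - c) / 2"]) (use F_gt[OF y(1)] y(2) in \<open>auto simp: field_simps\<close>)
  qed
  obtain R where R: "R > 0" "\<And>x. x \<in> \<Gamma> \<Longrightarrow> norm x \<le> R"
    using compact_imp_bounded[OF \<Gamma>] unfolding bounded_pos by blast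
  define \<epsilon> where "\<epsilon> = min (\<delta> / 4) (\<delta> / (4 * R))"
  have eps: "\<epsilon> > 0" "\<epsilon> \<le> \<delta> / 4" "\<epsilon> * R \<le> \<delta> / 4"
  proof -
    show "\<epsilon> > 0" "\<epsilon> \<le> \<delta> / 4" using \<delta>(1) R(1) by (simp_all add: \<epsilon>_def)
    have "\<epsilon> \<le> \<delta> / (4 * R)" by (simp add: \<epsilon>_def)
    then show "\<epsilon> * R \<le> \<delta> / 4" using R(1) by (simp add: field_simps)
  qed
  have close: "\<bar>u' \<bullet> x - u \<bullet> x\<bar> \<le> \<delta> / 4" if "dist u' u < \<epsilon>" "x \<in> \<Gamma>" for u' x
  proof -
    have "\<bar>u' \<bullet> x - u \<bullet> x\<bar> = \<bar>(u' - u) \<bullet> x\<bar>" by (simp add: inner_diff_left)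
    also have "\<dots> \<le> norm (u' - u) * norm x" by (rule Cauchy_Schwarz_ineq2)
    also have "\<dots> \<le> \<epsilon> * R"
      using that(1) R(2)[OF that(2)] eps(1) by (intro mult_mono) (simp_all add: dist_norm)
    finally show ?thesis using eps(3) by simp
  qed
  show thesis
  proof (rule that[OF U(1,2,5) eps(1), of "c + \<delta>"], intro allI impI conjI)
    fix u' :: "real^3" and c' :: real assume u': "dist u' u < \<epsilon>" and c': "\<bar>c' - (c + \<delta>)\<bar> < \<epsilon>"
    show "\<Gamma> \<inter> half_space u' c' \<subseteq> U1 \<union> U2"
    proof
      fix x assume x: "x \<in> \<Gamma> \<inter> half_space u' c'"
      show "x \<in> U1 \<union> U2"
      proof (rule ccontr)
        assume "x \<notin> U1 \<union> U2"
        then have "c + 2 * \<delta> \<le> u \<bullet> x" using x \<delta>(2) by (simp add: F_def)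
        moreover have "u' \<bullet> x \<le> c'" using x by (simp add: half_space_def)
        moreover have "\<bar>u' \<bullet> x - u \<bullet> x\<bar> \<le> \<delta> / 4" using close[OF u'] x by simp
        ultimately show False using c' eps(2) \<delta>(1) by linarith
      qed
    qed
    have low: "x \<in> \<Gamma> \<inter> half_space u' c'" if "x \<in> \<Gamma> \<inter> half_space u c" for x
    proof -
      have "\<bar>u' \<bullet> x - u \<bullet> x\<bar> \<le> \<delta> / 4" "u \<bullet> x \<le> c" using close[OF u'] that by (simp_all add: half_space_def)
      then have "u' \<bullet> x \<le> c'" using c' eps(2) \<delta>(1) by linarith
      then show ?thesis using that by (simp add: half_space_def)
    qed
    show "\<Gamma> \<inter> half_space u' c' \<inter> U1 \<noteq> {}" "\<Gamma> \<inter> half_space u' c' \<inter> U2 \<noteq> {}"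
      using low AB(3-5) U(3,4) by blast+
  qed
qed

lemma not_connected_if_separated:
  assumes "open U1" "open U2" "U1 \<inter> U2 = {}" "S \<subseteq> U1 \<union> U2" "S \<inter> U1 \<noteq> {}" "S \<inter> U2 \<noteq> {}"
  shows "S \<noteq> {} \<and> \<not> connected S"
proof (intro conjI notI)
  assume "connected S"
  moreover have "U1 \<inter> U2 \<inter> S = {}" using assms(3) by simp
  ultimately have "U1 \<inter> S = {} \<or> U2 \<inter> S = {}" using assms(1,2,4) by (intro connectedD)
  then show False using assms(5,6) by blast
qed (use assms(5) in auto)

lemma space_sphere_measure: "space sphere_measure = sphere 0 1"
  and sets_sphere_measure: "sets sphere_measure = sets (restrict_space borel (sphere 0 1))"
  by (simp_all add: sphere_measure_def space_scale_measure sets_scale_measure space_restrict_space)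

lemma radial_projection_measurable:
  "(\<lambda>x :: real^3. x /\<^sub>R norm x) \<in> measurable (restrict_space lborel (ball 0 1 - {0})) (restrict_space borel (sphere 0 1))"
proof (rule measurable_restrict_space2)
  show "(\<lambda>x :: real^3. x /\<^sub>R norm x) \<in> space (restrict_space lborel (ball 0 1 - {0})) \<rightarrow> sphere 0 1"
    by (auto simp: space_restrict_space)
  show "(\<lambda>x :: real^3. x /\<^sub>R norm x) \<in> borel_measurable (restrict_space lborel (ball 0 1 - {0}))"
    by (intro measurable_restrict_space1) measurable
qed

text \<open>The cone over an open subset of the sphere is open and nonempty.\<close>

lemma emeasure_sphere_measure_open_pos:
  assumes G: "open G" and x: "x \<in> G \<inter> sphere 0 1"
  shows "emeasure sphere_measure (G \<inter> sphere 0 1) \<noteq> 0"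
proof
  let ?\<Omega> = "ball 0 1 - {0 :: real^3}"
  let ?f = "\<lambda>x :: real^3. x /\<^sub>R norm x"
  define W where "W = {x \<in> ?\<Omega>. ?f x \<in> G}"
  assume 0: "emeasure sphere_measure (G \<inter> sphere 0 1) = 0"
  have Gs: "G \<inter> sphere 0 1 \<in> sets (restrict_space borel (sphere 0 1))"
    using G by (auto simp: sets_restrict_space)
  have vim: "?f -` (G \<inter> sphere 0 1) \<inter> space (restrict_space lborel ?\<Omega>) = W"
    by (auto simp: W_def space_restrict_space)
  have op: "open W"
  proof -
    have "open ?\<Omega>" by (intro open_Diff) simp_all
    moreover have "continuous_on ?\<Omega> ?f" by (intro continuous_intros) auto
    ultimately have "open (?\<Omega> \<inter> ?f -` G)" using G by (intro continuous_open_preimage)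
    moreover have "?\<Omega> \<inter> ?f -` G = W" by (auto simp: W_def)
    ultimately show ?thesis by simp
  qed
  have "emeasure sphere_measure (G \<inter> sphere 0 1) = 3 * emeasure (restrict_space lborel ?\<Omega>) W"
    unfolding sphere_measure_def emeasure_scale_measure emeasure_distr[OF radial_projection_measurable Gs] vim ..
  then have "emeasure (restrict_space lborel ?\<Omega>) W = 0" using 0 by simp
  then have "emeasure lborel W = 0"
  proof -
    have "?\<Omega> \<inter> space lborel \<in> sets lborel" "W \<subseteq> ?\<Omega>" by (auto simp: W_def)
    from emeasure_restrict_space[OF this] show ?thesis
      using \<open>emeasure (restrict_space lborel ?\<Omega>) W = 0\<close> by simp
  qed
  then have "W \<in> null_sets lborel" using op by (intro null_setsI) simp_all
  then have "W \<in> null_sets lebesgue" by (rule null_sets_completionI)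
  then have "negligible W" by (simp only: negligible_iff_null_sets)
  moreover have "(1/2) *\<^sub>R x \<in> W"
  proof -
    have x1: "norm x = 1" "x \<in> G" using x by simp_all
    then have "?f ((1/2) *\<^sub>R x) = x" "(1/2) *\<^sub>R x \<in> ?\<Omega>" by auto
    then show ?thesis using x1(2) by (simp only: W_def mem_Collect_eq)
  qed
  ultimately show False using open_not_negligible[OF op] by blast
qed

text \<open>
  A product of a relatively open subset of the sphere and an open interval has positive measure.
\<close>

lemma AE_imp_dense_in_sphere:
  assumes ae: "AE (u, c) in sphere_measure \<Otimes>\<^sub>M lborel. P u c"
    and u: "u \<in> sphere 0 1" and \<epsilon>: "\<epsilon> > 0"
  shows "\<exists>u'\<in>sphere 0 1. \<exists>c'. dist u' u < \<epsilon> \<and> \<bar>c' - c\<bar> < \<epsilon> \<and> P u' c'"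
proof (rule ccontr)
  assume none: "\<not> ?thesis"
  define B where "B = ball u \<epsilon> \<inter> sphere 0 1"
  define I where "I = {c - \<epsilon><..<c + \<epsilon>}"
  obtain N where N: "N \<in> null_sets (sphere_measure \<Otimes>\<^sub>M lborel)"
      "{p \<in> space (sphere_measure \<Otimes>\<^sub>M lborel). \<not> (case p of (u, c) \<Rightarrow> P u c)} \<subseteq> N"
    using ae unfolding eventually_ae_filter by (rule bexE)
  have meas: "B \<in> sets sphere_measure" "I \<in> sets (lborel :: real measure)"
    by (auto simp: B_def I_def sets_sphere_measure sets_restrict_space)
  have "B \<times> I \<subseteq> N"
  proof
    fix p assume "p \<in> B \<times> I"
    then obtain u' c' where p: "p = (u', c')" "u' \<in> B" "c' \<in> I" by blast
    have uc: "u' \<in> sphere 0 1" "dist u' u < \<epsilon>" "\<bar>c' - c\<bar> < \<epsilon>"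
      using p(2,3) by (simp_all add: B_def I_def dist_commute abs_less_iff)
    have "\<not> P u' c'"
    proof
      assume "P u' c'"
      with uc have "\<exists>u'\<in>sphere 0 1. \<exists>c'. dist u' u < \<epsilon> \<and> \<bar>c' - c\<bar> < \<epsilon> \<and> P u' c'"
        by (intro bexI[of _ u'] exI[of _ c'] conjI)
      with none show False by (rule notE)
    qed
    then show "p \<in> N"
      using \<open>u' \<in> sphere 0 1\<close> unfolding p(1)
      by (intro subsetD[OF N(2)]) (simp add: space_pair_measure space_sphere_measure)
  qed
  then have "emeasure (sphere_measure \<Otimes>\<^sub>M lborel) (B \<times> I) \<le> emeasure (sphere_measure \<Otimes>\<^sub>M lborel) N"
    using null_setsD2[OF N(1)] by (rule emeasure_mono)
  then have "emeasure (sphere_measure \<Otimes>\<^sub>M lborel) (B \<times> I) = 0"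
    using null_setsD1[OF N(1)] by simp
  then have "emeasure sphere_measure B * emeasure lborel I = 0"
    using lborel.emeasure_pair_measure_Times[OF meas] by simp
  moreover have "emeasure sphere_measure B \<noteq> 0"
    unfolding B_def by (rule emeasure_sphere_measure_open_pos[of _ u]) (use u \<epsilon> in auto)
  moreover have "emeasure lborel I \<noteq> 0" using \<epsilon> by (simp add: I_def)
  ultimately show False by simp
qed

lemma connected_if_almost_all_connected:
  fixes \<Gamma> :: "(real^3) set"
  assumes \<Gamma>: "compact \<Gamma>" and u: "u \<in> sphere 0 1"
    and ae: "AE (u, c) in sphere_measure \<Otimes>\<^sub>M lborel. \<Gamma> \<inter> half_space u c = {} \<or> connected (\<Gamma> \<inter> half_space u c)"
  shows "connected (\<Gamma> \<inter> half_space u c)"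
proof (rule ccontr)
  assume "\<not> ?thesis"
  then obtain U1 U2 c0 \<epsilon> where
    *: "open U1" "open U2" "U1 \<inter> U2 = {}" "\<epsilon> > 0" "\<forall>u' c'. dist u' u < \<epsilon> \<longrightarrow> \<bar>c' - c0\<bar> < \<epsilon> \<longrightarrow>
       \<Gamma> \<inter> half_space u' c' \<subseteq> U1 \<union> U2 \<and> \<Gamma> \<inter> half_space u' c' \<inter> U1 \<noteq> {} \<and> \<Gamma> \<inter> half_space u' c' \<inter> U2 \<noteq> {}"
    by (rule disconnected_half_space_stable[OF \<Gamma>])
  obtain u' c' where uc: "dist u' u < \<epsilon>" "\<bar>c' - c0\<bar> < \<epsilon>"
      "\<Gamma> \<inter> half_space u' c' = {} \<or> connected (\<Gamma> \<inter> half_space u' c')"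
    using AE_imp_dense_in_sphere[OF ae u *(4), of c0] by (elim bexE exE conjE)
  from *(5)[rule_format, OF uc(1,2)] have "\<Gamma> \<inter> half_space u' c' \<noteq> {} \<and> \<not> connected (\<Gamma> \<inter> half_space u' c')"
    by (intro not_connected_if_separated[OF *(1-3)]) blast+
  then show False using uc(3) by blast
qed

text \<open>
  Points of the open set \<open>U1\<close> outside the half-space are higher than all points of the
  section, so a lowest point of the part of the section in \<open>U1\<close> is a lowest point in
  \<open>U1\<close>.
\<close>

lemma minimum_of_separated_part_is_local:
  fixes \<Gamma> :: "(real^3) set"
  assumes \<Gamma>: "compact \<Gamma>" and U: "open U1" "open U2" "U1 \<inter> U2 = {}" "\<Gamma> \<inter> half_space u c \<subseteq> U1 \<union> U2"
    and ne: "\<Gamma> \<inter> half_space u c \<inter> U1 \<noteq> {}"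
  shows "\<exists>p\<in>U1. local_minimum_on \<Gamma> (\<lambda>x. u \<bullet> x) p"
proof -
  let ?K = "\<Gamma> \<inter> half_space u c \<inter> U1"
  have K: "?K = (\<Gamma> \<inter> half_space u c) - U2" using U(3,4) by blast
  have "compact ?K"
    unfolding K using \<Gamma> closed_half_space U(2) by (intro compact_diff compact_Int_closed)
  then obtain p where p: "p \<in> ?K" "\<forall>x\<in>?K. u \<bullet> p \<le> u \<bullet> x"
    by (rule height_attains_minimum[OF _ ne, where u = u])
  have le: "u \<bullet> p \<le> u \<bullet> x" if x: "x \<in> \<Gamma>" "x \<in> U1" for x
  proof (cases "u \<bullet> x \<le> c")
    case True
    then show ?thesis using bspec[OF p(2), of x] x by (simp add: half_space_def)
  next
    case False
    then show ?thesis using p(1) by (simp add: half_space_def)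
  qed
  have "p \<in> U1" using p(1) by blast
  then have "\<forall>\<^sub>F x in nhds p. x \<in> U1" using U(1) by (rule eventually_nhds_in_open[rotated])
  then have "\<forall>\<^sub>F x in at p within \<Gamma>. u \<bullet> p \<le> u \<bullet> x"
    unfolding eventually_at_filter by (rule eventually_mono) (use le in blast)
  then have "local_minimum_on \<Gamma> (\<lambda>x. u \<bullet> x) p" using p(1) by (simp add: local_minimum_on_def)
  then show ?thesis using \<open>p \<in> U1\<close> by blast
qed

lemma nondegenerate_level_finite:
  assumes \<Gamma>: "semialgebraic_graph \<Gamma> V E" and u: "nondegenerate \<Gamma> V E u"
  shows "finite {x\<in>\<Gamma>. u \<bullet> x = c}"
proof -
  obtain g where "parametrized_graph \<Gamma> V E g" using parametrized_graph_exists[OF \<Gamma>] by blast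
  then interpret parametrized_graph \<Gamma> V E g .
  have edge: "finite {t\<in>{0<..<1}. u \<bullet> g e t - c = 0}" if e: "e \<in> E" for e
  proof -
    have F: "real_polynomial_function (\<lambda>x :: real^3. u \<bullet> x - c)"
      using real_polynomial_function.intros(3)[OF real_polynomial_function_inner[of u] real_polynomial_function.intros(2)[of "- c"]]
      by simp
    have "nondegenerate_on_edge (\<lambda>x. u \<bullet> x) e" using u e by (simp add: nondegenerate_def)
    from nondegenerate_height_nonconstant[OF g[OF e] this]
    obtain s t where "s \<in> {0..1}" "t \<in> {0..1}" "u \<bullet> g e s - c \<noteq> u \<bullet> g e t - c" by auto
    from polynomial_on_edge_noncritical[OF g[OF e] F this]
    obtain a where a: "a \<in> {0<..<1}" "deriv (\<lambda>t. u \<bullet> g e t - c) a \<noteq> 0" by blast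
    have "\<exists>b\<in>{0<..<1}. u \<bullet> g e b - c \<noteq> 0"
    proof (rule ccontr)
      assume "\<not> ?thesis"
      then have z: "u \<bullet> g e b - c = 0" if "b \<in> {0<..<1}" for b using that by blast
      have "\<forall>\<^sub>F x in nhds a. x \<in> {0<..<1}" by (rule eventually_nhds_in_open[OF open_greaterThanLessThan a(1)])
      then have "\<forall>\<^sub>F x in nhds a. u \<bullet> g e x - c = 0" by (rule eventually_mono) (rule z)
      from deriv_cong_ev[OF this refl] show False using a(2) by simp
    qed
    then obtain b where "b \<in> {0<..<1}" "u \<bullet> g e b - c \<noteq> 0" by blast
    from finite_zeros_of_polynomial_on_edge[OF semialgebraic_graph_edge(1)[OF \<Gamma> e] g[OF e] F this]
    show ?thesis .
  qed
  have "{x\<in>\<Gamma>. u \<bullet> x = c} \<subseteq> V \<union> (\<Union>e\<in>E. g e ` {t\<in>{0<..<1}. u \<bullet> g e t - c = 0})"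
  proof
    fix x assume x: "x \<in> {x\<in>\<Gamma>. u \<bullet> x = c}"
    show "x \<in> V \<union> (\<Union>e\<in>E. g e ` {t\<in>{0<..<1}. u \<bullet> g e t - c = 0})"
    proof (cases "x \<in> V")
      case False
      then obtain e where e: "e \<in> E" "x \<in> e" using x graph_facts(4) by blast
      then obtain t where t: "t \<in> {0<..<1}" "x = g e t" using graph_facts(9)[OF e(1)] by blast
      then have "t \<in> {t\<in>{0<..<1}. u \<bullet> g e t - c = 0}" using x by simp
      then have "x \<in> g e ` {t\<in>{0<..<1}. u \<bullet> g e t - c = 0}" unfolding t(2) by (rule imageI)
      then show ?thesis using e(1) by (intro UnI2 UN_I)
    qed simp
  qed
  moreover have "finite (V \<union> (\<Union>e\<in>E. g e ` {t\<in>{0<..<1}. u \<bullet> g e t - c = 0}))"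
    using graph_facts(1,2) edge by (intro finite_UnI finite_UN_I finite_imageI)
  ultimately show ?thesis by (rule finite_subset)
qed

text \<open>
  Near \<open>q\<close> the section at the level of \<open>q\<close> consists of points of that
  level only. There are finitely many of them, so \<open>q\<close> is an isolated point of the
  section, which is connected.
\<close>

lemma local_minimum_isolated_in_half_space:
  assumes fin: "finite {x\<in>\<Gamma>. u \<bullet> x = u \<bullet> q}" and q: "local_minimum_on \<Gamma> (\<lambda>x. u \<bullet> x) q"
    and conn: "connected (\<Gamma> \<inter> half_space u (u \<bullet> q))" and p: "p \<in> \<Gamma>" "u \<bullet> p \<le> u \<bullet> q"
  shows "p = q"
proof (rule ccontr)
  assume "p \<noteq> q"
  let ?S = "\<Gamma> \<inter> half_space u (u \<bullet> q)"
  have qS: "q \<in> ?S" and pS: "p \<in> ?S" using q p by (simp_all add: local_minimum_on_def half_space_def)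
  obtain A where A: "open A" "q \<in> A" "\<And>x. x \<in> A \<Longrightarrow> x \<noteq> q \<Longrightarrow> x \<in> \<Gamma> \<Longrightarrow> u \<bullet> q \<le> u \<bullet> x"
    using q unfolding local_minimum_on_def eventually_at_topological by blast
  define B where "B = A - ({x\<in>\<Gamma>. u \<bullet> x = u \<bullet> q} - {q})"
  have "open B" unfolding B_def using A(1) fin by (intro open_Diff finite_imp_closed) simp_all
  moreover have "?S \<inter> B = {q}"
  proof (intro equalityI subsetI)
    fix x assume x: "x \<in> ?S \<inter> B"
    show "x \<in> {q}"
    proof (rule ccontr)
      assume "x \<notin> {q}"
      then have "u \<bullet> q \<le> u \<bullet> x" using A(3)[of x] x by (simp add: B_def)
      then show False using x \<open>x \<notin> {q}\<close> by (simp add: B_def half_space_def)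
    qed
  qed (use qS A(2) in \<open>auto simp: B_def\<close>)
  ultimately have "openin (top_of_set ?S) {q}" using openin_open_Int[of B ?S] by simp
  moreover have "closedin (top_of_set ?S) {q}" using qS by (intro closed_subset) auto
  ultimately have "{q} = ?S" using conn unfolding connected_clopen by blast
  then show False using pS \<open>p \<noteq> q\<close> by blast
qed

lemma graph_weight_tight_iff_unique_minimum:
  assumes \<Gamma>: "semialgebraic_graph \<Gamma> V E" and u: "nondegenerate \<Gamma> V E u"
  shows "graph_weight \<Gamma> u = 1 + int (first_betti_number \<Gamma>) \<longleftrightarrow>
    (\<exists>p. {p. local_minimum_on \<Gamma> (\<lambda>x. u \<bullet> x) p} = {p})"
proof -
  obtain g where "parametrized_graph \<Gamma> V E g" using parametrized_graph_exists[OF \<Gamma>] by blast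
  then interpret parametrized_graph \<Gamma> V E g .
  have nonconst: "\<exists>s\<in>{0..1}. \<exists>t\<in>{0..1}. u \<bullet> g e s \<noteq> u \<bullet> g e t" if e: "e \<in> E" for e
    by (rule nondegenerate_height_nonconstant[OF g[OF e]]) (use u e in \<open>simp add: nondegenerate_def\<close>)
  interpret height_function_on_graph \<Gamma> V E g u by unfold_locales (rule nonconst)
  have b: "int (first_betti_number \<Gamma>) + int (card V) = int (card E) + 1"
    using first_betti_number_graph[OF semialgebraic_graph_nonempty[OF \<Gamma>]] by linarith
  have "graph_weight \<Gamma> u = 1 + int (first_betti_number \<Gamma>) \<longleftrightarrow> card {p. local_minimum_on \<Gamma> (\<lambda>x. u \<bullet> x) p} = 1"
  proof
    assume "graph_weight \<Gamma> u = 1 + int (first_betti_number \<Gamma>)"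
    then show "card {p. local_minimum_on \<Gamma> (\<lambda>x. u \<bullet> x) p} = 1" using b graph_weight_eq(2) by linarith
  next
    assume "card {p. local_minimum_on \<Gamma> (\<lambda>x. u \<bullet> x) p} = 1"
    then show "graph_weight \<Gamma> u = 1 + int (first_betti_number \<Gamma>)" using b graph_weight_eq(2) by linarith
  qed
  then show ?thesis by (simp add: card_1_singleton_iff)
qed

lemma connected_half_spaces_if_tight:
  assumes \<Gamma>: "semialgebraic_graph \<Gamma> V E" and tight: "tight_graph \<Gamma> V E" and u: "u \<in> sphere 0 1"
  shows "connected (\<Gamma> \<inter> half_space u c)"
proof (rule ccontr)
  assume disc: "\<not> ?thesis"
  have comp: "compact \<Gamma>" using \<Gamma> by (simp add: semialgebraic_graph_def)
  obtain U1 U2 c0 \<epsilon> where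
    *: "open U1" "open U2" "U1 \<inter> U2 = {}" "\<epsilon> > 0" "\<forall>u' c'. dist u' u < \<epsilon> \<longrightarrow> \<bar>c' - c0\<bar> < \<epsilon> \<longrightarrow>
       \<Gamma> \<inter> half_space u' c' \<subseteq> U1 \<union> U2 \<and> \<Gamma> \<inter> half_space u' c' \<inter> U1 \<noteq> {} \<and> \<Gamma> \<inter> half_space u' c' \<inter> U2 \<noteq> {}"
    by (rule disconnected_half_space_stable[OF comp disc])
  obtain u' where u': "u' \<in> sphere 0 1" "dist u' u < \<epsilon>" "nondegenerate \<Gamma> V E u'"
    using nondegenerate_dense[OF \<Gamma> u *(4)] by blast
  have sep: "\<Gamma> \<inter> half_space u' c0 \<subseteq> U1 \<union> U2" "\<Gamma> \<inter> half_space u' c0 \<inter> U1 \<noteq> {}" "\<Gamma> \<inter> half_space u' c0 \<inter> U2 \<noteq> {}"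
    using *(5)[rule_format, OF u'(2), of c0] *(4) by simp_all
  obtain p1 where p1: "p1 \<in> U1" "local_minimum_on \<Gamma> (\<lambda>x. u' \<bullet> x) p1"
    using minimum_of_separated_part_is_local[OF comp *(1-3) sep(1,2)] by blast
  have "U2 \<inter> U1 = {}" "\<Gamma> \<inter> half_space u' c0 \<subseteq> U2 \<union> U1" using *(3) sep(1) by blast+
  from minimum_of_separated_part_is_local[OF comp *(2,1) this sep(3)]
  obtain p2 where p2: "p2 \<in> U2" "local_minimum_on \<Gamma> (\<lambda>x. u' \<bullet> x) p2" by blast
  have "u' \<in> sphere 0 1 - degenerate_vectors \<Gamma> V E" using u' by (simp add: degenerate_vectors_def)
  then have "graph_weight \<Gamma> u' = 1 + int (first_betti_number \<Gamma>)" using tight by (simp add: tight_graph_def)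
  then obtain p where p: "{p. local_minimum_on \<Gamma> (\<lambda>x. u' \<bullet> x) p} = {p}"
    unfolding graph_weight_tight_iff_unique_minimum[OF \<Gamma> u'(3)] by (rule exE)
  have "p1 \<in> {p}" "p2 \<in> {p}" unfolding p[symmetric] using p1(2) p2(2) by (simp_all only: mem_Collect_eq)
  then have "p1 \<in> U1 \<inter> U2" using p1(1) p2(1) by simp
  then show False using *(3) by simp
qed

lemma tight_if_connected_half_spaces:
  assumes \<Gamma>: "semialgebraic_graph \<Gamma> V E"
    and conn: "\<And>u c. u \<in> sphere 0 1 \<Longrightarrow> connected (\<Gamma> \<inter> half_space u c)"
  shows "tight_graph \<Gamma> V E"
  unfolding tight_graph_def
proof
  fix u assume "u \<in> sphere 0 1 - degenerate_vectors \<Gamma> V E"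
  then have u: "u \<in> sphere 0 1" "nondegenerate \<Gamma> V E u" by (simp_all add: degenerate_vectors_def)
  have comp: "compact \<Gamma>" using \<Gamma> by (simp add: semialgebraic_graph_def)
  let ?M = "{p. local_minimum_on \<Gamma> (\<lambda>x. u \<bullet> x) p}"
  obtain p where p: "p \<in> \<Gamma>" "\<forall>x\<in>\<Gamma>. u \<bullet> p \<le> u \<bullet> x"
    by (rule height_attains_minimum[OF comp semialgebraic_graph_nonempty[OF \<Gamma>], where u = u])
  have unique: "q = p" if q: "local_minimum_on \<Gamma> (\<lambda>x. u \<bullet> x) q" for q
  proof -
    have "q \<in> \<Gamma>" using q unfolding local_minimum_on_def by (rule conjunct1)
    with p(2) have "u \<bullet> p \<le> u \<bullet> q" by (rule bspec)
    from local_minimum_isolated_in_half_space[OF nondegenerate_level_finite[OF \<Gamma> u(2)] q conn[OF u(1)] p(1) this]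
    show ?thesis by (rule sym)
  qed
  have "\<forall>\<^sub>F q in at p within \<Gamma>. u \<bullet> p \<le> u \<bullet> q"
    unfolding eventually_at_filter by (rule always_eventually) (intro allI impI bspec[OF p(2)])
  then have minimum: "local_minimum_on \<Gamma> (\<lambda>x. u \<bullet> x) p"
    unfolding local_minimum_on_def using p(1) by (intro conjI)
  have "?M = {p}"
  proof (intro equalityI subsetI)
    fix q assume "q \<in> ?M"
    then have "q = p" unfolding mem_Collect_eq by (rule unique)
    then show "q \<in> {p}" by (rule ssubst) (rule singletonI)
  next
    fix q assume "q \<in> {p}"
    from singletonD[OF this] show "q \<in> ?M" unfolding mem_Collect_eq by (rule ssubst) (rule minimum)
  qed
  then show "graph_weight \<Gamma> u = 1 + int (first_betti_number \<Gamma>)"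
    unfolding graph_weight_tight_iff_unique_minimum[OF \<Gamma> u(2)] by (rule exI)
qed

theorem proposition1p7:
  fixes \<Gamma> V :: "(real^3) set" and E :: "(real^3) set set"
  assumes "semialgebraic_graph \<Gamma> V E"
  shows "(tight_graph \<Gamma> V E \<longleftrightarrow>
           (AE (u, c) in sphere_measure \<Otimes>\<^sub>M lborel.
              \<Gamma> \<inter> half_space u c = {} \<or> connected (\<Gamma> \<inter> half_space u c))) \<and>
         ((AE (u, c) in sphere_measure \<Otimes>\<^sub>M lborel.
              \<Gamma> \<inter> half_space u c = {} \<or> connected (\<Gamma> \<inter> half_space u c)) \<longleftrightarrow>
           (\<forall>u \<in> sphere 0 1. \<forall>c.
              \<Gamma> \<inter> half_space u c = {} \<or> connected (\<Gamma> \<inter> half_space u c)))"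
    (is "(?a \<longleftrightarrow> ?b) \<and> (?b \<longleftrightarrow> ?c)")
proof -
  have comp: "compact \<Gamma>" using assms by (simp add: semialgebraic_graph_def)
  have ac: "?c" if ?a
    by (intro ballI allI disjI2 connected_half_spaces_if_tight[OF assms that])
  have ca: "?a" if c: ?c
  proof (rule tight_if_connected_half_spaces[OF assms])
    fix u :: "real^3" and c :: real assume "u \<in> sphere 0 1"
    with c have "\<Gamma> \<inter> half_space u c = {} \<or> connected (\<Gamma> \<inter> half_space u c)" by blast
    then show "connected (\<Gamma> \<inter> half_space u c)" by auto
  qed
  have bc: "?c" if ?b
    by (intro ballI allI disjI2 connected_if_almost_all_connected[OF comp _ that])
  have cb: "?b" if c: ?c
  proof (rule AE_I2)
    fix p assume "p \<in> space (sphere_measure \<Otimes>\<^sub>M (lborel :: real measure))"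
    then have "fst p \<in> sphere 0 1" by (auto simp: space_pair_measure space_sphere_measure)
    with c show "case p of (u, c) \<Rightarrow> \<Gamma> \<inter> half_space u c = {} \<or> connected (\<Gamma> \<inter> half_space u c)"
      by (cases p) auto
  qed
  show ?thesis using ac ca bc cb by blast
qed

end
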